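(* Let $\mathbf{X}$ be a Dedekind complete vector lattice, let $\mathbb{R}^+=]0,+\infty[$ be endowed with the metric $d_{\ln}(t_1,t_2)=|\ln t_1-\ln t_2|$ and the measure $\mu(S)=\int_S\frac{dt}{t}$, let $q\in\mathbb{N}$, $q\ge1$, and let $\varphi:\mathbf{X}\to\mathbf{X}$, $\varphi(u)=|u|^q$ (with the convention on powers in the context). Let $$\widetilde K_n(t,u)=\widetilde L_n(t)\,\Upsilon_n(u),\qquad n\in\mathbb{N},\ t\in\mathbb{R}^+,\ u\in\mathbf{X},$$ where $(\widetilde L_n)_n$ is one of the following sequences: (L1) (moment kernel) $\widetilde L_n(t)=n\,t^n\chi_{]0,1[}(t)$; (L2) (Mellin-Gauss-Weierstrass kernel) $\widetilde L_n(t)=\frac{n}{2\sqrt\pi}\,e^{-\frac{n^2}{4}\ln^2 t}$; (L3) (Mellin-Poisson-Cauchy kernel) $\widetilde L_n(t)=C_p\,\dfrac{n}{(1+n^2\ln^2t)^p}$ with $p\in\mathbb{N}$, $p\ge2$ fixed and $C_p=\dfrac{2^{p-1}(p-1)!}{\pi(2p-3)!!}$; and $(\Upsilon_n)_n$ is one of the following: (U1) (linear case) $\Upsilon_n(u)=u$ for all $n\in\mathbb{N}$, $u\in\mathbf{X}$; (U2) (nonlinear case) $\mathbf{X}=L^r([0,1],\Sigma,\nu)$ with $0\le r\le\infty$, where $\nu$ is Lebesgue measure on the $\sigma$-algebra $\Sigma$ of measurable subsets of $[0,1]$, and $\Upsilon_n(u)(x)=\dfrac{n\,u(x)\,|u(x)|}{n\,|u(x)|+1}$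 for $x\in[0,1]$. For $f\in\mathcal{C}_c(\mathbb{R}^+)$ put $$(\widetilde T_nf)(s)=\int_0^{+\infty}\widetilde K_n\Big(\frac ts,f(t)\Big)\frac{dt}{t},\qquad s\in\mathbb{R}^+,\ n\in\mathbb{N}.$$ Then for every $f\in\mathcal{C}_c(\mathbb{R}^+)$ the sequence $(\widetilde T_nf)_n$ is uniformly convergent to $f$ on $\mathbb{R}^+$, that is, $$\ell\Big(\Big(\bigvee_{s\in\mathbb{R}^+}|(\widetilde T_nf)(s)-f(s)|\Big)_n\Big)=0,$$ and it is modularly convergent to $f$ with respect to $\rho^\varphi$, with a constant independent of $f$: there exists $a\in\mathbb{R}^+$ such that for every $f\in\mathcal{C}_c(\mathbb{R}^+)$ $$\ell\big(\big(\rho^\varphi(a(\widetilde T_nf-f))\big)_n\big)=0.$$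
   Context: **Vector lattice.** $\mathbf{X}$ is a Dedekind complete vector lattice, $\mathbf{X}^+$ its positive cone, $|x|=x\vee(-x)$. $\overline{\mathbf{X}}=\mathbf{X}\cup\{+\infty\}$ with the natural extension of order and operations and $0\cdot(+\infty)=0$. $\mathcal{T}$ is the set of all sequences in $\mathbf{X}$, $\mathcal{T}^+$ the set of sequences in $\mathbf{X}^+$. "Definitely" means for all but finitely many $n$. Convention on powers: $|u|^q$ is formed pointwise when $\mathbf{X}$ is a space of functions (in particular $\mathbf{X}=L^r([0,1])$; $L^0$ is the space of all (classes of) measurable functions), and in general with respect to an $f$-algebra multiplication on $\mathbf{X}$; it is understood that $\varphi(u)=|u|^q$ is a well-defined map $\mathbf{X}\to\mathbf{X}$ (automatic for $q=1$). **Convergence.** A convergence on $\mathbf{X}$ is a pair $(\mathcal{S},\ell)$, with $\mathcal{S}$ a linear subspace of $\mathcal{T}$ and $\ell:\mathcal{S}\to\mathbf{X}$ linear and monotone, such that: (a) if $x_n=l$ definitely, then $(x_n)_n\in\mathcal{S}$ and $\ell((x_n)_n)=l$; if $(x_n)_n\in\mathcal{S}$ and $\{n:x_n\ne y_n\}$ is finite, then $(y_n)_n\in\mathcal{S}$ and $\ell((y_n)_n)=\ell((x_n)_n)$; (b) if $(x_n)_n\in\mathcal{S}$, then $(|x_n|)_n\in\mathcal{S}$ and $\ell((|x_n|)_n)=|\ell((x_n)_n)|$; (c) if $(x_n)_n,(z_n)_n\in\mathcal{S}$ have the same $\ell$ and $x_n\le_X y_n\le_X z_n$ definitely, then $(y_n)_n\in\mathcal{S}$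 and $\ell((y_n)_n)$ is the same value; (d) if $u\in\mathbf{X}^+$, then $(\frac1n u)_n\in\mathcal{S}$ and $\ell((\frac1n u)_n)=0$. Writing "$\ell((x_n)_n)=0$" includes that $(x_n)_n\in\mathcal{S}$. There is also a subadditive and monotone function $\overline\ell:\mathcal{T}^+\to\overline{\mathbf{X}}^+$ such that: $\overline\ell((x_n)_n)=\overline\ell((y_n)_n)$ if $x_n=y_n$ definitely; $\overline\ell((x_n)_n)=\ell((x_n)_n)$ if $(x_n)_n\in\mathcal{S}\cap\mathcal{T}^+$; and if $\overline\ell((x_n)_n)=0$ then $(x_n)_n\in\mathcal{S}$ and $\ell((x_n)_n)=0$. Fixed throughout are such $\ell,\overline\ell$ on $\mathbf{X}$ and a convergence $\ell_{\mathbb{R}}$ on $\mathbb{R}$ (with the same axioms), such that, for the scalar multiplication: $\ell((x_n)_n)=0$ and $y\in\mathbb{R}$ imply $\ell((y x_n)_n)=0$; and $x\in\mathbf{X}$, $\ell_{\mathbb{R}}((y_n)_n)=0$ imply $\ell((y_n x)_n)=0$. **Integral.** Let $G=\mathbb{R}^+$, $\mathcal{A}$ the algebra of measurable subsets of $G$, $\mu(S)=\int_S\frac{dt}{t}$. $\mathscr{S}$ is the set of simple functions $f=\sum_{i=1}^k c_i\chi_{A_i}$, $c_i\in\mathbf{X}$, $A_i\in\mathcal{A}$ disjoint with $\mu(A_i)<+\infty$; $\int_A f\,d\mu=\sum_i\mu(A\cap A_i)c_i$. A sequence $(f_n)_n$ of functions $G\to\mathbf{X}$ converges in measure to $f$ on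 $A\in\mathcal{A}$ if there are $A_n\in\mathcal{A}$ with $\ell_{\mathbb{R}}((\mu(A\cap A_n))_n)=0$ and $\ell((\bigvee_{g\in A\setminus A_n}|f_n(g)-f(g)|)_n)=0$. A sequence $(f_n)_n$ in $\mathscr{S}$ is $\mu$-equiabsolutely continuous if (i) $\ell((\int_{A_n}|f_n|\,d\mu)_n)=0$ whenever $\ell_{\mathbb{R}}((\mu(A_n))_n)=0$, and (ii) there is an increasing sequence $(B_m)_m$ in $\mathcal{A}$ with $\mu(B_m)<+\infty$ for all $m$ and $\ell\big(\big(\overline\ell((\int_{G\setminus B_m}|f_n|\,d\mu)_n)\big)_m\big)=0$. A defining sequence for $f$ is a $\mu$-equiabsolutely continuous sequence in $\mathscr{S}$ converging in measure to $f$ on each $A\in\mathcal{A}$ with $\mu(A)<+\infty$. A positive $f:G\to\mathbf{X}$ is integrable if there are a defining sequence $(f_n)_n$ for $f$ and a map $l:\mathcal{A}\to\mathbf{X}$ with $\ell((\bigvee_{A\in\mathcal{A}}|\int_A f_n\,d\mu-l(A)|)_n)=0$; then $\int_A f\,d\mu:=l(A)$. A general $f$ is integrable if $f^+=f\vee0$ and $f^-=(-f)\vee0$ are, and $\int_A f\,d\mu=\int_A f^+d\mu-\int_A f^-d\mu$. Integrals over $]0,+\infty[$ against $\frac{dt}{t}$ are integrals with respect to $\mu$. **Function space and modular.** $\mathcal{C}_c(\mathbb{R}^+)$ is the set of functions $f:\mathbb{R}^+\to\mathbf{X}$ with compact support that are uniformly continuous in the sense that there is $u\in\mathbf{X}^+$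 such that for every $\varepsilon\in\mathbb{R}^+$ there is $\delta\in\mathbb{R}^+$ with $|f(g_1)-f(g_2)|\leq_X\varepsilon u$ whenever $d_{\ln}(g_1,g_2)\le\delta$. The modular is $\rho^\varphi(f)=\int_G\varphi(|f(g)|)\,d\mu(g)$ (defined in $\mathbf{X}$ when the integral exists), and the Orlicz space is $L^\varphi(G)=\{f\in\mathbf{X}^G:\bigwedge_{a\in\mathbb{R}^+}\rho^\varphi(af)=0\}$. A sequence $(f_n)_n$ in $L^\varphi(G)$ is modularly convergent to $f\in L^\varphi(G)$ if there is $a\in\mathbb{R}^+$ with $\ell((\rho^\varphi(a(f_n-f)))_n)=0$. For an odd integer $k\ge1$, $k!!=k(k-2)\cdots3\cdot1$. *)

theory Defs
  imports "HOL-Analysis.Analysis" "HOL-Library.Lattice_Algebras" "HOL-Library.Extended"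
begin

section \<open>Vector lattices\<close>

text \<open>Dedekind completeness is the conditional completeness of
  \<^class>\<open>conditionally_complete_lattice\<close>; \<^class>\<open>lattice_ab_group_add_abs\<close> says
  that \<open>\<bar>x\<bar> = sup x (- x)\<close>.\<close>

class dedekind_complete_vector_lattice =
  ordered_real_vector + conditionally_complete_lattice + lattice_ab_group_add_abs

instance real :: dedekind_complete_vector_lattice
  by standard (auto simp: sup_real_def abs_real_def max_def)

text \<open>A representation of \<open>'x\<close> as a space of (classes of) real functions on \<open>M\<close>: \<open>F\<close> is the set of
  representatives, \<open>cls h\<close> the element represented by \<open>h\<close>, and two representatives are identified iff
  they agree almost everywhere. Genuine functions are the case of a counting measure.\<close>

definition function_space ::
  "'w measure \<Rightarrow> ('w \<Rightarrow> real) set \<Rightarrow> (('w \<Rightarrow> real) \<Rightarrow> 'x::dedekind_complete_vector_lattice) \<Rightarrow> bool" where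
  "function_space M F cls \<longleftrightarrow>
     (\<forall>h\<in>F. \<forall>k\<in>F. (\<lambda>w. h w + k w) \<in> F \<and> cls (\<lambda>w. h w + k w) = cls h + cls k) \<and>
     (\<forall>c. \<forall>h\<in>F. (\<lambda>w. c * h w) \<in> F \<and> cls (\<lambda>w. c * h w) = c *\<^sub>R cls h) \<and>
     (\<forall>h\<in>F. (\<lambda>w. \<bar>h w\<bar>) \<in> F) \<and>
     cls ` F = UNIV \<and>
     (\<forall>h\<in>F. \<forall>k\<in>F. cls h \<le> cls k \<longleftrightarrow> (AE w in M. h w \<le> k w))"

definition Lr_functions :: "ennreal \<Rightarrow> (real \<Rightarrow> real) set" where
  "Lr_functions r = {h \<in> borel_measurable (lebesgue_on {0..1}).
     (r = top \<longrightarrow> (\<exists>B. AE x in lebesgue_on {0..1}. \<bar>h x\<bar> \<le> B)) \<and>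
     (0 < r \<and> r < top \<longrightarrow> integrable (lebesgue_on {0..1}) (\<lambda>x. \<bar>h x\<bar> powr enn2real r))}"

text \<open>\<open>'x\<close> is \<open>L\<^sup>r([0,1])\<close>, for \<open>0 \<le> r \<le> \<infinity>\<close>, with \<open>cls h\<close> the class of \<open>h\<close>. As \<open>r\<close> is a value and
  cannot index a type, the type is pinned down only up to the isomorphism \<open>cls\<close>.\<close>

definition is_Lr :: "ennreal \<Rightarrow> ((real \<Rightarrow> real) \<Rightarrow> 'x::dedekind_complete_vector_lattice) \<Rightarrow> bool" where
  "is_Lr r cls \<longleftrightarrow> function_space (lebesgue_on {0..1}) (Lr_functions r) cls"

definition f_algebra_mult ::
  "('x::dedekind_complete_vector_lattice \<Rightarrow> 'x \<Rightarrow> 'x) \<Rightarrow> bool" where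
  "f_algebra_mult m \<longleftrightarrow> bilinear m \<and>
     (\<forall>x y z. m (m x y) z = m x (m y z)) \<and>
     (\<forall>x y. 0 \<le> x \<longrightarrow> 0 \<le> y \<longrightarrow> 0 \<le> m x y) \<and>
     (\<forall>x y z. inf x y = 0 \<longrightarrow> 0 \<le> z \<longrightarrow> inf (m z x) y = 0 \<and> inf (m x z) y = 0)"

text \<open>The map \<open>u \<mapsto> \<bar>u\<bar>\<^sup>q\<close>, \<open>q \<ge> 1\<close>, for an \<open>f\<close>-algebra multiplication (no unit is needed) and
  for pointwise powers. In the pointwise case the powers are required to stay in the space.\<close>

definition f_algebra_power ::
  "('x::dedekind_complete_vector_lattice \<Rightarrow> 'x \<Rightarrow> 'x) \<Rightarrow> nat \<Rightarrow> ('x \<Rightarrow> 'x) \<Rightarrow> bool" where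
  "f_algebra_power m q \<phi> \<longleftrightarrow> (\<forall>u. \<phi> u = (m \<bar>u\<bar> ^^ (q - 1)) \<bar>u\<bar>)"

definition pointwise_power ::
  "('w \<Rightarrow> real) set \<Rightarrow> (('w \<Rightarrow> real) \<Rightarrow> 'x) \<Rightarrow> nat \<Rightarrow> ('x \<Rightarrow> 'x) \<Rightarrow> bool" where
  "pointwise_power F cls q \<phi> \<longleftrightarrow>
     (\<forall>h\<in>F. (\<lambda>w. \<bar>h w\<bar> ^ q) \<in> F \<and> \<phi> (cls h) = cls (\<lambda>w. \<bar>h w\<bar> ^ q))"


section \<open>Abstract convergences\<close>

record 'x convergence =
  conv_seqs :: "(nat \<Rightarrow> 'x) set"
  conv_lim :: "(nat \<Rightarrow> 'x) \<Rightarrow> 'x"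

definition null_seq :: "'x::zero convergence \<Rightarrow> (nat \<Rightarrow> 'x) \<Rightarrow> bool" where
  "null_seq C x \<longleftrightarrow> x \<in> conv_seqs C \<and> conv_lim C x = 0"

text \<open>Sequences are indexed from 0. Division by 0 makes the 0-th term of
  \<open>(1/n) u\<close> equal to 0; by axiom (a) a single term is immaterial.\<close>

definition is_convergence :: "'x::dedekind_complete_vector_lattice convergence \<Rightarrow> bool" where
  "is_convergence C \<longleftrightarrow>
     \<comment> \<open>linear subspace, linear monotone map\<close>
     (\<forall>x\<in>conv_seqs C. \<forall>y\<in>conv_seqs C. (\<lambda>n. x n + y n) \<in> conv_seqs C \<and>
        conv_lim C (\<lambda>n. x n + y n) = conv_lim C x + conv_lim C y) \<and>
     (\<forall>c. \<forall>x\<in>conv_seqs C. (\<lambda>n. c *\<^sub>R x n) \<in> conv_seqs C \<and>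
        conv_lim C (\<lambda>n. c *\<^sub>R x n) = c *\<^sub>R conv_lim C x) \<and>
     (\<forall>x\<in>conv_seqs C. \<forall>y\<in>conv_seqs C. (\<forall>n. x n \<le> y n) \<longrightarrow> conv_lim C x \<le> conv_lim C y) \<and>
     \<comment> \<open>(a)\<close>
     (\<forall>x l. (\<forall>\<^sub>F n in sequentially. x n = l) \<longrightarrow> x \<in> conv_seqs C \<and> conv_lim C x = l) \<and>
     (\<forall>x\<in>conv_seqs C. \<forall>y. finite {n. x n \<noteq> y n} \<longrightarrow>
        y \<in> conv_seqs C \<and> conv_lim C y = conv_lim C x) \<and>
     \<comment> \<open>(b)\<close>
     (\<forall>x\<in>conv_seqs C. (\<lambda>n. \<bar>x n\<bar>) \<in> conv_seqs C \<and>
        conv_lim C (\<lambda>n. \<bar>x n\<bar>) = \<bar>conv_lim C x\<bar>) \<and>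
     \<comment> \<open>(c)\<close>
     (\<forall>x\<in>conv_seqs C. \<forall>z\<in>conv_seqs C. \<forall>y. conv_lim C x = conv_lim C z \<longrightarrow>
        (\<forall>\<^sub>F n in sequentially. x n \<le> y n \<and> y n \<le> z n) \<longrightarrow>
        y \<in> conv_seqs C \<and> conv_lim C y = conv_lim C x) \<and>
     \<comment> \<open>(d)\<close>
     (\<forall>u\<ge>0. null_seq C (\<lambda>n. (1 / real n) *\<^sub>R u))"

text \<open>Values in \<open>'x \<union> {+\<infinity>}\<close> are modelled by \<^typ>\<open>'x extended\<close>; the value \<^const>\<open>Minf\<close> is excluded
  because the values are required to be nonnegative.\<close>

definition is_upper_limit ::
  "'x::dedekind_complete_vector_lattice convergence \<Rightarrow> ((nat \<Rightarrow> 'x) \<Rightarrow> 'x extended) \<Rightarrow> bool" where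
  "is_upper_limit C lb \<longleftrightarrow>
     (let T = {x. \<forall>n. 0 \<le> x n} in
       (\<forall>x\<in>T. 0 \<le> lb x) \<and>
       (\<forall>x\<in>T. \<forall>y\<in>T. lb (\<lambda>n. x n + y n) \<le> lb x + lb y) \<and>
       (\<forall>x\<in>T. \<forall>y\<in>T. (\<forall>n. x n \<le> y n) \<longrightarrow> lb x \<le> lb y) \<and>
       (\<forall>x\<in>T. \<forall>y\<in>T. (\<forall>\<^sub>F n in sequentially. x n = y n) \<longrightarrow> lb x = lb y) \<and>
       (\<forall>x\<in>T \<inter> conv_seqs C. lb x = Fin (conv_lim C x)) \<and>
       (\<forall>x\<in>T. lb x = 0 \<longrightarrow> null_seq C x))"

definition convergence_setting ::
  "'x::dedekind_complete_vector_lattice convergence \<Rightarrow> ((nat \<Rightarrow> 'x) \<Rightarrow> 'x extended)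
    \<Rightarrow> real convergence \<Rightarrow> bool" where
  "convergence_setting C lb R \<longleftrightarrow>
     is_convergence C \<and> is_upper_limit C lb \<and> is_convergence R \<and>
     (\<forall>x y. null_seq C x \<longrightarrow> null_seq C (\<lambda>n. (y::real) *\<^sub>R x n)) \<and>
     (\<forall>x y. null_seq R y \<longrightarrow> null_seq C (\<lambda>n. y n *\<^sub>R x))"

text \<open>\<open>\<ell>((\<Or> V\<^sub>n)\<^sub>n) = 0\<close> for sets \<open>V\<^sub>n\<close> of nonnegative elements, including the existence of the
  suprema. They are taken in the positive cone, so that the supremum of the empty set is 0.\<close>

definition sup_null ::
  "'x::dedekind_complete_vector_lattice convergence \<Rightarrow> (nat \<Rightarrow> 'x set) \<Rightarrow> bool" where
  "sup_null C V \<longleftrightarrow> (\<forall>n. bdd_above (V n)) \<and> null_seq C (\<lambda>n. Sup (insert 0 (V n)))"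


section \<open>The integral\<close>

text \<open>Functions on the half-line \<open>]0,+\<infinity>[\<close> are functions on \<^typ>\<open>real\<close> of which only the values
  on \<^term>\<open>{0::real<..}\<close> matter.\<close>

definition mellin_measure :: "real measure" where
  "mellin_measure = density (lebesgue_on {0<..}) (\<lambda>t. ennreal (1 / t))"

definition d_ln :: "real \<Rightarrow> real \<Rightarrow> real" where
  "d_ln s t = \<bar>ln s - ln t\<bar>"

definition fin_sets :: "real set set" where
  "fin_sets = {A \<in> sets mellin_measure. emeasure mellin_measure A < top}"

definition simple_fun :: "(real \<Rightarrow> 'x::dedekind_complete_vector_lattice) \<Rightarrow> bool" where
  "simple_fun f \<longleftrightarrow> (\<exists>(k::nat) c A. (\<forall>i<k. A i \<in> fin_sets) \<and> disjoint_family_on A {..<k} \<and>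
     (\<forall>g>0. f g = (\<Sum>i<k. indicat_real (A i) g *\<^sub>R c i)))"

text \<open>The sum is taken over the canonical representation, with one set for each nonzero value.\<close>

definition simple_int ::
  "(real \<Rightarrow> 'x::dedekind_complete_vector_lattice) \<Rightarrow> real set \<Rightarrow> 'x" where
  "simple_int f A = (\<Sum>c \<in> f ` {0<..} - {0}. measure mellin_measure (A \<inter> {g. 0 < g \<and> f g = c}) *\<^sub>R c)"

definition converges_in_measure ::
  "'x::dedekind_complete_vector_lattice convergence \<Rightarrow> real convergence \<Rightarrow>
   real set \<Rightarrow> (nat \<Rightarrow> real \<Rightarrow> 'x) \<Rightarrow> (real \<Rightarrow> 'x) \<Rightarrow> bool" where
  "converges_in_measure C R A fs f \<longleftrightarrow>
     (\<exists>B. (\<forall>n. B n \<in> sets mellin_measure \<and> A \<inter> B n \<in> fin_sets) \<and>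
        null_seq R (\<lambda>n. measure mellin_measure (A \<inter> B n)) \<and>
        sup_null C (\<lambda>n. (\<lambda>g. \<bar>fs n g - f g\<bar>) ` (A - B n)))"

definition equi_abs_continuous ::
  "'x::dedekind_complete_vector_lattice convergence \<Rightarrow> ((nat \<Rightarrow> 'x) \<Rightarrow> 'x extended) \<Rightarrow>
   real convergence \<Rightarrow> (nat \<Rightarrow> real \<Rightarrow> 'x) \<Rightarrow> bool" where
  "equi_abs_continuous C lb R fs \<longleftrightarrow>
     (\<forall>A. (\<forall>n. A n \<in> fin_sets) \<and> null_seq R (\<lambda>n. measure mellin_measure (A n)) \<longrightarrow>
        null_seq C (\<lambda>n. simple_int (\<lambda>g. \<bar>fs n g\<bar>) (A n))) \<and>
     (\<exists>B b. incseq B \<and> (\<forall>m. B m \<in> fin_sets) \<and>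
        (\<forall>m. lb (\<lambda>n. simple_int (\<lambda>g. \<bar>fs n g\<bar>) ({0<..} - B m)) = Fin (b m)) \<and>
        null_seq C b)"

definition defining_sequence ::
  "'x::dedekind_complete_vector_lattice convergence \<Rightarrow> ((nat \<Rightarrow> 'x) \<Rightarrow> 'x extended) \<Rightarrow>
   real convergence \<Rightarrow> (nat \<Rightarrow> real \<Rightarrow> 'x) \<Rightarrow> (real \<Rightarrow> 'x) \<Rightarrow> bool" where
  "defining_sequence C lb R fs f \<longleftrightarrow>
     (\<forall>n. simple_fun (fs n)) \<and> equi_abs_continuous C lb R fs \<and>
     (\<forall>A\<in>fin_sets. converges_in_measure C R A fs f)"

definition has_pos_integral ::
  "'x::dedekind_complete_vector_lattice convergence \<Rightarrow> ((nat \<Rightarrow> 'x) \<Rightarrow> 'x extended) \<Rightarrow>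
   real convergence \<Rightarrow> (real \<Rightarrow> 'x) \<Rightarrow> (real set \<Rightarrow> 'x) \<Rightarrow> bool" where
  "has_pos_integral C lb R f l \<longleftrightarrow>
     (\<forall>g>0. 0 \<le> f g) \<and>
     (\<exists>fs. defining_sequence C lb R fs f \<and>
        sup_null C (\<lambda>n. (\<lambda>A. \<bar>simple_int (fs n) A - l A\<bar>) ` sets mellin_measure))"

definition vl_integrable ::
  "'x::dedekind_complete_vector_lattice convergence \<Rightarrow> ((nat \<Rightarrow> 'x) \<Rightarrow> 'x extended) \<Rightarrow>
   real convergence \<Rightarrow> (real \<Rightarrow> 'x) \<Rightarrow> bool" where
  "vl_integrable C lb R f \<longleftrightarrow>
     (\<exists>l. has_pos_integral C lb R (\<lambda>g. sup (f g) 0) l) \<and>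
     (\<exists>l. has_pos_integral C lb R (\<lambda>g. sup (- f g) 0) l)"

text \<open>The set function \<open>l\<close> is determined on measurable sets only, hence the description ranges over
  the value \<open>l A\<close>.\<close>

definition pos_integral ::
  "'x::dedekind_complete_vector_lattice convergence \<Rightarrow> ((nat \<Rightarrow> 'x) \<Rightarrow> 'x extended) \<Rightarrow>
   real convergence \<Rightarrow> (real \<Rightarrow> 'x) \<Rightarrow> real set \<Rightarrow> 'x" where
  "pos_integral C lb R f A = (THE v. \<exists>l. has_pos_integral C lb R f l \<and> l A = v)"

definition vl_integral ::
  "'x::dedekind_complete_vector_lattice convergence \<Rightarrow> ((nat \<Rightarrow> 'x) \<Rightarrow> 'x extended) \<Rightarrow>
   real convergence \<Rightarrow> (real \<Rightarrow> 'x) \<Rightarrow> real set \<Rightarrow> 'x" where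
  "vl_integral C lb R f A =
     pos_integral C lb R (\<lambda>g. sup (f g) 0) A - pos_integral C lb R (\<lambda>g. sup (- f g) 0) A"


section \<open>Function space and modular\<close>

definition Cc :: "(real \<Rightarrow> 'x::dedekind_complete_vector_lattice) set" where
  "Cc = {f. (\<exists>K. compact K \<and> K \<subseteq> {0<..} \<and> (\<forall>t\<in>{0<..} - K. f t = 0)) \<and>
     (\<exists>u\<ge>0. \<forall>\<epsilon>>0. \<exists>\<delta>>0. \<forall>s>0. \<forall>t>0. d_ln s t \<le> \<delta> \<longrightarrow> \<bar>f s - f t\<bar> \<le> \<epsilon> *\<^sub>R u)}"

definition modular_defined ::
  "'x::dedekind_complete_vector_lattice convergence \<Rightarrow> ((nat \<Rightarrow> 'x) \<Rightarrow> 'x extended) \<Rightarrow>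
   real convergence \<Rightarrow> ('x \<Rightarrow> 'x) \<Rightarrow> (real \<Rightarrow> 'x) \<Rightarrow> bool" where
  "modular_defined C lb R \<phi> f \<longleftrightarrow> vl_integrable C lb R (\<lambda>g. \<phi> \<bar>f g\<bar>)"

definition modular ::
  "'x::dedekind_complete_vector_lattice convergence \<Rightarrow> ((nat \<Rightarrow> 'x) \<Rightarrow> 'x extended) \<Rightarrow>
   real convergence \<Rightarrow> ('x \<Rightarrow> 'x) \<Rightarrow> (real \<Rightarrow> 'x) \<Rightarrow> 'x" where
  "modular C lb R \<phi> f = vl_integral C lb R (\<lambda>g. \<phi> \<bar>f g\<bar>) {0<..}"

text \<open>The infimum ranges over those \<open>a\<close> for which the modular is defined (it would be \<open>+\<infinity>\<close> for the
  others).\<close>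

definition orlicz_space ::
  "'x::dedekind_complete_vector_lattice convergence \<Rightarrow> ((nat \<Rightarrow> 'x) \<Rightarrow> 'x extended) \<Rightarrow>
   real convergence \<Rightarrow> ('x \<Rightarrow> 'x) \<Rightarrow> (real \<Rightarrow> 'x) set" where
  "orlicz_space C lb R \<phi> = {f.
     let V = {modular C lb R \<phi> (\<lambda>g. a *\<^sub>R f g) | a.
                0 < a \<and> modular_defined C lb R \<phi> (\<lambda>g. a *\<^sub>R f g)}
     in V \<noteq> {} \<and> bdd_below V \<and> Inf V = 0}"

definition modularly_convergent_with ::
  "'x::dedekind_complete_vector_lattice convergence \<Rightarrow> ((nat \<Rightarrow> 'x) \<Rightarrow> 'x extended) \<Rightarrow>
   real convergence \<Rightarrow> ('x \<Rightarrow> 'x) \<Rightarrow> real \<Rightarrow> (nat \<Rightarrow> real \<Rightarrow> 'x) \<Rightarrow> (real \<Rightarrow> 'x) \<Rightarrow> bool" where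
  "modularly_convergent_with C lb R \<phi> a fs f \<longleftrightarrow>
     (\<forall>n. fs n \<in> orlicz_space C lb R \<phi>) \<and> f \<in> orlicz_space C lb R \<phi> \<and>
     (\<forall>n. modular_defined C lb R \<phi> (\<lambda>g. a *\<^sub>R (fs n g - f g))) \<and>
     null_seq C (\<lambda>n. modular C lb R \<phi> (\<lambda>g. a *\<^sub>R (fs n g - f g)))"


section \<open>Kernels and operators\<close>

text \<open>All three kernels vanish identically for \<open>n = 0\<close>.\<close>

definition moment_kernel :: "nat \<Rightarrow> real \<Rightarrow> real" where
  "moment_kernel n t = real n * t ^ n * indicat_real {0<..<1} t"

definition gauss_weierstrass_kernel :: "nat \<Rightarrow> real \<Rightarrow> real" where
  "gauss_weierstrass_kernel n t = real n / (2 * sqrt pi) * exp (- ((real n)\<^sup>2 / 4 * (ln t)\<^sup>2))"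

fun double_fact :: "nat \<Rightarrow> nat" where
  "double_fact 0 = 1"
| "double_fact (Suc 0) = 1"
| "double_fact (Suc (Suc n)) = Suc (Suc n) * double_fact n"

definition poisson_cauchy_const :: "nat \<Rightarrow> real" where
  "poisson_cauchy_const p = 2 ^ (p - 1) * fact (p - 1) / (pi * real (double_fact (2 * p - 3)))"

definition poisson_cauchy_kernel :: "nat \<Rightarrow> nat \<Rightarrow> real \<Rightarrow> real" where
  "poisson_cauchy_kernel p n t =
     poisson_cauchy_const p * (real n / (1 + (real n)\<^sup>2 * (ln t)\<^sup>2) ^ p)"

definition product_kernel ::
  "(nat \<Rightarrow> real \<Rightarrow> real) \<Rightarrow> (nat \<Rightarrow> 'x \<Rightarrow> 'x) \<Rightarrow> nat \<Rightarrow> real \<Rightarrow> 'x::real_vector \<Rightarrow> 'x" where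
  "product_kernel L \<Upsilon> n t u = L n t *\<^sub>R \<Upsilon> n u"

definition mellin_operator ::
  "'x::dedekind_complete_vector_lattice convergence \<Rightarrow> ((nat \<Rightarrow> 'x) \<Rightarrow> 'x extended) \<Rightarrow>
   real convergence \<Rightarrow> (nat \<Rightarrow> real \<Rightarrow> 'x \<Rightarrow> 'x) \<Rightarrow> (real \<Rightarrow> 'x) \<Rightarrow> nat \<Rightarrow> real \<Rightarrow> 'x" where
  "mellin_operator C lb R K f n s = vl_integral C lb R (\<lambda>t. K n (t / s) (f t)) {0<..}"

end

theory Submission
  imports Defs "HOL-Probability.Distributions"
begin

text \<open>Every integral in the statement is computed with respect to a single vector \<open>w \<ge> 0\<close>: a
  function \<open>h\<close> that is approximated by simple functions \<open>g\<close> with \<open>\<bar>g - h\<bar> \<le> k w\<close>, where the real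
  functions \<open>k\<close> are small both uniformly and in \<open>L\<^sup>1(\<mu>)\<close>, has a defining sequence, and the vector
  estimates for its integral reduce to real integrals times \<open>w\<close>. In logarithmic coordinates each of
  the three kernels is \<open>n \<psi>(n x)\<close> for a bounded probability density \<open>\<psi>\<close>, so the operators are
  convolutions with an approximate identity; uniform convergence follows from the modulus of
  continuity of \<open>f\<close> and the vanishing mass of the tails. Away from the support of \<open>f\<close>, Fubini's
  theorem bounds the \<open>L\<^sup>1\<close> mass of the operators by that of the tails of the kernel, which gives the
  modular convergence because \<open>\<phi>\<close> is locally Lipschitz with an order bound.\<close>

section \<open>Vector lattices\<close>

text \<open>The space carries no norm or topology, so neither a vector-valued dominated convergence
  theorem nor a vector-valued Fubini theorem can be invoked. Dedekind completeness compensates: it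
  gives the Archimedean property and the existence of relatively uniform limits, so that limits are
  replaced by inequalities up to \<open>e *\<^sub>R w\<close> for every \<open>e > 0\<close>.
  Smallness is required in two senses because the half-line has infinite measure: the uniform bound
  serves convergence in measure and sets of small measure, the integral bound serves the tails and
  the uniformity over all measurable sets. As the integral is a definite description, its values
  become available only after uniqueness is known for arbitrary defining sequences. Membership of
  the operators in the Orlicz space requires their integrability in the outer variable. Instead of
  exchanging vector integrals, the input is replaced by step functions, whose convolutions are
  finite sums of scalar convolutions times vectors. The nonlinear factors are Lipschitz uniformly in
  n and differ from the identity by at most a fixed vector divided by n, so they can be moved into
  the function that is convolved.\<close>

lemma archimedean_le_0:
  fixes x w :: "'x::dedekind_complete_vector_lattice"
  assumes w: "0 \<le> w" and le: "\<And>e::real. 0 < e \<Longrightarrow> x \<le> e *\<^sub>R w"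
  shows "x \<le> 0"
proof -
  define y where "y = sup x 0"
  have y: "0 \<le> y" and y_le: "y \<le> e *\<^sub>R w" if "0 < e" for e :: real
    using le[OF that] w that by (auto simp: y_def scaleR_nonneg_nonneg)
  have y0: "0 \<le> y" by (simp add: y_def)
  let ?S = "range (\<lambda>n::nat. real n *\<^sub>R y)"
  have bdd: "real n *\<^sub>R y \<le> w" for n :: nat
  proof (cases "n = 0")
    case False
    then have "real n *\<^sub>R y \<le> real n *\<^sub>R (1 / real n) *\<^sub>R w"
      by (intro scaleR_left_mono y_le) auto
    with False show ?thesis by simp
  qed (use w in auto)
  then have B: "bdd_above ?S" by (auto simp: bdd_above_def)
  \<comment> \<open>Adding \<open>y\<close> maps the set of multiples into itself, so every multiple
    stays below the supremum minus \<open>y\<close>.\<close>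
  have "Sup ?S \<le> Sup ?S - y"
  proof (rule cSup_least)
    fix z assume "z \<in> ?S"
    then obtain n :: nat where z: "z = real n *\<^sub>R y" by auto
    have "real (Suc n) *\<^sub>R y \<le> Sup ?S" by (rule cSup_upper[OF _ B]) (rule rangeI)
    then show "z \<le> Sup ?S - y" by (simp add: z le_diff_eq scaleR_left_distrib add.commute)
  qed auto
  then have "y \<le> 0" by simp
  then show ?thesis by (simp add: y_def)
qed

lemma archimedean_eq:
  fixes x y w :: "'x::dedekind_complete_vector_lattice"
  assumes "0 \<le> w" and "\<And>e::real. 0 < e \<Longrightarrow> \<bar>x - y\<bar> \<le> e *\<^sub>R w"
  shows "x = y"
  using archimedean_le_0[OF assms] by auto

lemma archimedean_le:
  fixes x y w :: "'x::dedekind_complete_vector_lattice"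
  assumes "0 \<le> w" and "\<And>e::real. 0 < e \<Longrightarrow> x \<le> y + e *\<^sub>R w"
  shows "x \<le> y"
  using archimedean_le_0[of w "x - y"] assms by (simp add: algebra_simps)

lemma scaleR_sup_right:
  fixes x y :: "'x::dedekind_complete_vector_lattice"
  assumes "0 \<le> (a::real)"
  shows "a *\<^sub>R sup x y = sup (a *\<^sub>R x) (a *\<^sub>R y)"
proof (cases "a = 0")
  case False
  with assms have a: "0 < a" by simp
  show ?thesis
  proof (rule antisym)
    have "sup x y \<le> sup (a *\<^sub>R x) (a *\<^sub>R y) /\<^sub>R a"
      using a by (auto simp: pos_le_divideR_eq)
    then show "a *\<^sub>R sup x y \<le> sup (a *\<^sub>R x) (a *\<^sub>R y)"
      by (simp only: pos_le_divideR_eq[OF a])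
  qed (use a in \<open>auto intro!: scaleR_left_mono\<close>)
qed simp

lemma abs_scaleR_vl: "\<bar>a *\<^sub>R x\<bar> = \<bar>a\<bar> *\<^sub>R \<bar>x\<bar>"
  for x :: "'x::dedekind_complete_vector_lattice" and a :: real
proof -
  have *: "\<bar>b *\<^sub>R x\<bar> = b *\<^sub>R \<bar>x\<bar>" if "0 \<le> b" for b :: real
    using scaleR_sup_right[OF that, of x "- x"] by (simp add: abs_lattice)
  show ?thesis
    using *[of a] *[of "- a"] by (cases "0 \<le> a") auto
qed

lemma abs_diff_le: "\<bar>x - y\<bar> \<le> z \<longleftrightarrow> x \<le> y + z \<and> y \<le> x + z"
  for x :: "'x::dedekind_complete_vector_lattice"
  by (auto simp: abs_le_iff algebra_simps)

lemma abs_diff_triangle: "\<bar>x - z\<bar> \<le> \<bar>x - y\<bar> + \<bar>y - z\<bar>"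
  for x :: "'x::dedekind_complete_vector_lattice"
  using abs_triangle_ineq[of "x - y" "y - z"] by simp

text \<open>Nonexpansiveness of the supremum with a fixed element lets approximations pass to
  positive parts, on which the integral is defined.\<close>

lemma abs_sup_diff_le: "\<bar>sup x z - sup y z\<bar> \<le> \<bar>x - y\<bar>"
  for x :: "'x::dedekind_complete_vector_lattice"
proof -
  have *: "sup x z \<le> sup y z + \<bar>x - y\<bar>" for x y :: 'x
  proof (rule sup_least)
    have "x \<le> y + \<bar>x - y\<bar>" using abs_ge_self[of "x - y"] by (simp add: algebra_simps)
    also have "\<dots> \<le> sup y z + \<bar>x - y\<bar>" by (intro add_right_mono) simp
    finally show "x \<le> sup y z + \<bar>x - y\<bar>" .
    show "z \<le> sup y z + \<bar>x - y\<bar>" by (intro add_increasing2) auto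
  qed
  show ?thesis
    unfolding abs_diff_le using *[of x y] *[of y x] by (simp add: abs_minus_commute)
qed

text \<open>The limit is the supremum of the lower bounds \<open>a n - e n *\<^sub>R w\<close>, each
  of which lies below every upper bound \<open>a m + e m *\<^sub>R w\<close>. The rate of the Cauchy
  estimate is inherited without loss.\<close>

lemma relatively_uniform_Cauchy:
  fixes a :: "nat \<Rightarrow> 'x::dedekind_complete_vector_lattice" and e :: "nat \<Rightarrow> real"
  assumes "\<And>n m. \<bar>a n - a m\<bar> \<le> (e n + e m) *\<^sub>R w"
  shows "\<exists>l. \<forall>n. \<bar>a n - l\<bar> \<le> e n *\<^sub>R w"
proof -
  have *: "a n - e n *\<^sub>R w \<le> a m + e m *\<^sub>R w" for n m
  proof -
    have "a n - a m \<le> (e n + e m) *\<^sub>R w"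
      using assms abs_ge_self order_trans by blast
    then show ?thesis by (simp add: algebra_simps)
  qed
  let ?S = "range (\<lambda>n. a n - e n *\<^sub>R w)"
  have B: "bdd_above ?S" using *[of _ 0] by (auto simp: bdd_above_def)
  have "a n - e n *\<^sub>R w \<le> Sup ?S" for n by (rule cSup_upper[OF _ B]) auto
  moreover have "Sup ?S \<le> a n + e n *\<^sub>R w" for n by (rule cSup_least) (use * in auto)
  ultimately have "\<bar>a n - Sup ?S\<bar> \<le> e n *\<^sub>R w" for n
    by (simp add: abs_diff_le algebra_simps)
  then show ?thesis by blast
qed

section \<open>Simple functions\<close>

abbreviation MM :: "real measure" where "MM \<equiv> mellin_measure"

lemma space_mellin [simp]: "space MM = {0<..}"
  by (simp add: mellin_measure_def)

lemma mellin_sets_greaterThan [simp]: "{0<..} \<in> sets MM"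
  using sets.top[of MM] by simp

lemma mellin_sets_subset: "A \<in> sets MM \<Longrightarrow> A \<subseteq> {0<..}"
  using sets.sets_into_space[of A MM] by simp

text \<open>The simple integral of the Bochner theory makes sense in any real vector space. This
  identification gives access to its linearity for values in the lattice.\<close>

lemma simple_bochner_integrable_iff_simple_fun:
  "Bochner_Integration.simple_bochner_integrable MM f \<longleftrightarrow> simple_fun f"
proof
  assume "Bochner_Integration.simple_bochner_integrable MM f"
  then have f: "simple_function MM f" and fin: "emeasure MM {t \<in> {0<..}. f t \<noteq> 0} \<noteq> \<infinity>"
    by (auto simp: simple_bochner_integrable.simps)
  let ?V = "f ` {0<..} - {0}"
  have finV: "finite ?V" using f by (auto simp: simple_function_def)
  then obtain c where c: "bij_betw c {..<card ?V} ?V"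
    using bij_betw_from_nat_into_finite by blast
  define A where "A = (\<lambda>i. f -` {c i} \<inter> {0<..})"
  have cV: "c i \<in> ?V" if "i < card ?V" for i using c that by (auto simp: bij_betw_def)
  have "A i \<in> fin_sets" if "i < card ?V" for i
  proof -
    have "A i \<in> sets MM" using f cV[OF that] by (auto simp: A_def simple_function_def)
    moreover have "emeasure MM (A i) \<le> emeasure MM {t \<in> {0<..}. f t \<noteq> 0}"
    proof (rule emeasure_mono)
      show "{t \<in> {0<..}. f t \<noteq> 0} \<in> sets MM"
        using simple_functionD(2)[OF f, of "- {0}"] by (simp add: vimage_def Int_def conj_commute)
    qed (use cV[OF that] in \<open>auto simp: A_def\<close>)
    ultimately show ?thesis using fin by (auto simp: fin_sets_def less_top top_unique)
  qed
  moreover have "disjoint_family_on A {..<card ?V}"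
    using c by (auto simp: disjoint_family_on_def A_def bij_betw_def inj_on_def)
  moreover have "f t = (\<Sum>i<card ?V. indicat_real (A i) t *\<^sub>R c i)" if "0 < t" for t
  proof -
    have "(\<Sum>i<card ?V. indicat_real (A i) t *\<^sub>R c i) = (\<Sum>v\<in>?V. of_bool (f t = v) *\<^sub>R v)"
      using sum.reindex_bij_betw[OF c, of "\<lambda>v. of_bool (f t = v) *\<^sub>R v"] that
      by (auto simp: A_def indicator_def of_bool_def intro!: sum.cong elim!: back_subst[of "\<lambda>x. x = _"])
    also have "\<dots> = (\<Sum>v\<in>?V. if v = f t then v else 0)"
      by (intro sum.cong) auto
    also have "\<dots> = f t" using that finV by (subst sum.delta) auto
    finally show ?thesis by simp
  qed
  ultimately show "simple_fun f" unfolding simple_fun_def by (intro exI[of _ "card ?V"] exI[of _ c] exI[of _ A]) blast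
next
  assume "simple_fun f"
  then obtain k :: nat and c A where A: "\<And>i. i < k \<Longrightarrow> A i \<in> fin_sets"
    and f: "\<And>t. 0 < t \<Longrightarrow> f t = (\<Sum>i<k. indicat_real (A i) t *\<^sub>R c i)"
    unfolding simple_fun_def by blast
  have "Bochner_Integration.simple_bochner_integrable MM (\<lambda>t. \<Sum>i<k. indicat_real (A i) t *\<^sub>R c i)"
    using A
  proof (induction k)
    case 0
    show ?case by (auto intro!: simple_bochner_integrable.intros)
  next
    case (Suc k)
    have Ak: "A k \<in> sets MM" "emeasure MM (A k) < top" using Suc.prems[of k] by (auto simp: fin_sets_def)
    have "Bochner_Integration.simple_bochner_integrable MM (\<lambda>t. indicat_real (A k) t *\<^sub>R c k)"
    proof
      show "simple_function MM (\<lambda>t. indicat_real (A k) t *\<^sub>R c k)"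
        by (rule simple_function_compose1[OF simple_function_indicator[OF Ak(1)]])
      have "emeasure MM {t \<in> space MM. indicat_real (A k) t *\<^sub>R c k \<noteq> 0} \<le> emeasure MM (A k)"
        by (rule emeasure_mono[OF _ Ak(1)]) (auto simp: indicator_def)
      then show "emeasure MM {t \<in> space MM. indicat_real (A k) t *\<^sub>R c k \<noteq> 0} \<noteq> \<infinity>"
        using Ak(2) by (auto simp: top_unique)
    qed
    with Suc show ?case
      by (simp add: simple_bochner_integrable_compose2[where p="(+)"])
  qed
  \<comment> \<open>The representation as a sum is known on the half-line only, so the properties
    are transferred by congruence on the space of the measure.\<close>
  moreover have "simple_function MM f \<longleftrightarrow> simple_function MM (\<lambda>t. \<Sum>i<k. indicat_real (A i) t *\<^sub>R c i)"
    by (rule simple_function_cong) (simp add: f del: scaleR_sum_left)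
  moreover have "{t \<in> space MM. f t \<noteq> 0} = {t \<in> space MM. (\<Sum>i<k. indicat_real (A i) t *\<^sub>R c i) \<noteq> 0}"
    using f by auto
  ultimately show "Bochner_Integration.simple_bochner_integrable MM f"
    by (simp only: simple_bochner_integrable.simps simp_thms)
qed

lemma simple_fun_compose2:
  "p 0 0 = 0 \<Longrightarrow> simple_fun f \<Longrightarrow> simple_fun g \<Longrightarrow> simple_fun (\<lambda>t. p (f t) (g t))"
  using simple_bochner_integrable_compose2[of p MM f g]
  by (simp add: simple_bochner_integrable_iff_simple_fun)

lemma simple_fun_compose: "p 0 = 0 \<Longrightarrow> simple_fun f \<Longrightarrow> simple_fun (\<lambda>t. p (f t))"
  by (rule simple_fun_compose2[of "\<lambda>x _. p x"])

lemma simple_fun_indicator: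
  assumes A: "A \<in> sets MM" and f: "simple_fun f"
  shows "simple_fun (\<lambda>t. indicat_real A t *\<^sub>R f t)"
proof -
  from f have f': "simple_function MM f" and fin: "emeasure MM {t \<in> space MM. f t \<noteq> 0} \<noteq> \<infinity>"
    unfolding simple_bochner_integrable_iff_simple_fun[symmetric]
    by (auto simp: simple_bochner_integrable.simps)
  have "Bochner_Integration.simple_bochner_integrable MM (\<lambda>t. indicat_real A t *\<^sub>R f t)"
  proof
    show "simple_function MM (\<lambda>t. indicat_real A t *\<^sub>R f t)"
      by (rule simple_function_compose2[OF simple_function_indicator[OF A] f'])
    have "emeasure MM {t \<in> space MM. indicat_real A t *\<^sub>R f t \<noteq> 0} \<le> emeasure MM {t \<in> space MM. f t \<noteq> 0}"
    proof (rule emeasure_mono)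
      show "{t \<in> space MM. f t \<noteq> 0} \<in> sets MM"
        using simple_functionD(2)[OF f', of "- {0}"] by (simp add: vimage_def Int_def conj_commute)
    qed auto
    then show "emeasure MM {t \<in> space MM. indicat_real A t *\<^sub>R f t \<noteq> 0} \<noteq> \<infinity>"
      using fin by (auto simp: top_unique)
  qed
  then show ?thesis by (simp add: simple_bochner_integrable_iff_simple_fun)
qed

text \<open>One sum runs over the values of \<open>f\<close> and intersects the level sets with
  \<open>A\<close>, the other over the values of \<open>f\<close> cut off outside \<open>A\<close>.
  They differ by values not attained on \<open>A\<close>, which contribute the measure of the empty
  set, and by the value 0.\<close>

lemma simple_int_eq:
  assumes A: "A \<in> sets MM" and f: "simple_fun f"
  shows "simple_int f A = Bochner_Integration.simple_bochner_integral MM (\<lambda>t. indicat_real A t *\<^sub>R f t)"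
proof -
  let ?g = "\<lambda>t. indicat_real A t *\<^sub>R f t"
  have fin: "finite (f ` {0<..})"
    using f unfolding simple_bochner_integrable_iff_simple_fun[symmetric]
    by (auto simp: simple_bochner_integrable.simps simple_function_def)
  have A0: "A \<subseteq> {0<..}" using A by (rule mellin_sets_subset)
  have "simple_int f A = (\<Sum>c \<in> f ` {0<..} - {0}. measure MM {t\<in>space MM. ?g t = c} *\<^sub>R c)"
    unfolding simple_int_def
  proof (intro sum.cong refl arg_cong2[where f=scaleR] arg_cong[where f="measure MM"])
    fix c assume "c \<in> f ` {0<..} - {0}"
    then show "A \<inter> {g. 0 < g \<and> f g = c} = {t \<in> space MM. ?g t = c}"
      using A0 by (auto simp: indicator_def split: if_splits)
  qed
  also have "\<dots> = (\<Sum>c \<in> ?g ` {0<..} - {0}. measure MM {t\<in>space MM. ?g t = c} *\<^sub>R c)"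
  proof (rule sum.mono_neutral_right)
    show "?g ` {0<..} - {0} \<subseteq> f ` {0<..} - {0}" by (auto simp: indicator_def)
    show "\<forall>c\<in>f ` {0<..} - {0} - (?g ` {0<..} - {0}). measure MM {t\<in>space MM. ?g t = c} *\<^sub>R c = 0"
    proof
      fix c assume "c \<in> f ` {0<..} - {0} - (?g ` {0<..} - {0})"
      then have "c \<notin> ?g ` {0<..}" by blast
      then have "{t\<in>space MM. ?g t = c} = {}" by (auto simp only: space_mellin)
      then show "measure MM {t\<in>space MM. ?g t = c} *\<^sub>R c = 0" by (metis measure_empty scaleR_zero_left)
    qed
  qed (use fin in auto)
  also have "\<dots> = Bochner_Integration.simple_bochner_integral MM ?g"
  proof -
    have "finite (?g ` {0<..})"
      by (rule finite_subset[of _ "insert 0 (f ` {0<..})"]) (use fin in \<open>auto simp: indicator_def\<close>)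
    then show ?thesis
      unfolding simple_bochner_integral_def space_mellin
      by (intro sum.mono_neutral_left) auto
  qed
  finally show ?thesis .
qed

lemma simple_int_cong:
  assumes "\<And>t. 0 < t \<Longrightarrow> f t = g t"
  shows "simple_int f A = simple_int g A"
proof -
  have "f ` {0<..} = g ` {0<..}" using assms by (intro image_cong) auto
  moreover have "{t. 0 < t \<and> f t = c} = {t. 0 < t \<and> g t = c}" for c using assms by auto
  ultimately show ?thesis by (simp add: simple_int_def)
qed

lemma simple_int_add:
  assumes A: "A \<in> sets MM" and "simple_fun f" "simple_fun g"
  shows "simple_int (\<lambda>t. f t + g t) A = simple_int f A + simple_int g A"
  using simple_bochner_integral_add[of MM "\<lambda>t. indicat_real A t *\<^sub>R f t" "\<lambda>t. indicat_real A t *\<^sub>R g t"] assms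
  by (simp add: simple_int_eq simple_fun_compose2[where p="(+)"] simple_bochner_integrable_iff_simple_fun
      simple_fun_indicator scaleR_add_right)

lemma simple_int_scaleR:
  assumes A: "A \<in> sets MM" and f: "simple_fun f"
  shows "simple_int (\<lambda>t. c *\<^sub>R f t) A = c *\<^sub>R simple_int f A"
  using simple_bochner_integral_linear[of "(*\<^sub>R) c" MM "\<lambda>t. indicat_real A t *\<^sub>R f t"] assms
  by (simp add: simple_int_eq simple_fun_compose[where p="(*\<^sub>R) c"] simple_bochner_integrable_iff_simple_fun
      simple_fun_indicator linear_scale_self mult.commute)

lemma simple_int_diff:
  assumes "A \<in> sets MM" and "simple_fun f" "simple_fun g"
  shows "simple_int (\<lambda>t. f t - g t) A = simple_int f A - simple_int g A"
  using simple_int_add[OF assms(1,2) simple_fun_compose[where p="(*\<^sub>R) (-1)", OF _ assms(3)]]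
    simple_int_scaleR[OF assms(1,3), of "-1"] by simp

section \<open>Bounds of simple integrals by real integrals times one vector\<close>

lemma mean_value_bound:
  fixes c w :: "'x::dedekind_complete_vector_lattice"
  assumes E: "E \<in> sets MM" and k: "integrable MM k" and k0: "\<And>t. t \<in> E \<Longrightarrow> 0 \<le> k t"
    and w: "0 \<le> w" and le: "\<And>t. t \<in> E \<Longrightarrow> c \<le> k t *\<^sub>R w"
  shows "measure MM E *\<^sub>R c \<le> (LINT t|MM. indicat_real E t * k t) *\<^sub>R w"
proof -
  have int: "integrable MM (\<lambda>t. indicat_real E t * k t)"
    using integrable_mult_indicator[OF E k] by simp
  have int0: "0 \<le> (LINT t|MM. indicat_real E t * k t)"
    by (rule Bochner_Integration.integral_nonneg) (auto simp: indicator_def k0)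
  show ?thesis
  \<comment> \<open>\<open>measure\<close> also vanishes on sets of infinite measure, so the second
    case deals with a nonempty set of finite measure.\<close>
  proof (cases "measure MM E = 0")
    case True
    then show ?thesis using int0 w by (simp add: scaleR_nonneg_nonneg)
  next
    case False
    then have E0: "E \<noteq> {}" and fin: "emeasure MM E < top"
      by (auto simp: measure_def less_top[symmetric] enn2real_eq_0_iff)
    define i where "i = (INF t\<in>E. k t)"
    have B: "bdd_below (k ` E)" using k0 by (auto simp: bdd_below_def)
    \<comment> \<open>As \<open>c\<close> does not depend on \<open>t\<close>, the Archimedean
      property improves the pointwise bound to the infimum of \<open>k\<close>. In this way a vector
      inequality is integrated without any order continuity of the integral.\<close>
    have "c \<le> i *\<^sub>R w"
    proof (rule archimedean_le[OF w])
      fix e :: real assume e: "0 < e"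
      obtain t where t: "t \<in> E" "k t < i + e"
        using cINF_less_iff[OF E0 B, of "i + e"] e by (auto simp: i_def)
      have "c \<le> k t *\<^sub>R w" by (rule le[OF t(1)])
      also have "\<dots> \<le> (i + e) *\<^sub>R w" using t w by (intro scaleR_right_mono) auto
      finally show "c \<le> i *\<^sub>R w + e *\<^sub>R w" by (simp add: scaleR_add_left)
    qed
    then have "measure MM E *\<^sub>R c \<le> (measure MM E * i) *\<^sub>R w"
      using scaleR_left_mono[of c "i *\<^sub>R w" "measure MM E"] by simp
    also have "\<dots> \<le> (LINT t|MM. indicat_real E t * k t) *\<^sub>R w"
    proof (rule scaleR_right_mono[OF _ w])
      have "(LINT t|MM. indicat_real E t * i) \<le> (LINT t|MM. indicat_real E t * k t)"
      proof (rule integral_mono)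
        show "integrable MM (\<lambda>t. indicat_real E t * i)"
          using E fin by (intro integrable_mult_left integrable_real_indicator) auto
        show "indicat_real E t * i \<le> indicat_real E t * k t" for t
          using cINF_lower[OF B] by (auto simp: indicator_def i_def)
      qed (rule int)
      then show "measure MM E * i \<le> (LINT t|MM. indicat_real E t * k t)"
        using mellin_sets_subset[OF E] by (simp add: Int_absorb2)
    qed
    finally show ?thesis .
  qed
qed

text \<open>The mean value bound is applied on each level set of the function cut off outside
  \<open>A\<close>. The value 0 is not removed from the sum, so the level sets partition the
  half-line and the integrals of \<open>k\<close> add up to the full one.\<close>

lemma simple_int_bound:
  fixes f :: "real \<Rightarrow> 'x::dedekind_complete_vector_lattice"
  assumes A: "A \<in> sets MM" and f: "simple_fun f" and k: "integrable MM k"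
    and k0: "\<And>t. 0 < t \<Longrightarrow> 0 \<le> k t" and w: "0 \<le> w"
    and le: "\<And>t. t \<in> A \<Longrightarrow> \<bar>f t\<bar> \<le> k t *\<^sub>R w"
  shows "\<bar>simple_int f A\<bar> \<le> (LINT t|MM. k t) *\<^sub>R w"
proof -
  let ?g = "\<lambda>t. indicat_real A t *\<^sub>R f t"
  let ?E = "\<lambda>c. {t\<in>space MM. ?g t = c}"
  have g: "simple_function MM ?g"
    using simple_fun_indicator[OF A f] unfolding simple_bochner_integrable_iff_simple_fun[symmetric]
    by (auto simp: simple_bochner_integrable.simps)
  have E: "?E c \<in> sets MM" for c
    using simple_functionD(2)[OF g, of "{c}"] by (simp add: vimage_def Int_def conj_commute)
  have fin: "finite (?g ` space MM)" using g by (simp add: simple_function_def)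
  have int: "integrable MM (\<lambda>t. indicat_real (?E c) t * k t)" for c
    using integrable_mult_indicator[OF E k] by simp
  have "\<bar>simple_int f A\<bar> \<le> (\<Sum>c\<in>?g ` space MM. \<bar>measure MM (?E c) *\<^sub>R c\<bar>)"
    unfolding simple_int_eq[OF A f] simple_bochner_integral_def by (rule sum_abs)
  also have "\<dots> \<le> (\<Sum>c\<in>?g ` space MM. (LINT t|MM. indicat_real (?E c) t * k t) *\<^sub>R w)"
  proof (rule sum_mono)
    fix c assume "c \<in> ?g ` space MM"
    have "measure MM (?E c) *\<^sub>R \<bar>c\<bar> \<le> (LINT t|MM. indicat_real (?E c) t * k t) *\<^sub>R w"
      by (rule mean_value_bound[OF E k _ w])
         (use k0 le w in \<open>auto simp: indicator_def scaleR_nonneg_nonneg\<close>)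
    then show "\<bar>measure MM (?E c) *\<^sub>R c\<bar> \<le> (LINT t|MM. indicat_real (?E c) t * k t) *\<^sub>R w"
      by (simp add: abs_scaleR_vl)
  qed
  also have "\<dots> = (LINT t|MM. (\<Sum>c\<in>?g ` space MM. indicat_real (?E c) t * k t)) *\<^sub>R w"
    using int by (simp add: scaleR_sum_left)
  also have "(LINT t|MM. (\<Sum>c\<in>?g ` space MM. indicat_real (?E c) t * k t)) = (LINT t|MM. k t)"
  proof (rule Bochner_Integration.integral_cong[OF refl])
    fix t assume t: "t \<in> space MM"
    have "(\<Sum>c\<in>?g ` space MM. indicat_real (?E c) t * k t) = (\<Sum>c\<in>?g ` space MM. if c = ?g t then k t else 0)"
      using t by (intro sum.cong) (auto simp: indicator_def)
    also have "\<dots> = k t" using fin t by (subst sum.delta) auto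
    finally show "(\<Sum>c\<in>?g ` space MM. indicat_real (?E c) t * k t) = k t" .
  qed
  finally show ?thesis .
qed

lemma simple_int_nonneg:
  assumes "A \<in> sets MM" "simple_fun f" "\<And>t. t \<in> A \<Longrightarrow> 0 \<le> f t"
  shows "0 \<le> simple_int f A"
  unfolding simple_int_def
proof (rule sum_nonneg)
  fix c assume "c \<in> f ` {0<..} - {0}"
  show "0 \<le> measure MM (A \<inter> {g. 0 < g \<and> f g = c}) *\<^sub>R c"
  proof (cases "A \<inter> {g. 0 < g \<and> f g = c} = {}")
    case True
    then show ?thesis by (metis measure_empty scaleR_zero_left order_refl)
  next
    case False
    then show ?thesis using assms(3) by (auto intro!: scaleR_nonneg_nonneg)
  qed
qed

lemma simple_int_mono:
  assumes A: "A \<in> sets MM" "simple_fun f" "simple_fun g" "\<And>t. t \<in> A \<Longrightarrow> f t \<le> g t"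
  shows "simple_int f A \<le> simple_int g A"
  using simple_int_nonneg[of A "\<lambda>t. g t - f t"] simple_int_diff[OF A(1,3,2)] assms
  by (simp add: simple_fun_compose2[where p="(-)"])

lemma simple_int_restrict:
  assumes "A \<in> sets MM" "B \<in> sets MM" "simple_fun f"
  shows "simple_int (\<lambda>t. indicat_real B t *\<^sub>R f t) A = simple_int f (A \<inter> B)"
  using assms
  by (simp add: simple_int_eq simple_fun_indicator sets.Int indicator_inter_arith)

lemma simple_int_abs:
  assumes A: "A \<in> sets MM" "simple_fun f"
  shows "\<bar>simple_int f A\<bar> \<le> simple_int (\<lambda>t. \<bar>f t\<bar>) A"
proof -
  have abs: "simple_fun (\<lambda>t. \<bar>f t\<bar>)" by (rule simple_fun_compose[where p=abs]) (use A in auto)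
  have m: "simple_fun (\<lambda>t. (-1) *\<^sub>R f t)" by (rule simple_fun_compose) (use A in auto)
  show ?thesis
    using simple_int_mono[OF A abs abs_ge_self] simple_int_mono[OF A(1) m abs] simple_int_scaleR[OF A, of "-1"]
    by (simp add: abs_le_iff abs_ge_minus_self)
qed

lemma simple_int_mono_set:
  assumes A: "A \<in> sets MM" "B \<in> sets MM" "simple_fun f" "\<And>t. 0 \<le> f t" "A \<subseteq> B"
  shows "simple_int f A \<le> simple_int f B"
proof -
  have "simple_int f A = simple_int (\<lambda>t. indicat_real A t *\<^sub>R f t) B"
    using simple_int_restrict[OF A(2,1,3)] A(5) by (simp add: Int_absorb1)
  also have "\<dots> \<le> simple_int f B"
    by (rule simple_int_mono[OF A(2) simple_fun_indicator[OF A(1,3)] A(3)]) (use A in \<open>auto simp: indicator_def\<close>)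
  finally show ?thesis .
qed

lemma integrable_mellin_indicator: "A \<in> fin_sets \<Longrightarrow> integrable MM (indicat_real A)"
  and integral_mellin_indicator: "A \<in> fin_sets \<Longrightarrow> (LINT t|MM. indicat_real A t) = measure MM A"
  using mellin_sets_subset[of A] by (auto simp: fin_sets_def Int_absorb2)

lemma simple_int_const_bound:
  assumes A: "A \<in> fin_sets" "simple_fun f" "0 \<le> w" "\<And>t. t \<in> A \<Longrightarrow> \<bar>f t\<bar> \<le> w"
  shows "\<bar>simple_int f A\<bar> \<le> measure MM A *\<^sub>R w"
  using simple_int_bound[OF _ A(2) integrable_mellin_indicator[OF A(1)] _ A(3), of A] A
  by (simp add: fin_sets_def integral_mellin_indicator[OF A(1), simplified])

lemma fin_sets_Un: "A \<in> fin_sets \<Longrightarrow> B \<in> fin_sets \<Longrightarrow> A \<union> B \<in> fin_sets"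
  using emeasure_subadditive[of A MM B] by (auto simp: fin_sets_def intro: order_le_less_trans)

lemma fin_sets_subset: "A \<in> fin_sets \<Longrightarrow> B \<in> sets MM \<Longrightarrow> B \<subseteq> A \<Longrightarrow> B \<in> fin_sets"
  using emeasure_mono[of B A MM] by (auto simp: fin_sets_def intro: order_le_less_trans)

section \<open>Abstract convergences\<close>

context
  fixes C :: "'x::dedekind_complete_vector_lattice convergence"
  assumes C: "is_convergence C"
begin

lemma null_seq_add:
  assumes "null_seq C x" "null_seq C y" shows "null_seq C (\<lambda>n. x n + y n)"
  using C assms unfolding is_convergence_def null_seq_def by (metis add.right_neutral)

lemma null_seq_zero: "null_seq C (\<lambda>n. 0)"
  using C unfolding is_convergence_def null_seq_def by (metis (mono_tags) always_eventually)

lemma conv_squeeze: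
  assumes "x \<in> conv_seqs C" "z \<in> conv_seqs C" "conv_lim C x = conv_lim C z"
    and "\<forall>\<^sub>F n in sequentially. x n \<le> y n \<and> y n \<le> z n"
  shows "y \<in> conv_seqs C \<and> conv_lim C y = conv_lim C x"
proof -
  have "\<forall>x\<in>conv_seqs C. \<forall>z\<in>conv_seqs C. \<forall>y. conv_lim C x = conv_lim C z \<longrightarrow>
        (\<forall>\<^sub>F n in sequentially. x n \<le> y n \<and> y n \<le> z n) \<longrightarrow>
        y \<in> conv_seqs C \<and> conv_lim C y = conv_lim C x"
    using C unfolding is_convergence_def by blast
  then show ?thesis using assms by blast
qed

text \<open>Axiom (c) squeezes between two sequences with a common limit; here they are
  \<open>x\<close> and its negative.\<close>

lemma null_seq_abs_squeeze:
  assumes x: "null_seq C x" and y: "\<And>n. \<bar>y n\<bar> \<le> x n"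
  shows "null_seq C y"
proof -
  have *: "\<forall>c. \<forall>x\<in>conv_seqs C. (\<lambda>n. c *\<^sub>R x n) \<in> conv_seqs C \<and>
        conv_lim C (\<lambda>n. c *\<^sub>R x n) = c *\<^sub>R conv_lim C x"
    using C unfolding is_convergence_def by blast
  have "\<forall>\<^sub>F n in sequentially. (-1) *\<^sub>R x n \<le> y n \<and> y n \<le> x n"
    using y by (intro always_eventually allI) (metis abs_le_iff minus_le_iff scaleR_minus1_left)
  moreover have "null_seq C (\<lambda>n. (-1) *\<^sub>R x n)"
    using x *[rule_format, of x "-1"] by (simp add: null_seq_def)
  ultimately show ?thesis
    using x conv_squeeze[of "\<lambda>n. (-1) *\<^sub>R x n" x y] by (simp add: null_seq_def)
qed

lemma null_seq_squeeze:
  assumes x: "null_seq C x" and y: "\<And>n. 0 \<le> y n \<and> y n \<le> x n"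
  shows "null_seq C y"
  using x y by (intro null_seq_abs_squeeze[OF x]) auto

lemma conv_const: "(\<lambda>n. l) \<in> conv_seqs C" "conv_lim C (\<lambda>n. l) = l"
  using C unfolding is_convergence_def by (metis (mono_tags) always_eventually)+

lemma null_seq_ge_const:
  assumes "null_seq C x" and "\<And>n. l \<le> x n" shows "l \<le> 0"
proof -
  have mono: "\<forall>x\<in>conv_seqs C. \<forall>y\<in>conv_seqs C. (\<forall>n. x n \<le> y n) \<longrightarrow> conv_lim C x \<le> conv_lim C y"
    using C unfolding is_convergence_def by blast
  have "conv_lim C (\<lambda>n. l) \<le> conv_lim C x"
    using mono[THEN bspec, OF conv_const(1)[of l], THEN bspec, of x] assms by (simp add: null_seq_def)
  then show ?thesis using conv_const(2)[of l] assms(1) by (simp add: null_seq_def)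
qed

lemma sup_null_le:
  assumes y: "null_seq C y" and le: "\<And>n v. v \<in> V n \<Longrightarrow> v \<le> y n" and y0: "\<And>n. 0 \<le> y n"
  shows "sup_null C V"
  unfolding sup_null_def
proof
  show B: "\<forall>n. bdd_above (V n)" using le by (auto simp: bdd_above_def)
  show "null_seq C (\<lambda>n. Sup (insert 0 (V n)))"
  proof (rule null_seq_squeeze[OF y], intro conjI)
    fix n
    show "0 \<le> Sup (insert 0 (V n))" using B by (intro cSup_upper) auto
    show "Sup (insert 0 (V n)) \<le> y n" using le y0 by (intro cSup_least) auto
  qed
qed

end

lemma sup_nullD:
  assumes "sup_null C V"
  obtains y where "null_seq C y" "\<And>n v. v \<in> V n \<Longrightarrow> v \<le> y n" "\<And>n. 0 \<le> y n"
proof -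
  have B: "bdd_above (insert 0 (V n))" for n using assms by (auto simp: sup_null_def)
  show thesis
    by (rule that[of "\<lambda>n. Sup (insert 0 (V n))"])
       (use assms in \<open>auto simp: sup_null_def intro: cSup_upper[OF _ B]\<close>)
qed

section \<open>Consequences of the upper limit\<close>

context
  fixes C :: "'x::dedekind_complete_vector_lattice convergence"
    and lb :: "(nat \<Rightarrow> 'x) \<Rightarrow> 'x extended"
    and R :: "real convergence"
  assumes setting: "convergence_setting C lb R"
begin

lemma convC: "is_convergence C" and convR: "is_convergence R" and upper: "is_upper_limit C lb"
  using setting by (auto simp: convergence_setting_def)

lemma lb_mono:
  assumes "\<And>n. 0 \<le> x n \<and> x n \<le> y n"
  shows "lb x \<le> lb y"
proof -
  have "\<forall>x\<in>{x. \<forall>n. 0 \<le> x n}. \<forall>y\<in>{x. \<forall>n. 0 \<le> x n}. (\<forall>n. x n \<le> y n) \<longrightarrow> lb x \<le> lb y"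
    using upper unfolding is_upper_limit_def Let_def by (elim conjE)
  moreover have "0 \<le> y n" for n using assms[of n] order_trans by blast
  ultimately show ?thesis using assms by simp
qed

lemma lb_nonneg: "(\<And>n. 0 \<le> x n) \<Longrightarrow> 0 \<le> lb x"
  using upper unfolding is_upper_limit_def Let_def by blast

lemma lb_add: "(\<And>n. 0 \<le> x n) \<Longrightarrow> (\<And>n. 0 \<le> y n) \<Longrightarrow> lb (\<lambda>n. x n + y n) \<le> lb x + lb y"
  using upper unfolding is_upper_limit_def Let_def by blast

lemma lb_conv: "(\<And>n. 0 \<le> x n) \<Longrightarrow> x \<in> conv_seqs C \<Longrightarrow> lb x = Fin (conv_lim C x)"
  using upper unfolding is_upper_limit_def Let_def by blast

lemma lb_null: "(\<And>n. 0 \<le> x n) \<Longrightarrow> lb x = 0 \<Longrightarrow> null_seq C x"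
  using upper unfolding is_upper_limit_def Let_def by blast

lemma lb_eventually_eq: "(\<And>n. 0 \<le> x n) \<Longrightarrow> (\<And>n. 0 \<le> y n) \<Longrightarrow>
    (\<forall>\<^sub>F n in sequentially. x n = y n) \<Longrightarrow> lb x = lb y"
  using upper unfolding is_upper_limit_def Let_def by blast

text \<open>Condition (ii) of equi-absolute continuity asks for finite upper limits. Domination by a
  sequence with finite upper limit, up to a null sequence, provides them by subadditivity.\<close>

lemma lb_le_Fin:
  assumes "\<And>n. 0 \<le> x n" "\<And>n. 0 \<le> p n" "\<And>n. 0 \<le> z n" "null_seq C z" "lb p \<le> Fin c"
    and "\<And>n. x n \<le> p n + z n"
  shows "\<exists>b. lb x = Fin b \<and> 0 \<le> b \<and> b \<le> c"
proof -
  have "lb z = Fin 0" using assms lb_conv[of z] by (auto simp: null_seq_def)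
  moreover have "lb x \<le> lb (\<lambda>n. p n + z n)" using assms by (intro lb_mono) auto
  moreover have "lb (\<lambda>n. p n + z n) \<le> lb p + lb z" using assms by (intro lb_add) auto
  ultimately have "lb x \<le> lb p + Fin 0" by (metis order_trans)
  also have "lb p + Fin 0 \<le> Fin c" using assms(5) by (cases "lb p") auto
  finally have "lb x \<le> Fin c" .
  with lb_nonneg[of x] assms(1) show ?thesis by (cases "lb x") (auto simp: zero_extended_def)
qed

lemma lb_const: "0 \<le> c \<Longrightarrow> lb (\<lambda>n. c) = Fin c"
  using lb_conv[of "\<lambda>n. c"] conv_const[OF convC, of c] by simp

text \<open>The axioms (a)--(d) alone only give \<open>\<ell>((u/n)\<^sub>n) = 0\<close>, without any information on slower
  rates; it is the upper limit that makes every relatively uniformly null sequence null.\<close>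

lemma null_seq_uniform:
  assumes u: "0 \<le> u" and x0: "\<And>n. 0 \<le> x n"
    and le: "\<And>e::real. 0 < e \<Longrightarrow> \<forall>\<^sub>F n in sequentially. x n \<le> e *\<^sub>R u"
  shows "null_seq C x"
proof (rule lb_null[OF x0])
  have *: "lb x \<le> Fin (e *\<^sub>R u)" if e: "0 < e" for e :: real
  proof -
    have eu: "0 \<le> e *\<^sub>R u" using u e by (simp add: scaleR_nonneg_nonneg)
    \<comment> \<open>The finitely many exceptional terms are replaced by 0. The upper limit does
      not notice this, and the modified sequence lies below a constant.\<close>
    let ?y = "\<lambda>n. if x n \<le> e *\<^sub>R u then x n else 0"
    have "lb x = lb ?y" by (rule lb_eventually_eq) (use x0 eventually_mono[OF le[OF e]] in auto)
    also have "\<dots> \<le> lb (\<lambda>n. e *\<^sub>R u)" by (rule lb_mono) (use x0 eu in auto)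
    finally show ?thesis using lb_const[OF eu] by simp
  qed
  have "0 \<le> lb x" by (rule lb_nonneg) (rule x0)
  with *[of 1] obtain b where b: "lb x = Fin b" "0 \<le> b"
    by (cases "lb x") (auto simp: zero_extended_def)
  have "b \<le> 0" by (rule archimedean_le_0[OF u]) (use * b in auto)
  with b show "lb x = 0" by (simp add: zero_extended_def)
qed

lemma null_seq_scaleR_real:
  assumes u: "0 \<le> u" and a: "a \<longlonglongrightarrow> 0" and x: "\<And>n. 0 \<le> x n" "\<And>n. x n \<le> a n *\<^sub>R u"
  shows "null_seq C x"
proof (rule null_seq_uniform[OF u x(1)])
  fix e :: real assume "0 < e"
  then have "\<forall>\<^sub>F n in sequentially. a n < e" using order_tendstoD(2)[OF a] by blast
  then show "\<forall>\<^sub>F n in sequentially. x n \<le> e *\<^sub>R u"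
    by eventually_elim (use x u in \<open>meson order_trans scaleR_right_mono less_imp_le\<close>)
qed

lemma null_seq_scaleR_null: "null_seq R y \<Longrightarrow> null_seq C (\<lambda>n. y n *\<^sub>R x)"
  and null_seq_scaleR: "null_seq C z \<Longrightarrow> null_seq C (\<lambda>n. (c::real) *\<^sub>R z n)"
  using setting unfolding convergence_setting_def by blast+

lemma null_seq_inverse_Suc:
  assumes "0 \<le> u"
  shows "null_seq C (\<lambda>n. (1 / real (Suc n)) *\<^sub>R u)"
  by (rule null_seq_scaleR_real[OF assms LIMSEQ_Suc[OF lim_1_over_n]]) (use assms in \<open>auto simp: scaleR_nonneg_nonneg\<close>)

section \<open>Uniqueness of the integral\<close>

text \<open>This makes the definite description in \<open>pos_integral\<close> meaningful. The
  half-line is cut into the outside of \<open>D\<close>, where condition (ii) bounds the upper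
  limits, the exceptional sets inside \<open>D\<close>, where condition (i) applies, and the rest of
  \<open>D\<close>, where both sequences are uniformly close to \<open>h\<close>. Only the first
  piece survives as n grows, and it leaves \<open>b m + b' m\<close> for every
  \<open>m\<close>.\<close>

lemma defining_sequence_unique:
  assumes fs: "defining_sequence C lb R fs h" and gs: "defining_sequence C lb R gs h"
    and l: "sup_null C (\<lambda>n. (\<lambda>A. \<bar>simple_int (fs n) A - l A\<bar>) ` sets MM)"
    and l': "sup_null C (\<lambda>n. (\<lambda>A. \<bar>simple_int (gs n) A - l' A\<bar>) ` sets MM)"
    and A: "A \<in> sets MM"
  shows "l A = l' A"
proof -
  have sf: "simple_fun (fs n)" and sg: "simple_fun (gs n)" for n
    using fs gs by (auto simp: defining_sequence_def)
  have sfa: "simple_fun (\<lambda>t. \<bar>fs n t\<bar>)" and sga: "simple_fun (\<lambda>t. \<bar>gs n t\<bar>)" for n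
    by (rule simple_fun_compose[where p=abs]; simp add: sf sg)+
  obtain B b where B: "\<And>m. B m \<in> fin_sets" "null_seq C b"
    and lbB: "\<And>m. lb (\<lambda>n. simple_int (\<lambda>g. \<bar>fs n g\<bar>) ({0<..} - B m)) = Fin (b m)"
    using fs unfolding defining_sequence_def equi_abs_continuous_def by blast
  obtain B' b' where B': "\<And>m. B' m \<in> fin_sets" "null_seq C b'"
    and lbB': "\<And>m. lb (\<lambda>n. simple_int (\<lambda>g. \<bar>gs n g\<bar>) ({0<..} - B' m)) = Fin (b' m)"
    using gs unfolding defining_sequence_def equi_abs_continuous_def by blast
  obtain z where z: "null_seq C z" "\<And>n v. v \<in> (\<lambda>A. \<bar>simple_int (fs n) A - l A\<bar>) ` sets MM \<Longrightarrow> v \<le> z n"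
    "\<And>n. 0 \<le> z n" by (rule sup_nullD[OF l]) blast
  obtain z' where z': "null_seq C z'" "\<And>n v. v \<in> (\<lambda>A. \<bar>simple_int (gs n) A - l' A\<bar>) ` sets MM \<Longrightarrow> v \<le> z' n"
    "\<And>n. 0 \<le> z' n" by (rule sup_nullD[OF l']) blast
  have "\<bar>l A - l' A\<bar> \<le> b m + b' m" for m
  proof -
    define D where "D = B m \<union> B' m"
    have D: "D \<in> fin_sets" using B B' by (simp add: D_def fin_sets_Un)
    then have D_sets: "D \<in> sets MM" by (simp add: fin_sets_def)
    obtain E where E: "\<And>n. E n \<in> sets MM" "\<And>n. D \<inter> E n \<in> fin_sets"
      "null_seq R (\<lambda>n. measure MM (D \<inter> E n))" "sup_null C (\<lambda>n. (\<lambda>g. \<bar>fs n g - h g\<bar>) ` (D - E n))"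
      using fs D unfolding defining_sequence_def converges_in_measure_def by blast
    obtain E' where E': "\<And>n. E' n \<in> sets MM" "\<And>n. D \<inter> E' n \<in> fin_sets"
      "null_seq R (\<lambda>n. measure MM (D \<inter> E' n))" "sup_null C (\<lambda>n. (\<lambda>g. \<bar>gs n g - h g\<bar>) ` (D - E' n))"
      using gs D unfolding defining_sequence_def converges_in_measure_def by blast
    obtain y where y: "null_seq C y" "\<And>n v. v \<in> (\<lambda>g. \<bar>fs n g - h g\<bar>) ` (D - E n) \<Longrightarrow> v \<le> y n" "\<And>n. 0 \<le> y n"
      by (rule sup_nullD[OF E(4)]) blast
    obtain y' where y': "null_seq C y'" "\<And>n v. v \<in> (\<lambda>g. \<bar>gs n g - h g\<bar>) ` (D - E' n) \<Longrightarrow> v \<le> y' n" "\<And>n. 0 \<le> y' n"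
      by (rule sup_nullD[OF E'(4)]) blast
    \<comment> \<open>The exceptional sets of both sequences are united, and cut down to
      \<open>D\<close> so that they have finite measure and condition (i) can be applied.\<close>
    define G where "G = (\<lambda>n. (D \<inter> E n) \<union> (D \<inter> E' n))"
    have G: "G n \<in> fin_sets" for n using E E' by (simp add: G_def fin_sets_Un)
    then have G_sets: "G n \<in> sets MM" for n by (simp add: fin_sets_def)
    have "null_seq R (\<lambda>n. measure MM (G n))"
    proof (rule null_seq_squeeze[OF convR null_seq_add[OF convR E(3) E'(3)]])
      show "0 \<le> measure MM (G n) \<and> measure MM (G n) \<le> measure MM (D \<inter> E n) + measure MM (D \<inter> E' n)" for n
        using E E' by (auto simp: G_def fin_sets_def less_top intro!: measure_Un_le)
    qed
    then have G_null: "null_seq C (\<lambda>n. simple_int (\<lambda>g. \<bar>fs n g\<bar>) (G n))"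
      "null_seq C (\<lambda>n. simple_int (\<lambda>g. \<bar>gs n g\<bar>) (G n))"
      using fs gs G unfolding defining_sequence_def equi_abs_continuous_def by blast+
    let ?P = "\<lambda>n. simple_int (\<lambda>g. \<bar>fs n g\<bar>) ({0<..} - B m)"
    let ?Q = "\<lambda>n. simple_int (\<lambda>g. \<bar>gs n g\<bar>) ({0<..} - B' m)"
    let ?z = "\<lambda>n. z n + z' n + measure MM D *\<^sub>R (y n + y' n) +
      (simple_int (\<lambda>g. \<bar>fs n g\<bar>) (G n) + simple_int (\<lambda>g. \<bar>gs n g\<bar>) (G n))"
    have P0: "0 \<le> ?P n" "0 \<le> ?Q n" for n
      using B B' sfa sga by (auto intro!: simple_int_nonneg simp: fin_sets_def)
    \<comment> \<open>The left side is constant in \<open>n\<close> and equals its own upper limit.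
      The terms in \<open>?z\<close> are null in \<open>n\<close> and disappear; the tails
      \<open>?P\<close> and \<open>?Q\<close> are bounded through their upper limits.\<close>
    have "\<exists>c. lb (\<lambda>n. \<bar>l A - l' A\<bar>) = Fin c \<and> 0 \<le> c \<and> c \<le> b m + b' m"
    proof (rule lb_le_Fin)
      show "0 \<le> ?P n + ?Q n" for n using P0 by simp
      show "0 \<le> ?z n" for n
        using z z' y y' sfa sga G_sets by (auto intro!: add_nonneg_nonneg scaleR_nonneg_nonneg simple_int_nonneg)
      show "null_seq C ?z"
        by (intro null_seq_add[OF convC] null_seq_scaleR z z' y y' G_null)
      have "lb (\<lambda>n. ?P n + ?Q n) \<le> lb ?P + lb ?Q" using P0 by (intro lb_add) auto
      then show "lb (\<lambda>n. ?P n + ?Q n) \<le> Fin (b m + b' m)" by (simp add: lbB lbB')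
      show "\<bar>l A - l' A\<bar> \<le> ?P n + ?Q n + ?z n" for n
      proof -
        let ?d = "\<lambda>t. fs n t - gs n t"
        have sd: "simple_fun ?d" by (rule simple_fun_compose2[where p="(-)"]) (simp_all add: sf sg)
        have sda: "simple_fun (\<lambda>t. \<bar>?d t\<bar>)" by (rule simple_fun_compose[where p=abs]) (simp_all add: sd)
        let ?X = "\<lambda>S. simple_int (\<lambda>t. \<bar>?d t\<bar>) S"
        let ?S = "\<lambda>t. \<bar>fs n t\<bar> + \<bar>gs n t\<bar>"
        have sS: "simple_fun ?S" by (rule simple_fun_compose2[where p="(+)"]) (simp_all add: sfa sga)
        have DG: "D - G n \<in> fin_sets"
          by (rule fin_sets_subset[OF D]) (use D_sets G_sets[of n] in auto)
        have cD: "{0<..} - D \<in> sets MM" using D_sets by auto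
        have "\<bar>l A - l' A\<bar> \<le> \<bar>l A - simple_int (fs n) A\<bar> + \<bar>simple_int (fs n) A - l' A\<bar>"
          by (rule abs_diff_triangle)
        also have "\<bar>simple_int (fs n) A - l' A\<bar> \<le>
            \<bar>simple_int (fs n) A - simple_int (gs n) A\<bar> + \<bar>simple_int (gs n) A - l' A\<bar>"
          by (rule abs_diff_triangle)
        also have "\<bar>l A - simple_int (fs n) A\<bar> \<le> z n"
          by (subst abs_minus_commute) (use z A in auto)
        also have "\<bar>simple_int (gs n) A - l' A\<bar> \<le> z' n" using z' A by auto
        also have "\<bar>simple_int (fs n) A - simple_int (gs n) A\<bar> \<le> ?X A"
          using simple_int_abs[OF A sd] simple_int_diff[OF A sf sg] by simp
        also have "?X A \<le> ?X {0<..}"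
          by (rule simple_int_mono_set) (use A sda mellin_sets_subset in auto)
        also have "?X {0<..} = ?X (D - G n) + ?X (G n) + ?X ({0<..} - D)"
        proof -
          let ?i = "\<lambda>S t. indicat_real S t *\<^sub>R \<bar>?d t\<bar>"
          have i: "simple_fun (?i S)" if "S \<in> sets MM" for S using simple_fun_indicator[OF that sda] .
          have S: "D - G n \<in> sets MM" "G n \<in> sets MM" "{0<..} - D \<in> sets MM"
            using DG G_sets cD by (auto simp: fin_sets_def)
          have "?X {0<..} = simple_int (\<lambda>t. (?i (D - G n) t + ?i (G n) t) + ?i ({0<..} - D) t) {0<..}"
            using mellin_sets_subset[OF D_sets]
            by (intro simple_int_cong) (auto simp: indicator_def G_def)
          also have "\<dots> = simple_int (?i (D - G n)) {0<..} + simple_int (?i (G n)) {0<..} + simple_int (?i ({0<..} - D)) {0<..}"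
            using i[OF S(1)] i[OF S(2)] i[OF S(3)]
            by (simp add: simple_int_add simple_fun_compose2[where p="(+)"])
          also have "\<dots> = ?X (D - G n) + ?X (G n) + ?X ({0<..} - D)"
            using S mellin_sets_subset[OF S(1)] mellin_sets_subset[OF S(2)]
            by (simp add: simple_int_restrict[OF _ _ sda] Int_absorb1)
          finally show ?thesis .
        qed
        also have "?X (D - G n) \<le> measure MM D *\<^sub>R (y n + y' n)"
        proof -
          have "\<bar>?X (D - G n)\<bar> \<le> measure MM (D - G n) *\<^sub>R (y n + y' n)"
          proof (rule simple_int_const_bound[OF DG sda])
            show "0 \<le> y n + y' n" using y y' by simp
            show "\<bar>\<bar>?d t\<bar>\<bar> \<le> y n + y' n" if "t \<in> D - G n" for t
            proof -
              have "\<bar>fs n t - h t\<bar> \<le> y n" "\<bar>gs n t - h t\<bar> \<le> y' n"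
                using that by (auto intro!: y(2) y'(2) simp: G_def)
              then show ?thesis
                using abs_diff_triangle[of "fs n t" "gs n t" "h t"] by (simp add: abs_minus_commute) (meson add_mono order_trans)
            qed
          qed
          also have "\<dots> \<le> measure MM D *\<^sub>R (y n + y' n)"
            using D y y' G_sets by (intro scaleR_right_mono measure_mono_fmeasurable)
              (auto simp: fin_sets_def fmeasurable_def)
          finally show ?thesis by (meson abs_ge_self order_trans)
        qed
        also have "?X (G n) \<le> simple_int ?S (G n)"
          by (rule simple_int_mono[OF G_sets sda sS]) (rule abs_triangle_ineq4)
        also have "\<dots> = simple_int (\<lambda>g. \<bar>fs n g\<bar>) (G n) + simple_int (\<lambda>g. \<bar>gs n g\<bar>) (G n)"
          by (rule simple_int_add[OF G_sets sfa sga])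
        also have "?X ({0<..} - D) \<le> simple_int ?S ({0<..} - D)"
          by (rule simple_int_mono[OF cD sda sS]) (rule abs_triangle_ineq4)
        also have "\<dots> = simple_int (\<lambda>g. \<bar>fs n g\<bar>) ({0<..} - D) + simple_int (\<lambda>g. \<bar>gs n g\<bar>) ({0<..} - D)"
          by (rule simple_int_add[OF cD sfa sga])
        also have "simple_int (\<lambda>g. \<bar>fs n g\<bar>) ({0<..} - D) \<le> ?P n"
          by (rule simple_int_mono_set[OF cD _ sfa]) (use B in \<open>auto simp: D_def fin_sets_def\<close>)
        also have "simple_int (\<lambda>g. \<bar>gs n g\<bar>) ({0<..} - D) \<le> ?Q n"
          by (rule simple_int_mono_set[OF cD _ sga]) (use B' in \<open>auto simp: D_def fin_sets_def\<close>)
        finally show ?thesis by (simp add: algebra_simps)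
      qed
    qed simp
    then show ?thesis using lb_const[of "\<bar>l A - l' A\<bar>"] by auto
  qed
  then have "\<bar>l A - l' A\<bar> \<le> 0"
    by (intro null_seq_ge_const[OF convC null_seq_add[OF convC B(2) B'(2)]]) auto
  then show ?thesis by simp
qed

lemma pos_integral_eq:
  assumes l: "has_pos_integral C lb R h l" and A: "A \<in> sets MM"
  shows "pos_integral C lb R h A = l A"
  unfolding pos_integral_def
proof (rule the_equality)
  show "\<exists>l'. has_pos_integral C lb R h l' \<and> l' A = l A" using l by blast
  fix v assume "\<exists>l'. has_pos_integral C lb R h l' \<and> l' A = v"
  then show "v = l A" using l A defining_sequence_unique unfolding has_pos_integral_def by blast
qed

end

section \<open>Relatively uniform integrals\<close>

text \<open>One real function witnesses both kinds of smallness. The uniform bound yields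
  convergence in measure with empty exceptional sets; the integral bound controls simple integrals
  over all measurable sets at the same rate.\<close>

definition ru_close :: "'x::dedekind_complete_vector_lattice \<Rightarrow> real \<Rightarrow> (real \<Rightarrow> 'x) \<Rightarrow> (real \<Rightarrow> 'x) \<Rightarrow> bool" where
  "ru_close w e g h \<longleftrightarrow> (\<exists>k. integrable MM k \<and> (LINT t|MM. k t) \<le> e \<and>
     (\<forall>t>0. 0 \<le> k t \<and> k t \<le> e \<and> \<bar>g t - h t\<bar> \<le> k t *\<^sub>R w))"

text \<open>Only the integral over the whole half-line is recorded. The set function that the
  definition of the integral demands is recovered from the approximants in
  \<open>has_pos_integral_ru\<close>.\<close>

definition ru_integral :: "'x::dedekind_complete_vector_lattice \<Rightarrow> (real \<Rightarrow> 'x) \<Rightarrow> 'x \<Rightarrow> bool" where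
  "ru_integral w h v \<longleftrightarrow>
     (\<forall>e>0. \<exists>g. simple_fun g \<and> ru_close w e g h \<and> \<bar>simple_int g {0<..} - v\<bar> \<le> e *\<^sub>R w)"

lemma ru_close_sym: "ru_close w e g h \<Longrightarrow> ru_close w e h g"
  unfolding ru_close_def by (simp add: abs_minus_commute)

lemma ru_close_triangle:
  assumes "ru_close w e f g" "ru_close w e' g h"
  shows "ru_close w (e + e') f h"
proof -
  obtain k k' where k: "integrable MM k" "(LINT t|MM. k t) \<le> e"
      "\<And>t. 0 < t \<Longrightarrow> 0 \<le> k t \<and> k t \<le> e \<and> \<bar>f t - g t\<bar> \<le> k t *\<^sub>R w"
    and k': "integrable MM k'" "(LINT t|MM. k' t) \<le> e'"
      "\<And>t. 0 < t \<Longrightarrow> 0 \<le> k' t \<and> k' t \<le> e' \<and> \<bar>g t - h t\<bar> \<le> k' t *\<^sub>R w"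
    using assms unfolding ru_close_def by blast
  have "\<bar>f t - h t\<bar> \<le> (k t + k' t) *\<^sub>R w" if "0 < t" for t
    using order_trans[OF abs_diff_triangle[of "f t" "h t" "g t"] add_mono] k(3)[OF that] k'(3)[OF that]
    by (simp add: scaleR_add_left)
  with k k' show ?thesis
    unfolding ru_close_def by (intro exI[of _ "\<lambda>t. k t + k' t"]) (auto intro: add_mono)
qed

lemma ru_close_mono:
  assumes "ru_close w e f g" "e \<le> e'" "w \<le> w'"
  shows "ru_close w' e' f g"
  using assms(1) unfolding ru_close_def
proof (elim exE conjE, intro exI conjI allI impI)
  fix k t assume k: "\<forall>t>0. 0 \<le> k t \<and> k t \<le> e \<and> \<bar>f t - g t\<bar> \<le> k t *\<^sub>R w" "(LINT t|MM. k t) \<le> e"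
  then show "(LINT t|MM. k t) \<le> e'" using assms(2) by simp
  fix t :: real assume t: "0 < t"
  with k have *: "0 \<le> k t" "k t \<le> e" "\<bar>f t - g t\<bar> \<le> k t *\<^sub>R w" by auto
  show "k t \<le> e'" using * assms(2) by simp
  show "\<bar>f t - g t\<bar> \<le> k t *\<^sub>R w'" using *(3) scaleR_left_mono[OF assms(3) *(1)] by (rule order_trans)
qed auto

lemma ru_close_refl: "0 \<le> e \<Longrightarrow> ru_close w e f f"
  unfolding ru_close_def by (intro exI[of _ "\<lambda>_. 0"]) auto

lemma simple_int_ru_close:
  assumes A: "A \<in> sets MM" and f: "simple_fun f" and g: "simple_fun g" and fg: "ru_close w e f g" and w: "0 \<le> w"
  shows "\<bar>simple_int f A - simple_int g A\<bar> \<le> e *\<^sub>R w"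
proof -
  obtain k where k: "integrable MM k" "(LINT t|MM. k t) \<le> e"
      "\<And>t. 0 < t \<Longrightarrow> 0 \<le> k t \<and> k t \<le> e \<and> \<bar>f t - g t\<bar> \<le> k t *\<^sub>R w"
    using fg unfolding ru_close_def by blast
  have "\<bar>simple_int (\<lambda>t. f t - g t) A\<bar> \<le> (LINT t|MM. k t) *\<^sub>R w"
    by (rule simple_int_bound[OF A simple_fun_compose2[where p="(-)"] k(1)])
       (use k f g w mellin_sets_subset[OF A] in auto)
  also have "\<dots> \<le> e *\<^sub>R w" using k(2) w by (rule scaleR_right_mono)
  finally show ?thesis by (simp add: simple_int_diff[OF A f g])
qed

lemma ru_integral_cong:
  assumes "\<And>t. 0 < t \<Longrightarrow> f t = g t"
  shows "ru_integral w f v \<longleftrightarrow> ru_integral w g v"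
  unfolding ru_integral_def ru_close_def by (simp add: assms)

lemma ru_integral_mono:
  assumes "ru_integral w h v" "w \<le> w'"
  shows "ru_integral w' h v"
  unfolding ru_integral_def
proof (intro allI impI)
  fix e :: real assume e: "0 < e"
  with assms obtain g where g: "simple_fun g" "ru_close w e g h" "\<bar>simple_int g {0<..} - v\<bar> \<le> e *\<^sub>R w"
    unfolding ru_integral_def by blast
  have "\<bar>simple_int g {0<..} - v\<bar> \<le> e *\<^sub>R w'"
    using g(3) scaleR_left_mono[OF assms(2), of e] e by (auto intro: order_trans)
  with g show "\<exists>g. simple_fun g \<and> ru_close w' e g h \<and> \<bar>simple_int g {0<..} - v\<bar> \<le> e *\<^sub>R w'"
    using ru_close_mono[OF g(2) order_refl assms(2)] by blast
qed

text \<open>The definition promises one good approximant for each error, whereas here every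
  approximant is good. The vector \<open>2 *\<^sub>R w\<close> absorbs the error \<open>d\<close> of
  an auxiliary approximant, which is paid twice.\<close>

lemma ru_integral_bound_simple:
  assumes h: "ru_integral w h v" and w: "0 \<le> w" and g: "simple_fun g" "ru_close w e g h"
  shows "\<bar>simple_int g {0<..} - v\<bar> \<le> e *\<^sub>R w"
proof (rule archimedean_le[of "2 *\<^sub>R w"])
  fix d :: real assume "0 < d"
  with h obtain f where f: "simple_fun f" "ru_close w d f h" "\<bar>simple_int f {0<..} - v\<bar> \<le> d *\<^sub>R w"
    unfolding ru_integral_def by blast
  have "\<bar>simple_int g {0<..} - simple_int f {0<..}\<bar> \<le> (e + d) *\<^sub>R w"
    by (rule simple_int_ru_close[OF _ g(1) f(1) ru_close_triangle[OF g(2) ru_close_sym[OF f(2)]] w]) simp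
  from add_mono[OF this f(3)] order_trans[OF abs_diff_triangle]
  have "\<bar>simple_int g {0<..} - v\<bar> \<le> (e + d) *\<^sub>R w + d *\<^sub>R w" by blast
  also have "\<dots> = e *\<^sub>R w + d *\<^sub>R 2 *\<^sub>R w"
    by (simp add: algebra_simps flip: scaleR_2)
  finally show "\<bar>simple_int g {0<..} - v\<bar> \<le> e *\<^sub>R w + d *\<^sub>R 2 *\<^sub>R w" .
qed (use w in \<open>simp add: scaleR_nonneg_nonneg\<close>)

lemma ru_integral_unique:
  assumes h: "ru_integral w h v" "ru_integral w h v'" and w: "0 \<le> w"
  shows "v = v'"
proof (rule archimedean_eq[of "2 *\<^sub>R w"])
  fix e :: real assume "0 < e"
  with h obtain g where g: "simple_fun g" "ru_close w e g h" "\<bar>simple_int g {0<..} - v\<bar> \<le> e *\<^sub>R w"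
    unfolding ru_integral_def by blast
  have "\<bar>v - v'\<bar> \<le> \<bar>v - simple_int g {0<..}\<bar> + \<bar>simple_int g {0<..} - v'\<bar>" by (rule abs_diff_triangle)
  also have "\<dots> \<le> e *\<^sub>R w + e *\<^sub>R w"
    using g(3) ru_integral_bound_simple[OF h(2) w g(1,2)]
    by (intro add_mono) (simp_all add: abs_minus_commute)
  also have "\<dots> = e *\<^sub>R 2 *\<^sub>R w" by (simp add: scaleR_2 scaleR_add_right)
  finally show "\<bar>v - v'\<bar> \<le> e *\<^sub>R 2 *\<^sub>R w" .
qed (use w in \<open>simp add: scaleR_nonneg_nonneg\<close>)

lemma ru_approximants:
  assumes "\<And>e. 0 < e \<Longrightarrow> \<exists>g. simple_fun g \<and> ru_close w e g h"
  obtains g where "\<And>n. simple_fun (g n)" "\<And>n. ru_close w (1 / real (Suc n)) (g n) h"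
proof -
  have "\<exists>g. simple_fun g \<and> ru_close w (1 / real (Suc n)) g h" for n by (rule assms) simp
  then show thesis using that by metis
qed

lemma ru_approximants_Cauchy:
  assumes g: "\<And>n. simple_fun (g n)" "\<And>n. ru_close w (1 / real (Suc n)) (g n) h" and w: "0 \<le> w"
    and A: "A \<in> sets MM"
  shows "\<exists>l. \<forall>n. \<bar>simple_int (g n) A - l\<bar> \<le> (1 / real (Suc n)) *\<^sub>R w"
  by (rule relatively_uniform_Cauchy)
     (rule simple_int_ru_close[OF A g(1) g(1) ru_close_triangle[OF g(2) ru_close_sym[OF g(2)]] w])

text \<open>Approximability alone produces a value, namely the relatively uniform limit of the
  simple integrals, so no candidate for the integral has to be guessed.\<close>

lemma ru_integral_exists:
  assumes h: "\<And>e. 0 < e \<Longrightarrow> \<exists>g. simple_fun g \<and> ru_close w e g h" and w: "0 \<le> w"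
  shows "\<exists>v. ru_integral w h v"
proof -
  obtain g where g: "\<And>n. simple_fun (g n)" "\<And>n. ru_close w (1 / real (Suc n)) (g n) h"
    using ru_approximants[OF h] by blast
  obtain v where v: "\<And>n. \<bar>simple_int (g n) {0<..} - v\<bar> \<le> (1 / real (Suc n)) *\<^sub>R w"
    using ru_approximants_Cauchy[OF g w mellin_sets_greaterThan] by blast
  have "ru_integral w h v"
    unfolding ru_integral_def
  proof (intro allI impI)
    fix e :: real assume "0 < e"
    then obtain n where n: "1 / real (Suc n) < e" by (rule nat_approx_posE)
    have "\<bar>simple_int (g n) {0<..} - v\<bar> \<le> e *\<^sub>R w"
      using v[of n] scaleR_right_mono[OF less_imp_le[OF n] w] by (rule order_trans)
    then show "\<exists>g. simple_fun g \<and> ru_close w e g h \<and> \<bar>simple_int g {0<..} - v\<bar> \<le> e *\<^sub>R w"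
      using g n ru_close_mono[OF g(2)[of n] less_imp_le[OF n] order_refl] by blast
  qed
  then show ?thesis ..
qed

lemma ru_integralD: "ru_integral w h v \<Longrightarrow> 0 < e \<Longrightarrow> \<exists>g. simple_fun g \<and> ru_close w e g h"
  unfolding ru_integral_def by blast

text \<open>Admits approximants that are integrable without being simple, such as step functions
  multiplied by a kernel.\<close>

lemma ru_integral_closure:
  assumes h: "\<And>e. 0 < e \<Longrightarrow> \<exists>g v. ru_integral w g v \<and> ru_close w e g h" and w: "0 \<le> w"
  shows "\<exists>v. ru_integral w h v"
proof (rule ru_integral_exists[OF _ w])
  fix e :: real assume e: "0 < e"
  obtain g v where g: "ru_integral w g v" "ru_close w (e / 2) g h" using h[of "e / 2"] e by auto
  obtain f where f: "simple_fun f" "ru_close w (e / 2) f g"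
    using ru_integralD[OF g(1), of "e / 2"] e by auto
  show "\<exists>g. simple_fun g \<and> ru_close w e g h"
    using f ru_close_triangle[OF f(2) g(2)] by auto
qed

lemma ru_integral_add:
  assumes f: "ru_integral w f u" and g: "ru_integral w g v"
  shows "ru_integral w (\<lambda>t. f t + g t) (u + v)"
  unfolding ru_integral_def
proof (intro allI impI)
  fix e :: real assume "0 < e"
  then have e: "0 < e / 2" by simp
  obtain f' where f': "simple_fun f'" "ru_close w (e/2) f' f" "\<bar>simple_int f' {0<..} - u\<bar> \<le> (e/2) *\<^sub>R w"
    using f e unfolding ru_integral_def by blast
  obtain g' where g': "simple_fun g'" "ru_close w (e/2) g' g" "\<bar>simple_int g' {0<..} - v\<bar> \<le> (e/2) *\<^sub>R w"
    using g e unfolding ru_integral_def by blast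
  have "ru_close w (e/2) (\<lambda>t. f' t + g' t) (\<lambda>t. f t + g' t)" "ru_close w (e/2) (\<lambda>t. f t + g' t) (\<lambda>t. f t + g t)"
    using f'(2) g'(2) by (simp_all add: ru_close_def)
  from ru_close_triangle[OF this] have "ru_close w e (\<lambda>t. f' t + g' t) (\<lambda>t. f t + g t)" by simp
  moreover have "\<bar>simple_int (\<lambda>t. f' t + g' t) {0<..} - (u + v)\<bar> \<le> e *\<^sub>R w"
  proof -
    have "\<bar>(simple_int f' {0<..} - u) + (simple_int g' {0<..} - v)\<bar> \<le> (e/2) *\<^sub>R w + (e/2) *\<^sub>R w"
      using abs_triangle_ineq add_mono[OF f'(3) g'(3)] order_trans by blast
    also have "\<dots> = e *\<^sub>R w" by (simp flip: scaleR_add_left)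
    finally show ?thesis by (simp add: simple_int_add f' g' algebra_simps)
  qed
  moreover have "simple_fun (\<lambda>t. f' t + g' t)"
    by (rule simple_fun_compose2[where p="(+)"]) (use f' g' in auto)
  ultimately show "\<exists>h. simple_fun h \<and> ru_close w e h (\<lambda>t. f t + g t) \<and>
      \<bar>simple_int h {0<..} - (u + v)\<bar> \<le> e *\<^sub>R w" by blast
qed

lemma simple_fun_zero: "simple_fun (\<lambda>t. 0)"
  unfolding simple_fun_def by (intro exI[of _ 0] exI[of _ "\<lambda>_. 0"] exI[of _ "\<lambda>_. {}"]) (auto simp: disjoint_family_on_def)

lemma simple_int_zero: "simple_int (\<lambda>t. 0) A = 0"
  by (simp add: simple_int_def)

lemma ru_integral_zero: "0 \<le> w \<Longrightarrow> ru_integral w (\<lambda>t. 0) 0"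
  unfolding ru_integral_def
  by (intro allI impI exI[of _ "\<lambda>t. 0"])
     (simp add: simple_fun_zero simple_int_zero ru_close_refl scaleR_nonneg_nonneg)

lemma ru_integral_sum:
  assumes "finite I" "\<And>i. i \<in> I \<Longrightarrow> ru_integral w (f i) (v i)" "0 \<le> w"
  shows "ru_integral w (\<lambda>t. \<Sum>i\<in>I. f i t) (\<Sum>i\<in>I. v i)"
  using assms by (induction I rule: finite_induct) (auto intro: ru_integral_zero ru_integral_add)

lemma ru_integral_scaleR:
  assumes f: "ru_integral w f u" and w: "0 \<le> w"
  shows "ru_integral w (\<lambda>t. c *\<^sub>R f t) (c *\<^sub>R u)"
  unfolding ru_integral_def
proof (intro allI impI)
  fix e :: real assume e: "0 < e"
  \<comment> \<open>The summand 1 keeps the denominator positive for \<open>c = 0\<close>.\<close>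
  define d where "d = e / (\<bar>c\<bar> + 1)"
  have d: "0 < d" "\<bar>c\<bar> * d \<le> e" using e by (auto simp: d_def field_simps)
  obtain g where g: "simple_fun g" "ru_close w d g f" "\<bar>simple_int g {0<..} - u\<bar> \<le> d *\<^sub>R w"
    using f d unfolding ru_integral_def by blast
  obtain k where k: "integrable MM k" "(LINT t|MM. k t) \<le> d"
      "\<And>t. 0 < t \<Longrightarrow> 0 \<le> k t \<and> k t \<le> d \<and> \<bar>g t - f t\<bar> \<le> k t *\<^sub>R w"
    using g(2) unfolding ru_close_def by blast
  have *: "\<bar>c *\<^sub>R x - c *\<^sub>R y\<bar> \<le> (\<bar>c\<bar> * a) *\<^sub>R w" if "\<bar>x - y\<bar> \<le> a *\<^sub>R w" for x y a
    using scaleR_left_mono[OF that, of "\<bar>c\<bar>"] by (simp add: abs_scaleR_vl flip: scaleR_diff_right)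
  have "ru_close w e (\<lambda>t. c *\<^sub>R g t) (\<lambda>t. c *\<^sub>R f t)"
    unfolding ru_close_def
  proof (intro exI[of _ "\<lambda>t. \<bar>c\<bar> * k t"] conjI allI impI)
    have le: "\<bar>c\<bar> * a \<le> e" if "a \<le> d" for a
      using mult_left_mono[OF that, of "\<bar>c\<bar>"] d by simp
    show "integrable MM (\<lambda>t. \<bar>c\<bar> * k t)" using k by simp
    show "(LINT t|MM. \<bar>c\<bar> * k t) \<le> e" using le[OF k(2)] by simp
    fix t :: real assume "0 < t"
    from k(3)[OF this] show "0 \<le> \<bar>c\<bar> * k t" "\<bar>c\<bar> * k t \<le> e" "\<bar>c *\<^sub>R g t - c *\<^sub>R f t\<bar> \<le> (\<bar>c\<bar> * k t) *\<^sub>R w"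
      using le * by auto
  qed
  moreover have "\<bar>simple_int (\<lambda>t. c *\<^sub>R g t) {0<..} - c *\<^sub>R u\<bar> \<le> e *\<^sub>R w"
    using order_trans[OF *[OF g(3)] scaleR_right_mono[OF d(2) w]] by (simp add: simple_int_scaleR g)
  moreover have "simple_fun (\<lambda>t. c *\<^sub>R g t)" by (rule simple_fun_compose) (use g in auto)
  ultimately show "\<exists>h. simple_fun h \<and> ru_close w e h (\<lambda>t. c *\<^sub>R f t) \<and>
      \<bar>simple_int h {0<..} - c *\<^sub>R u\<bar> \<le> e *\<^sub>R w" by blast
qed

lemma ru_integral_diff:
  assumes f: "ru_integral w f u" and g: "ru_integral w g v" and w: "0 \<le> w"
  shows "ru_integral w (\<lambda>t. f t - g t) (u - v)"
  using ru_integral_add[OF f ru_integral_scaleR[OF g w, of "-1"]] by simp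

lemma ru_integral_bound:
  assumes h: "ru_integral w h v" and w: "0 \<le> w" and k: "integrable MM k"
    and le: "\<And>t. 0 < t \<Longrightarrow> 0 \<le> k t \<and> \<bar>h t\<bar> \<le> k t *\<^sub>R w"
  shows "\<bar>v\<bar> \<le> (LINT t|MM. k t) *\<^sub>R w"
proof (rule archimedean_le[of "2 *\<^sub>R w"])
  fix e :: real assume "0 < e"
  with h obtain g where g: "simple_fun g" "ru_close w e g h" "\<bar>simple_int g {0<..} - v\<bar> \<le> e *\<^sub>R w"
    unfolding ru_integral_def by blast
  then obtain k' where k': "integrable MM k'" "(LINT t|MM. k' t) \<le> e"
      "\<And>t. 0 < t \<Longrightarrow> 0 \<le> k' t \<and> k' t \<le> e \<and> \<bar>g t - h t\<bar> \<le> k' t *\<^sub>R w"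
    unfolding ru_close_def by blast
  have "\<bar>g t\<bar> \<le> (k t + k' t) *\<^sub>R w" if "0 < t" for t
  proof -
    have "\<bar>g t\<bar> \<le> \<bar>h t\<bar> + \<bar>g t - h t\<bar>" using abs_triangle_ineq[of "h t" "g t - h t"] by simp
    also have "\<dots> \<le> k t *\<^sub>R w + k' t *\<^sub>R w" using le[OF that] k'(3)[OF that] by (intro add_mono) auto
    finally show ?thesis by (simp add: scaleR_add_left)
  qed
  then have "\<bar>simple_int g {0<..}\<bar> \<le> (LINT t|MM. k t + k' t) *\<^sub>R w"
    by (intro simple_int_bound) (use g k k' le w in auto)
  also have "\<dots> \<le> ((LINT t|MM. k t) + e) *\<^sub>R w"
    using k k' w by (intro scaleR_right_mono) auto
  finally have "\<bar>simple_int g {0<..}\<bar> \<le> ((LINT t|MM. k t) + e) *\<^sub>R w" .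
  from add_mono[OF this g(3)]
  have "\<bar>simple_int g {0<..}\<bar> + \<bar>simple_int g {0<..} - v\<bar> \<le> (LINT t|MM. k t) *\<^sub>R w + e *\<^sub>R 2 *\<^sub>R w"
    by (simp add: scaleR_add_left scaleR_2 scaleR_add_right add.assoc)
  moreover have "\<bar>v\<bar> \<le> \<bar>simple_int g {0<..}\<bar> + \<bar>simple_int g {0<..} - v\<bar>"
    using abs_triangle_ineq4[of "simple_int g {0<..}" "simple_int g {0<..} - v"] by simp
  ultimately show "\<bar>v\<bar> \<le> (LINT t|MM. k t) *\<^sub>R w + e *\<^sub>R 2 *\<^sub>R w" by (rule order_trans[rotated])
qed (use w in \<open>simp add: scaleR_nonneg_nonneg\<close>)

lemma ru_integral_sup:
  assumes h: "ru_integral w h v" and w: "0 \<le> w"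
  shows "\<exists>v'. ru_integral w (\<lambda>t. sup (h t) 0) v'"
proof (rule ru_integral_exists[OF _ w])
  fix e :: real assume "0 < e"
  then obtain g where g: "simple_fun g" "ru_close w e g h" using ru_integralD[OF h] by blast
  have "ru_close w e (\<lambda>t. sup (g t) 0) (\<lambda>t. sup (h t) 0)"
    using g(2) unfolding ru_close_def by (meson abs_sup_diff_le order_trans)
  moreover have "simple_fun (\<lambda>t. sup (g t) 0)" by (rule simple_fun_compose) (use g in auto)
  ultimately show "\<exists>f. simple_fun f \<and> ru_close w e f (\<lambda>t. sup (h t) 0)" by blast
qed

text \<open>Supplies the integrable majorant of the first approximant in
  \<open>ru_imp_defining_sequence\<close>. The sum of the absolute values is a crude upper bound for
  the finitely many values.\<close>

lemma simple_fun_bounded: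
  assumes "simple_fun g"
  obtains E c where "E \<in> fin_sets" "0 \<le> c" "\<And>t. 0 < t \<Longrightarrow> \<bar>g t\<bar> \<le> indicat_real E t *\<^sub>R c"
proof -
  have g: "simple_function MM g" and fin: "emeasure MM {t \<in> space MM. g t \<noteq> 0} \<noteq> \<infinity>"
    using assms unfolding simple_bochner_integrable_iff_simple_fun[symmetric]
    by (auto simp: simple_bochner_integrable.simps)
  have finite: "finite (g ` {0<..})" using g by (auto simp: simple_function_def)
  have "{t \<in> space MM. g t \<noteq> 0} \<in> sets MM"
    using simple_functionD(2)[OF g, of "- {0}"] by (simp add: vimage_def Int_def conj_commute)
  then have E: "{t \<in> space MM. g t \<noteq> 0} \<in> fin_sets" using fin by (simp add: fin_sets_def less_top)
  have "\<bar>g t\<bar> \<le> (\<Sum>c\<in>g ` {0<..}. \<bar>c\<bar>)" if "0 < t" for t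
    using that finite by (subst sum.remove[of _ "g t"]) (auto intro: sum_nonneg)
  then have le: "\<bar>g t\<bar> \<le> indicat_real {t \<in> space MM. g t \<noteq> 0} t *\<^sub>R (\<Sum>c\<in>g ` {0<..}. \<bar>c\<bar>)" if "0 < t" for t
    using that by (auto simp: indicator_def)
  show thesis by (rule that[OF E _ le]) (simp_all add: sum_nonneg)
qed

lemma tail_integral_tendsto_0:
  assumes k: "integrable MM k"
  shows "(\<lambda>m. LINT t|MM. indicat_real ({0<..} - {exp (- real m)..exp (real m)}) t * k t) \<longlonglongrightarrow> 0"
proof -
  have "(\<lambda>m. LINT t|MM. indicat_real ({0<..} - {exp (- real m)..exp (real m)}) t * k t) \<longlonglongrightarrow> (LINT t|MM. 0)"
  proof (rule integral_dominated_convergence[where w="\<lambda>t. \<bar>k t\<bar>"])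
    have [measurable]: "{0<..} - {exp (- real m)..exp (real m)} \<in> sets MM" for m
      by (auto simp: mellin_measure_def sets_restrict_space intro!: image_eqI[of _ _ "{0<..} - {exp (- real m)..exp (real m)}"])
    have [measurable]: "k \<in> borel_measurable MM" using k by simp
    show "(\<lambda>t. indicat_real ({0<..} - {exp (- real m)..exp (real m)}) t * k t) \<in> borel_measurable MM" for m
      by measurable
    show "AE t in MM. (\<lambda>m. indicat_real ({0<..} - {exp (- real m)..exp (real m)}) t * k t) \<longlonglongrightarrow> 0"
    proof (rule AE_I2)
      fix t assume "t \<in> space MM"
      then have t: "0 < t" by simp
      obtain N :: nat where N: "\<bar>ln t\<bar> \<le> real N" using real_arch_simple by blast
      have "indicat_real ({0<..} - {exp (- real m)..exp (real m)}) t * k t = 0" if "N \<le> m" for m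
      proof -
        have "- real m \<le> ln t" "ln t \<le> real m" using N that by linarith+
        then have "exp (- real m) \<le> t" "t \<le> exp (real m)" using t by (metis exp_le_cancel_iff exp_ln)+
        then show ?thesis by simp
      qed
      then show "(\<lambda>m. indicat_real ({0<..} - {exp (- real m)..exp (real m)}) t * k t) \<longlonglongrightarrow> 0"
        by (intro tendsto_eventually eventually_sequentiallyI[of N])
    qed
  qed (use k in \<open>auto simp: indicator_def\<close>)
  then show ?thesis by simp
qed

lemma mellin_interval_fin: "0 < a \<Longrightarrow> {a..b} \<in> fin_sets"
proof -
  assume a: "0 < a"
  have s: "{a..b} \<in> sets MM"
    using a by (auto simp: mellin_measure_def sets_restrict_space intro!: image_eqI[of _ _ "{a..b}"])
  have "emeasure MM {a..b} = (\<integral>\<^sup>+t\<in>{a..b}. ennreal (1 / t) \<partial>lebesgue_on {0<..})"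
    using s unfolding mellin_measure_def by (intro emeasure_density) (auto simp: mellin_measure_def intro!: measurable_restrict_space1 measurable_completion)
  also have "\<dots> \<le> (\<integral>\<^sup>+t. ennreal (1 / a) * indicator {a..b} t \<partial>lebesgue_on {0<..})"
    by (intro nn_integral_mono) (use a in \<open>auto simp: indicator_def frac_le intro!: ennreal_leI\<close>)
  also have "\<dots> = ennreal (1 / a) * emeasure (lebesgue_on {0<..}) {a..b}"
    using s by (intro nn_integral_cmult_indicator) (simp add: mellin_measure_def)
  also have "emeasure (lebesgue_on {0<..}) {a..b} = emeasure lebesgue {a..b}"
    using a by (intro emeasure_restrict_space) auto
  also have "ennreal (1 / a) * \<dots> < top" by (auto simp: ennreal_mult_less_top emeasure_lborel_Icc_eq)
  finally show ?thesis using s by (simp add: fin_sets_def)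
qed

section \<open>From relatively uniform integrals to the abstract integral\<close>

context
  fixes C :: "'x::dedekind_complete_vector_lattice convergence"
    and lb :: "(nat \<Rightarrow> 'x) \<Rightarrow> 'x extended"
    and R :: "real convergence"
  assumes setting: "convergence_setting C lb R"
begin

text \<open>All \<open>g n\<close> obey the bound \<open>(k n t + K t) *\<^sub>R U\<close>: compare
  \<open>g n\<close> with \<open>h\<close>, then \<open>h\<close> with \<open>g 0\<close>, and use
  that \<open>g 0\<close> is simple. \<open>K\<close> is independent of \<open>n\<close> and the
  integral of \<open>k n\<close> tends to 0, which is what equi-absolute continuity needs.\<close>

lemma ru_imp_defining_sequence:
  assumes w: "0 \<le> w" and g: "\<And>n. simple_fun (g n)" "\<And>n. ru_close w (1 / real (Suc n)) (g n) h"
  shows "defining_sequence C lb R g h"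
proof -
  note convC = convC[OF setting] and convR = convR[OF setting]
  have ga: "simple_fun (\<lambda>t. \<bar>g n t\<bar>)" for n by (rule simple_fun_compose[where p=abs]) (simp_all add: g)
  obtain k where k: "\<And>n. integrable MM (k n)" "\<And>n. (LINT t|MM. k n t) \<le> 1 / real (Suc n)"
      "\<And>n t. 0 < t \<Longrightarrow> 0 \<le> k n t \<and> k n t \<le> 1 / real (Suc n) \<and> \<bar>g n t - h t\<bar> \<le> k n t *\<^sub>R w"
    using g(2) unfolding ru_close_def by metis
  obtain E c where E: "E \<in> fin_sets" and c: "0 \<le> c" and g0: "\<And>t. 0 < t \<Longrightarrow> \<bar>g 0 t\<bar> \<le> indicat_real E t *\<^sub>R c"
    using simple_fun_bounded[OF g(1)] by blast
  define U where "U = w + c"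
  define K where "K = (\<lambda>t. k 0 t + indicat_real E t)"
  have U: "0 \<le> U" using w c by (simp add: U_def)
  have K: "integrable MM K" unfolding K_def using k(1) integrable_mellin_indicator[OF E] by (rule Bochner_Integration.integrable_add)
  have K0: "0 \<le> K t" "K t \<le> 2" if "0 < t" for t using k(3)[OF that, of 0] by (auto simp: K_def indicator_def)
  have g_le: "\<bar>g n t\<bar> \<le> (k n t + K t) *\<^sub>R U" if t: "0 < t" for n t
  proof -
    have "\<bar>g n t\<bar> \<le> \<bar>g n t - h t\<bar> + \<bar>h t\<bar>" using abs_triangle_ineq[of "g n t - h t" "h t"] by simp
    also have "\<bar>h t\<bar> \<le> \<bar>g 0 t - h t\<bar> + \<bar>g 0 t\<bar>" using abs_triangle_ineq4[of "g 0 t" "g 0 t - h t"] by (simp add: add.commute)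
    also have "\<bar>g n t - h t\<bar> + (\<bar>g 0 t - h t\<bar> + \<bar>g 0 t\<bar>) \<le> k n t *\<^sub>R U + (k 0 t *\<^sub>R U + indicat_real E t *\<^sub>R U)"
    proof (intro add_mono)
      show "\<bar>g n t - h t\<bar> \<le> k n t *\<^sub>R U" "\<bar>g 0 t - h t\<bar> \<le> k 0 t *\<^sub>R U"
        using k(3)[OF t, of n] k(3)[OF t, of 0] c
        by (auto intro: order_trans[OF _ scaleR_left_mono] simp: U_def)
      show "\<bar>g 0 t\<bar> \<le> indicat_real E t *\<^sub>R U"
        using w by (auto intro!: order_trans[OF g0[OF t]] scaleR_left_mono simp: U_def)
    qed
    finally show ?thesis by (simp add: K_def scaleR_add_left)
  qed
  have eq: "equi_abs_continuous C lb R g"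
    unfolding equi_abs_continuous_def
  proof (intro conjI allI impI)
    fix A :: "nat \<Rightarrow> real set" assume A: "(\<forall>n. A n \<in> fin_sets) \<and> null_seq R (\<lambda>n. measure MM (A n))"
    show "null_seq C (\<lambda>n. simple_int (\<lambda>t. \<bar>g n t\<bar>) (A n))"
    proof (rule null_seq_abs_squeeze[OF convC null_seq_scaleR_null[OF setting]])
      show "null_seq R (\<lambda>n. measure MM (A n))" using A by simp
      fix n
      have An: "A n \<in> fin_sets" using A by simp
      then have sub: "A n \<subseteq> {0<..}" using mellin_sets_subset by (auto simp: fin_sets_def)
      \<comment> \<open>The constant 3 bounds \<open>k n t + K t\<close>, since \<open>k n\<close>,
        \<open>k 0\<close> and the indicator of \<open>E\<close> are each at most 1.\<close>
      show "\<bar>simple_int (\<lambda>t. \<bar>g n t\<bar>) (A n)\<bar> \<le> measure MM (A n) *\<^sub>R (3 *\<^sub>R U)"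
      proof (rule simple_int_const_bound[OF An ga])
        fix t assume "t \<in> A n"
        then have t: "0 < t" using sub by auto
        have "1 / real (Suc n) \<le> 1" by simp
        then have "k n t \<le> 1" using k(3)[OF t, of n] by linarith
        then have "(k n t + K t) *\<^sub>R U \<le> 3 *\<^sub>R U" using K0[OF t] U by (intro scaleR_right_mono) auto
        with g_le[OF t, of n] show "\<bar>\<bar>g n t\<bar>\<bar> \<le> 3 *\<^sub>R U" by simp
      qed (use U in \<open>simp add: scaleR_nonneg_nonneg\<close>)
    qed
  next
    \<comment> \<open>Intervals symmetric in logarithmic coordinates have finite measure and exhaust
      the half-line.\<close>
    define B where "B = (\<lambda>m::nat. {exp (- real m)..exp (real m)})"
    define \<tau> where "\<tau> = (\<lambda>m. LINT t|MM. indicat_real ({0<..} - B m) t * K t)"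
    have B: "B m \<in> fin_sets" for m by (simp add: B_def mellin_interval_fin)
    have cB: "{0<..} - B m \<in> sets MM" for m using B[of m] by (auto simp: fin_sets_def)
    have \<tau>0: "0 \<le> \<tau> m" for m unfolding \<tau>_def
      by (rule Bochner_Integration.integral_nonneg) (auto simp: indicator_def K0)
    have "\<exists>b. lb (\<lambda>n. simple_int (\<lambda>t. \<bar>g n t\<bar>) ({0<..} - B m)) = Fin b \<and> 0 \<le> b \<and> b \<le> \<tau> m *\<^sub>R U" for m
    proof (rule lb_le_Fin[OF setting])
      show "0 \<le> simple_int (\<lambda>t. \<bar>g n t\<bar>) ({0<..} - B m)" for n
        by (rule simple_int_nonneg[OF cB ga]) simp
      show t0: "0 \<le> \<tau> m *\<^sub>R U" using \<tau>0 U by (simp add: scaleR_nonneg_nonneg)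
      show "lb (\<lambda>n. \<tau> m *\<^sub>R U) \<le> Fin (\<tau> m *\<^sub>R U)" by (simp add: lb_const[OF setting t0])
      \<comment> \<open>The part of the majorant that depends on \<open>n\<close> is null and drops
        out of the upper limit; only the tail of the fixed function \<open>K\<close>
        remains.\<close>
      show "null_seq C (\<lambda>n. (1 / real (Suc n)) *\<^sub>R U)"
        by (rule null_seq_inverse_Suc[OF setting U])
      show "0 \<le> (1 / real (Suc n)) *\<^sub>R U" for n using U by (simp add: scaleR_nonneg_nonneg)
      show "simple_int (\<lambda>t. \<bar>g n t\<bar>) ({0<..} - B m) \<le> \<tau> m *\<^sub>R U + (1 / real (Suc n)) *\<^sub>R U" for n
      proof -
        let ?k = "\<lambda>t. indicat_real ({0<..} - B m) t * K t + k n t"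
        have int: "integrable MM (\<lambda>t. indicat_real ({0<..} - B m) t * K t)"
          using integrable_mult_indicator[OF cB K] by simp
        have "\<bar>simple_int (\<lambda>t. \<bar>g n t\<bar>) ({0<..} - B m)\<bar> \<le> (LINT t|MM. ?k t) *\<^sub>R U"
        proof (rule simple_int_bound[OF cB ga _ _ U])
          show "integrable MM ?k" using int k(1) by (rule Bochner_Integration.integrable_add)
          show "0 \<le> ?k t" if "0 < t" for t using k(3)[OF that, of n] K0[OF that] by auto
          show "\<bar>\<bar>g n t\<bar>\<bar> \<le> ?k t *\<^sub>R U" if "t \<in> {0<..} - B m" for t
            using g_le[of t n] that by (simp add: add.commute)
        qed
        also have "(LINT t|MM. ?k t) *\<^sub>R U \<le> (\<tau> m + 1 / real (Suc n)) *\<^sub>R U"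
          using k(2)[of n] Bochner_Integration.integral_add[OF int k(1)[of n]] U
          by (intro scaleR_right_mono) (auto simp: \<tau>_def)
        finally show ?thesis unfolding scaleR_add_left by (rule order_trans[OF abs_ge_self])
      qed
    qed
    then obtain b where b: "\<And>m. lb (\<lambda>n. simple_int (\<lambda>t. \<bar>g n t\<bar>) ({0<..} - B m)) = Fin (b m)"
      "\<And>m. 0 \<le> b m" "\<And>m. b m \<le> \<tau> m *\<^sub>R U" by metis
    have "null_seq C b"
    proof (rule null_seq_scaleR_real[OF setting U _ b(2,3)])
      show "\<tau> \<longlonglongrightarrow> 0" unfolding \<tau>_def B_def by (rule tail_integral_tendsto_0[OF K])
    qed
    moreover have "incseq B" by (auto simp: incseq_def B_def elim!: order_trans[rotated] order_trans)
    ultimately show "\<exists>B b. incseq B \<and> (\<forall>m. B m \<in> fin_sets) \<and>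
        (\<forall>m. lb (\<lambda>n. simple_int (\<lambda>t. \<bar>g n t\<bar>) ({0<..} - B m)) = Fin (b m)) \<and> null_seq C b"
      using B b(1) by blast
  qed
  have "converges_in_measure C R A g h" if A: "A \<in> fin_sets" for A
    unfolding converges_in_measure_def
  proof (intro exI[of _ "\<lambda>n. {}"] conjI allI)
    \<comment> \<open>The convergence is uniform, so the exceptional sets can be taken
      empty.\<close>
    show "null_seq R (\<lambda>n. measure MM (A \<inter> {}))" using null_seq_zero[OF convR] by simp
    show "sup_null C (\<lambda>n. (\<lambda>t. \<bar>g n t - h t\<bar>) ` (A - {}))"
    proof (rule sup_null_le[OF convC])
      show "null_seq C (\<lambda>n. (1 / real (Suc n)) *\<^sub>R w)"
        by (rule null_seq_inverse_Suc[OF setting w])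
      show "0 \<le> (1 / real (Suc n)) *\<^sub>R w" for n using w by (simp add: scaleR_nonneg_nonneg)
      fix n v assume "v \<in> (\<lambda>t. \<bar>g n t - h t\<bar>) ` (A - {})"
      then obtain t where t: "t \<in> A" "v = \<bar>g n t - h t\<bar>" by auto
      then have "0 < t" using A mellin_sets_subset[of A] by (auto simp: fin_sets_def)
      from k(3)[OF this, of n] have "v \<le> k n t *\<^sub>R w" "k n t \<le> 1 / real (Suc n)" using t by auto
      then show "v \<le> (1 / real (Suc n)) *\<^sub>R w" using w by (meson order_trans scaleR_right_mono)
    qed
  qed (auto simp: fin_sets_def)
  with g(1) eq show ?thesis by (auto simp: defining_sequence_def)
qed

text \<open>The set function is chosen one measurable set at a time. The supremum over all sets is
  under control because the rate \<open>1 / real (Suc n)\<close> is the same for each of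
  them.\<close>

lemma has_pos_integral_ru:
  assumes h: "ru_integral w h v" and w: "0 \<le> w" and h0: "\<And>t. 0 < t \<Longrightarrow> 0 \<le> h t"
  shows "\<exists>l. has_pos_integral C lb R h l \<and> l {0<..} = v"
proof -
  obtain g where g: "\<And>n. simple_fun (g n)" "\<And>n. ru_close w (1 / real (Suc n)) (g n) h"
    using ru_approximants[OF ru_integralD[OF h]] by blast
  have "\<exists>l. \<forall>n. \<bar>simple_int (g n) A - l\<bar> \<le> (1 / real (Suc n)) *\<^sub>R w" if "A \<in> sets MM" for A
    by (rule ru_approximants_Cauchy[OF g w that])
  then obtain l where l: "\<And>A n. A \<in> sets MM \<Longrightarrow> \<bar>simple_int (g n) A - l A\<bar> \<le> (1 / real (Suc n)) *\<^sub>R w"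
    by metis
  have "sup_null C (\<lambda>n. (\<lambda>A. \<bar>simple_int (g n) A - l A\<bar>) ` sets MM)"
  proof (rule sup_null_le[OF convC[OF setting]])
    show "null_seq C (\<lambda>n. (1 / real (Suc n)) *\<^sub>R w)"
      by (rule null_seq_inverse_Suc[OF setting w])
    show "0 \<le> (1 / real (Suc n)) *\<^sub>R w" for n using w by (simp add: scaleR_nonneg_nonneg)
  qed (use l in auto)
  then have "has_pos_integral C lb R h l"
    using ru_imp_defining_sequence[OF w g] h0 unfolding has_pos_integral_def by blast
  moreover have "l {0<..} = v"
  proof (rule archimedean_eq[of "2 *\<^sub>R w"])
    fix e :: real assume "0 < e"
    then obtain n where n: "1 / real (Suc n) < e" by (rule nat_approx_posE)
    have "\<bar>l {0<..} - v\<bar> \<le> \<bar>l {0<..} - simple_int (g n) {0<..}\<bar> + \<bar>simple_int (g n) {0<..} - v\<bar>"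
      by (rule abs_diff_triangle)
    also have "\<dots> \<le> (1 / real (Suc n)) *\<^sub>R w + (1 / real (Suc n)) *\<^sub>R w"
      using l[of "{0<..}" n] ru_integral_bound_simple[OF h w g]
      by (intro add_mono) (auto simp: abs_minus_commute)
    also have "\<dots> \<le> e *\<^sub>R w + e *\<^sub>R w" using n w by (intro add_mono scaleR_right_mono) auto
    also have "\<dots> = e *\<^sub>R 2 *\<^sub>R w" by (simp add: scaleR_2 scaleR_add_right)
    finally show "\<bar>l {0<..} - v\<bar> \<le> e *\<^sub>R 2 *\<^sub>R w" .
  qed (use w in \<open>simp add: scaleR_nonneg_nonneg\<close>)
  ultimately show ?thesis by blast
qed

lemma pos_neg_parts: "sup x 0 - sup (- x) 0 = x" for x :: 'x
proof -
  have "x + sup (- x) 0 = sup x 0" using add_sup_distrib_left[of x "- x" 0] by (simp add: sup_commute)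
  then show ?thesis unfolding diff_eq_eq by simp
qed

text \<open>The bridge by which all later integrals are evaluated. Both parts of \<open>h\<close>
  inherit approximability, and uniqueness of the relatively uniform value identifies their
  difference with \<open>v\<close>.\<close>

lemma vl_integral_ru:
  assumes h: "ru_integral w h v" and w: "0 \<le> w"
  shows "vl_integrable C lb R h" and "vl_integral C lb R h {0<..} = v"
proof -
  obtain v1 where v1: "ru_integral w (\<lambda>t. sup (h t) 0) v1" using ru_integral_sup[OF h w] by blast
  have "ru_integral w (\<lambda>t. - h t) (- v)" using ru_integral_scaleR[OF h w, of "-1"] by simp
  then obtain v2 where v2: "ru_integral w (\<lambda>t. sup (- h t) 0) v2" using ru_integral_sup[OF _ w] by blast
  have "ru_integral w h (v1 - v2)" using ru_integral_diff[OF v1 v2 w] by (simp only: pos_neg_parts)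
  then have v: "v = v1 - v2" using ru_integral_unique[OF h _ w] by blast
  obtain l1 where l1: "has_pos_integral C lb R (\<lambda>t. sup (h t) 0) l1" "l1 {0<..} = v1"
    using has_pos_integral_ru[OF v1 w] by auto
  obtain l2 where l2: "has_pos_integral C lb R (\<lambda>t. sup (- h t) 0) l2" "l2 {0<..} = v2"
    using has_pos_integral_ru[OF v2 w] by auto
  show "vl_integrable C lb R h" using l1 l2 by (auto simp: vl_integrable_def)
  show "vl_integral C lb R h {0<..} = v"
    using pos_integral_eq[OF setting l1(1), of "{0<..}"] pos_integral_eq[OF setting l2(1), of "{0<..}"] l1 l2 v
    by (simp add: vl_integral_def)
qed

lemma ru_integral_nonneg:
  assumes h: "ru_integral w h v" and w: "0 \<le> w" and h0: "\<And>t. 0 < t \<Longrightarrow> 0 \<le> h t"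
  shows "0 \<le> v"
proof (rule archimedean_le[of "2 *\<^sub>R w"])
  fix e :: real assume "0 < e"
  then obtain g where g: "simple_fun g" "ru_close w e g h" using ru_integralD[OF h] by blast
  \<comment> \<open>As \<open>h\<close> is nonnegative, the positive part of an approximant is an
    approximant with the same error function, and its simple integral is nonnegative.\<close>
  have "ru_close w e (\<lambda>t. sup (g t) 0) h"
    unfolding ru_close_def
  proof -
    obtain k where k: "integrable MM k" "(LINT t|MM. k t) \<le> e"
      "\<And>t. 0 < t \<Longrightarrow> 0 \<le> k t \<and> k t \<le> e \<and> \<bar>g t - h t\<bar> \<le> k t *\<^sub>R w"
      using g(2) unfolding ru_close_def by blast
    have "\<bar>sup (g t) 0 - h t\<bar> \<le> k t *\<^sub>R w" if "0 < t" for t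
      using abs_sup_diff_le[of "g t" 0 "h t"] k(3)[OF that] h0[OF that] by (auto simp: sup_absorb1)
    with k show "\<exists>k. integrable MM k \<and> (LINT t|MM. k t) \<le> e \<and>
        (\<forall>t>0. 0 \<le> k t \<and> k t \<le> e \<and> \<bar>sup (g t) 0 - h t\<bar> \<le> k t *\<^sub>R w)" by blast
  qed
  moreover have s: "simple_fun (\<lambda>t. sup (g t) 0)" by (rule simple_fun_compose) (use g in auto)
  ultimately have "\<bar>simple_int (\<lambda>t. sup (g t) 0) {0<..} - v\<bar> \<le> e *\<^sub>R w"
    using ru_integral_bound_simple[OF h w] by blast
  moreover have "0 \<le> simple_int (\<lambda>t. sup (g t) 0) {0<..}"
    by (rule simple_int_nonneg[OF _ s]) auto
  moreover have "e *\<^sub>R w \<le> e *\<^sub>R 2 *\<^sub>R w" using \<open>0 < e\<close> w by (intro scaleR_left_mono) (auto simp: scaleR_2)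
  ultimately show "0 \<le> v + e *\<^sub>R 2 *\<^sub>R w" by (auto simp: abs_diff_le) (meson add_left_mono order_trans)
qed (use w in \<open>simp add: scaleR_nonneg_nonneg\<close>)

end

section \<open>Mellin convolution\<close>

lemma mellin_sets_borel: "I \<in> sets borel \<Longrightarrow> I \<subseteq> {0<..} \<Longrightarrow> I \<in> sets MM"
  by (auto simp: mellin_measure_def sets_restrict_space intro!: image_eqI[of _ _ I])

text \<open>The substitution t = e^x turns dt/t into dx. Borel measurability of \<open>h\<close>
  permits the passage between Lebesgue measure, for which the substitution theorem is stated, and
  \<open>lborel\<close>.\<close>

lemma mellin_exp:
  fixes h :: "real \<Rightarrow> real"
  assumes h: "h \<in> borel_measurable borel"
  shows "integrable MM h \<longleftrightarrow> integrable lborel (\<lambda>x. h (exp x))"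
    and "integrable lborel (\<lambda>x. h (exp x)) \<Longrightarrow> (LINT t|MM. h t) = (LINT x|lborel. h (exp x))"
proof -
  have he: "(\<lambda>x. h (exp x)) \<in> borel_measurable borel"
    using h by measurable
  have hl: "h \<in> borel_measurable (lebesgue_on {0<..})"
    using h by (intro measurable_restrict_space1 measurable_completion) simp
  have 1: "(\<lambda>t::real. 1 / t) \<in> borel_measurable (lebesgue_on {0<..})"
    by (intro measurable_restrict_space1 measurable_completion) simp
  have pos: "AE t in lebesgue_on {0<..}. 0 \<le> 1 / (t::real)" by (intro AE_I2) auto
  have int1: "integrable MM h \<longleftrightarrow> (\<lambda>t. h t / t) absolutely_integrable_on {0<..}"
    unfolding mellin_measure_def set_integrable_def integrable_density[OF hl 1 pos]
    by (subst integrable_restrict_space) (simp_all add: mult.commute)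
  have val1: "(LINT t|MM. h t) = (LINT t:{0<..}|lebesgue. h t / t)"
    unfolding mellin_measure_def set_lebesgue_integral_def integral_density[OF hl 1 pos]
    by (subst integral_restrict_space) (simp_all add: mult.commute)
  \<comment> \<open>The substitution theorem couples integrability with a value. Leaving
    \<open>b\<close> arbitrary allows both the equivalence of integrability and the equality of the
    values to be read off.\<close>
  have cv: "(\<lambda>x. \<bar>exp x\<bar> * (h (exp x) / exp x)) absolutely_integrable_on UNIV \<and>
        integral UNIV (\<lambda>x. \<bar>exp x\<bar> * (h (exp x) / exp x)) = b
     \<longleftrightarrow> (\<lambda>t. h t / t) absolutely_integrable_on (range exp) \<and> integral (range exp) (\<lambda>t. h t / t) = b" for b
    by (rule has_absolute_integral_change_of_variables_1') (auto intro!: derivative_eq_intros inj_onI)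
  have "range exp = {0::real<..}"
    by (auto simp: image_iff) (metis exp_ln)
  with cv have cv: "(\<lambda>x. h (exp x)) absolutely_integrable_on UNIV \<and> integral UNIV (\<lambda>x. h (exp x)) = b
     \<longleftrightarrow> (\<lambda>t. h t / t) absolutely_integrable_on {0<..} \<and> integral {0<..} (\<lambda>t. h t / t) = b" for b
    by simp
  have int2: "(\<lambda>x. h (exp x)) absolutely_integrable_on UNIV \<longleftrightarrow> integrable lborel (\<lambda>x. h (exp x))"
    using he by (simp add: set_integrable_def integrable_completion)
  show iff: "integrable MM h \<longleftrightarrow> integrable lborel (\<lambda>x. h (exp x))"
    using cv int1 int2 by blast
  assume i: "integrable lborel (\<lambda>x. h (exp x))"
  have "(LINT t|MM. h t) = integral {0<..} (\<lambda>t. h t / t)"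
    unfolding val1 using i iff int1 by (intro set_lebesgue_integral_eq_integral) auto
  also have "\<dots> = integral UNIV (\<lambda>x. h (exp x))" using cv i int2 by metis
  also have "\<dots> = (LINT x:UNIV|lebesgue. h (exp x))"
    using i int2 by (intro set_lebesgue_integral_eq_integral(2)[symmetric]) auto
  also have "\<dots> = (LINT x|lborel. h (exp x))"
    using he by (simp add: set_lebesgue_integral_def integral_completion)
  finally show "(LINT t|MM. h t) = (LINT x|lborel. h (exp x))" .
qed

text \<open>Source of errors that are small in both senses: rounding a nonnegative function down to
  a grid of width 1/(n+1) costs at most this minimum, which is uniformly small and has an integrable
  majorant.\<close>

lemma min_integral_tendsto_0:
  fixes k :: "'a \<Rightarrow> real"
  assumes k: "integrable M k" and k0: "\<And>t. t \<in> space M \<Longrightarrow> 0 \<le> k t"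
  shows "(\<lambda>n. LINT t|M. min (1 / real (Suc n)) (k t)) \<longlonglongrightarrow> 0"
proof -
  have [measurable]: "k \<in> borel_measurable M" using k by simp
  have "(\<lambda>n. LINT t|M. min (1 / real (Suc n)) (k t)) \<longlonglongrightarrow> (LINT t|M. 0)"
  proof (rule integral_dominated_convergence[where w="\<lambda>t. \<bar>k t\<bar>"])
    show "AE t in M. (\<lambda>n. min (1 / real (Suc n)) (k t)) \<longlonglongrightarrow> 0"
    proof (rule AE_I2)
      fix t assume "t \<in> space M"
      then have "0 \<le> k t" by (rule k0)
      moreover have "(\<lambda>n. min (1 / real (Suc n)) (k t)) \<longlonglongrightarrow> min 0 (k t)"
        by (intro tendsto_min LIMSEQ_Suc[OF lim_1_over_n] tendsto_const)
      ultimately show "(\<lambda>n. min (1 / real (Suc n)) (k t)) \<longlonglongrightarrow> 0" by simp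
    qed
    show "AE t in M. norm (min (1 / real (Suc n)) (k t)) \<le> \<bar>k t\<bar>" for n
    proof (rule AE_I2)
      fix t assume "t \<in> space M"
      from k0[OF this] show "norm (min (1 / real (Suc n)) (k t)) \<le> \<bar>k t\<bar>" by (simp add: min_def)
    qed
  qed (use k in auto)
  then show ?thesis by simp
qed

text \<open>Rounding \<open>k\<close> down to multiples of \<eta> gives finitely many values because
  \<open>k\<close> is bounded. The linear map \<open>\<lambda>r. r *\<^sub>R c\<close> then carries
  the real simple integral over to the lattice.\<close>

lemma ru_integral_const:
  fixes c :: "'x::dedekind_complete_vector_lattice"
  assumes k: "integrable MM k" and kB: "\<And>t. 0 < t \<Longrightarrow> 0 \<le> k t \<and> k t \<le> B"
  shows "ru_integral \<bar>c\<bar> (\<lambda>t. k t *\<^sub>R c) ((LINT t|MM. k t) *\<^sub>R c)"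
  unfolding ru_integral_def
proof (intro allI impI)
  fix e :: real assume e: "0 < e"
  have [measurable]: "k \<in> borel_measurable MM" using k by simp
  have "\<forall>\<^sub>F n in sequentially. (LINT t|MM. min (1 / real (Suc n)) (k t)) < e"
    using order_tendstoD(2)[OF min_integral_tendsto_0[OF k] e] kB by simp
  moreover have "\<forall>\<^sub>F n in sequentially. 1 / real (Suc n) < e"
    using order_tendstoD(2)[OF LIMSEQ_Suc[OF lim_1_over_n] e] by simp
  ultimately obtain n where n: "(LINT t|MM. min (1 / real (Suc n)) (k t)) < e" "1 / real (Suc n) < e"
    using eventually_conj eventually_happens'[OF sequentially_bot] by blast
  define \<eta> where "\<eta> = 1 / real (Suc n)"
  have \<eta>: "0 < \<eta>" by (simp add: \<eta>_def)
  define s where "s = (\<lambda>t. \<eta> * real_of_int \<lfloor>k t / \<eta>\<rfloor>)"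
  have [measurable]: "s \<in> borel_measurable MM" unfolding s_def by measurable
  have s: "0 \<le> s t" "s t \<le> k t" "k t - s t \<le> \<eta>" if "0 < t" for t
  proof -
    show "0 \<le> s t" using kB[OF that] \<eta> by (simp add: s_def)
    have "real_of_int \<lfloor>k t / \<eta>\<rfloor> \<le> k t / \<eta>" "k t / \<eta> \<le> real_of_int \<lfloor>k t / \<eta>\<rfloor> + 1" by linarith+
    then have "\<eta> * real_of_int \<lfloor>k t / \<eta>\<rfloor> \<le> \<eta> * (k t / \<eta>)" "\<eta> * (k t / \<eta>) \<le> \<eta> * (real_of_int \<lfloor>k t / \<eta>\<rfloor> + 1)"
      using \<eta> mult_left_mono[OF _ less_imp_le[OF \<eta>]] by blast+
    then show "s t \<le> k t" "k t - s t \<le> \<eta>" using \<eta> by (auto simp: s_def algebra_simps)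
  qed
  have s_int: "integrable MM s"
    by (rule Bochner_Integration.integrable_bound[OF k]) (auto simp: s(1,2) kB)
  have fin: "finite (s ` space MM)"
  proof (rule finite_subset)
    show "s ` space MM \<subseteq> (\<lambda>i. \<eta> * real_of_int i) ` {0..\<lfloor>B / \<eta>\<rfloor>}"
      using kB \<eta> by (auto simp: s_def intro!: imageI floor_mono divide_right_mono)
  qed simp
  have sb: "Bochner_Integration.simple_bochner_integrable MM s"
  proof (rule simple_bochner_integrableI_bounded)
    show "simple_function MM s" by (rule simple_function_borel_measurable[OF _ fin]) simp
    show "(\<integral>\<^sup>+ t. ennreal (norm (s t)) \<partial>MM) < \<infinity>" using s_int by (simp add: integrable_iff_bounded)
  qed
  have sf: "simple_fun s" using sb by (simp add: simple_bochner_integrable_iff_simple_fun)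
  let ?g = "\<lambda>t. s t *\<^sub>R c"
  have g: "simple_fun ?g" by (rule simple_fun_compose[where p="\<lambda>r. r *\<^sub>R c", OF _ sf]) simp
  have int_min: "integrable MM (\<lambda>t. min \<eta> (k t))"
    by (rule Bochner_Integration.integrable_bound[OF k]) (use kB \<eta> in \<open>auto simp: min_def\<close>)
  have int_le: "(LINT t|MM. k t - s t) \<le> e"
  proof -
    have "(LINT t|MM. k t - s t) \<le> (LINT t|MM. min \<eta> (k t))"
      by (rule integral_mono[OF Bochner_Integration.integrable_diff[OF k s_int] int_min]) (use s in auto)
    then show ?thesis using n by (simp add: \<eta>_def)
  qed
  have "ru_close \<bar>c\<bar> e ?g (\<lambda>t. k t *\<^sub>R c)"
    unfolding ru_close_def
  proof (intro exI[of _ "\<lambda>t. k t - s t"] conjI allI impI)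
    fix t :: real assume t: "0 < t"
    show "0 \<le> k t - s t" "k t - s t \<le> e" using s[OF t] n by (auto simp: \<eta>_def)
    show "\<bar>s t *\<^sub>R c - k t *\<^sub>R c\<bar> \<le> (k t - s t) *\<^sub>R \<bar>c\<bar>"
      using s[OF t] by (simp add: abs_scaleR_vl flip: scaleR_diff_left)
  qed (use k s_int int_le in auto)
  moreover have "simple_int ?g {0<..} = (LINT t|MM. s t) *\<^sub>R c"
  proof -
    have "linear (\<lambda>r. r *\<^sub>R c)" by (intro linearI) (auto simp: scaleR_add_left)
    from simple_bochner_integral_linear[OF this sb] have
      "Bochner_Integration.simple_bochner_integral MM ?g = (LINT t|MM. s t) *\<^sub>R c"
      by (simp add: simple_bochner_integrable_eq_integral[OF sb])
    moreover have "simple_int ?g {0<..} = Bochner_Integration.simple_bochner_integral MM ?g"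
      unfolding simple_int_def Bochner_Integration.simple_bochner_integral_def space_mellin
    proof (rule sum.mono_neutral_cong_left)
      have "finite ((\<lambda>r. r *\<^sub>R c) ` s ` {0<..})" using fin by simp
      then show "finite (?g ` {0<..})" by (simp add: image_image)
    qed (auto intro!: arg_cong2[where f=scaleR] arg_cong[where f="measure MM"])
    ultimately show ?thesis by simp
  qed
  moreover have "\<bar>(LINT t|MM. s t) *\<^sub>R c - (LINT t|MM. k t) *\<^sub>R c\<bar> \<le> e *\<^sub>R \<bar>c\<bar>"
  proof -
    have "0 \<le> (LINT t|MM. k t - s t)" by (rule Bochner_Integration.integral_nonneg) (use s in auto)
    then have "\<bar>(LINT t|MM. s t) *\<^sub>R c - (LINT t|MM. k t) *\<^sub>R c\<bar> = (LINT t|MM. k t - s t) *\<^sub>R \<bar>c\<bar>"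
      using k s_int by (simp add: abs_scaleR_vl abs_minus_commute flip: scaleR_diff_left)
    also have "\<dots> \<le> e *\<^sub>R \<bar>c\<bar>" using int_le by (rule scaleR_right_mono) simp
    finally show ?thesis .
  qed
  ultimately show "\<exists>g. simple_fun g \<and> ru_close \<bar>c\<bar> e g (\<lambda>t. k t *\<^sub>R c) \<and>
      \<bar>simple_int g {0<..} - (LINT t|MM. k t) *\<^sub>R c\<bar> \<le> e *\<^sub>R \<bar>c\<bar>" using g by metis
qed

lemma ru_integral_weighted:
  fixes N :: nat
  assumes w: "0 \<le> w" and c: "\<And>i. i < N \<Longrightarrow> \<bar>c i\<bar> \<le> w"
    and k: "\<And>i. i < N \<Longrightarrow> integrable MM (k i) \<and> (\<forall>t>0. 0 \<le> k i t \<and> k i t \<le> B)"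
  shows "ru_integral w (\<lambda>t. \<Sum>i<N. k i t *\<^sub>R c i) (\<Sum>i<N. (LINT t|MM. k i t) *\<^sub>R c i)"
proof (rule ru_integral_sum[OF _ _ w])
  fix i assume "i \<in> {..<N}"
  then have i: "i < N" by simp
  show "ru_integral w (\<lambda>t. k i t *\<^sub>R c i) ((LINT t|MM. k i t) *\<^sub>R c i)"
    using ru_integral_mono[OF ru_integral_const c[OF i]] k[OF i] by blast
qed simp

text \<open>Boundedness is demanded besides integrability because rounding has to produce finitely
  many values and \<open>step_limit\<close> works with uniformly bounded weights.\<close>

definition kernel :: "(real \<Rightarrow> real) \<Rightarrow> bool" where
  "kernel k \<longleftrightarrow> integrable lborel k \<and> (\<forall>x. 0 \<le> k x) \<and> (\<exists>B. \<forall>x. k x \<le> B)"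

definition outer :: "real \<Rightarrow> (real \<Rightarrow> real) \<Rightarrow> real \<Rightarrow> real" where
  "outer \<delta> k x = indicat_real {x. \<delta> \<le> \<bar>x\<bar>} x * k x"

lemma kernel_outer:
  assumes k: "kernel k"
  shows "kernel (outer \<delta> k)"
  unfolding kernel_def
proof (intro conjI allI)
  obtain B where B: "\<And>x. k x \<le> B" and k0: "\<And>x. 0 \<le> k x" using k by (auto simp: kernel_def)
  have "{x::real. \<delta> \<le> \<bar>x\<bar>} \<in> sets lborel" by simp
  from integrable_mult_indicator[OF this, of k] show "integrable lborel (outer \<delta> k)"
    using k by (simp add: kernel_def outer_def[abs_def])
  show "0 \<le> outer \<delta> k x" for x using k0 by (simp add: outer_def)
  show "\<exists>B. \<forall>x. outer \<delta> k x \<le> B"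
    using B order_trans[OF k0 B] by (intro exI[of _ B]) (simp add: outer_def indicator_def)
qed

text \<open>In logarithmic coordinates this is the convolution of an indicator with the reflected
  kernel, that is, the scalar operator applied to the indicator of \<open>I\<close>.\<close>

definition mass_on :: "(real \<Rightarrow> real) \<Rightarrow> real set \<Rightarrow> real \<Rightarrow> real" where
  "mass_on k I s = (LINT t|MM. indicat_real I t * k (ln (t / s)))"

lemma kernel_measurable: "kernel k \<Longrightarrow> k \<in> borel_measurable borel"
  using borel_measurable_integrable[of lborel k] by (auto simp: kernel_def)

text \<open>Division by \<open>s\<close> is a translation by \<open>ln s\<close> in logarithmic
  coordinates, under which Lebesgue measure is invariant.\<close>

lemma kernel_shift:
  assumes k: "kernel k" and s: "0 < s"
  shows "integrable MM (\<lambda>t. k (ln (t / s)))" and "(LINT t|MM. k (ln (t / s))) = (LINT x|lborel. k x)"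
proof -
  have [measurable]: "k \<in> borel_measurable borel" by (rule kernel_measurable[OF k])
  have m: "(\<lambda>t. k (ln (t / s))) \<in> borel_measurable borel" by measurable
  have eq: "(\<lambda>x. k (ln (exp x / s))) = (\<lambda>x. k (- ln s + 1 * x))" using s by (simp add: ln_div)
  have i: "integrable lborel (\<lambda>x. k (ln (exp x / s)))"
    unfolding eq by (rule lborel_integrable_real_affine) (use k in \<open>auto simp: kernel_def\<close>)
  show "integrable MM (\<lambda>t. k (ln (t / s)))" using mellin_exp(1)[OF m] i by simp
  have "(LINT t|MM. k (ln (t / s))) = (LINT x|lborel. k (- ln s + 1 * x))"
    using mellin_exp(2)[OF m i] unfolding eq .
  also have "\<dots> = (LINT x|lborel. k x)"
    using lborel_integral_real_affine[of 1 k "- ln s"] by simp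
  finally show "(LINT t|MM. k (ln (t / s))) = (LINT x|lborel. k x)" .
qed

lemma kernel_shift_on:
  assumes k: "kernel k" and s: "0 < s" and I: "I \<in> sets borel" "I \<subseteq> {0<..}"
  shows "integrable MM (\<lambda>t. indicat_real I t * k (ln (t / s)))"
  using integrable_mult_indicator[OF mellin_sets_borel[OF I] kernel_shift(1)[OF k s]] by simp

lemma mass_on_bounds:
  assumes k: "kernel k" and s: "0 < s" and I: "I \<in> sets borel" "I \<subseteq> {0<..}"
  shows "0 \<le> mass_on k I s" "mass_on k I s \<le> (LINT x|lborel. k x)"
proof -
  have k0: "0 \<le> k x" for x using k by (simp add: kernel_def)
  show "0 \<le> mass_on k I s"
    unfolding mass_on_def by (rule Bochner_Integration.integral_nonneg) (simp add: k0)
  have "mass_on k I s \<le> (LINT t|MM. k (ln (t / s)))"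
    unfolding mass_on_def
    by (rule integral_mono[OF kernel_shift_on[OF assms] kernel_shift(1)[OF k s]])
       (simp add: indicator_def k0)
  then show "mass_on k I s \<le> (LINT x|lborel. k x)" by (simp add: kernel_shift(2)[OF k s])
qed

text \<open>Fubini for the nonnegative function \<open>J y * k (y - x)\<close>: integration over
  \<open>x\<close> first leaves the mass of \<open>k\<close> at each \<open>y\<close>. This exchange
  of two scalar integrals is what later controls the operators far from the support.\<close>

lemma mass_on_integrable:
  assumes k: "kernel k" and I: "I \<in> sets borel" "I \<subseteq> {0<..}" "I \<in> fin_sets"
  shows "integrable MM (mass_on k I)" and "(LINT s|MM. mass_on k I s) = measure MM I * (LINT x|lborel. k x)"
proof -
  have [measurable]: "k \<in> borel_measurable borel" by (rule kernel_measurable[OF k])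
  have [measurable]: "I \<in> sets borel" by (rule I)
  have k0: "0 \<le> k x" for x using k by (simp add: kernel_def)
  define J where "J = (\<lambda>y. indicat_real I (exp y))"
  have [measurable]: "J \<in> borel_measurable borel" unfolding J_def by measurable
  define m where "m = (\<lambda>x. LINT y|lborel. J y * k (y - x))"
  define f where "f = (\<lambda>(y, x). J y * k (y - x))"
  have [measurable]: "f \<in> borel_measurable (lborel \<Otimes>\<^sub>M lborel)" unfolding f_def by measurable
  have J_int: "integrable lborel J" "(LINT y|lborel. J y) = measure MM I"
  proof -
    have "integrable MM (indicat_real I)" "(LINT t|MM. indicat_real I t) = measure MM I"
      using I mellin_sets_subset[of I] by (auto simp: fin_sets_def Int_absorb2)
    then show "integrable lborel J" "(LINT y|lborel. J y) = measure MM I"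
      using mellin_exp[of "indicat_real I"] by (auto simp: J_def)
  qed
  have inner: "integrable lborel (\<lambda>x. J y * k (y - x))" "(LINT x|lborel. J y * k (y - x)) = J y * (LINT x|lborel. k x)" for y
  proof -
    have "integrable lborel (\<lambda>x. k (y + (-1) * x))"
      by (rule lborel_integrable_real_affine) (use k in \<open>auto simp: kernel_def\<close>)
    then show "integrable lborel (\<lambda>x. J y * k (y - x))" by simp
    show "(LINT x|lborel. J y * k (y - x)) = J y * (LINT x|lborel. k x)"
      using lborel_integral_real_affine[of "-1" k y] by simp
  qed
  have f_int: "integrable (lborel \<Otimes>\<^sub>M lborel) f"
  proof (rule lborel_pair.Fubini_integrable)
    have "(\<lambda>y. LINT x|lborel. norm (f (y, x))) = (\<lambda>y. J y * (LINT x|lborel. k x))"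
      using inner(2) k0 by (auto simp: f_def abs_mult J_def)
    then show "integrable lborel (\<lambda>y. LINT x|lborel. norm (f (y, x)))" using J_int by simp
    show "AE y in lborel. integrable lborel (\<lambda>x. f (y, x))" using inner(1) by (simp add: f_def)
  qed simp
  have m_int: "integrable lborel m"
    using lborel_pair.integrable_snd[of "\<lambda>y x. f (y, x)"] f_int by (simp add: m_def f_def)
  have m_val: "(LINT x|lborel. m x) = measure MM I * (LINT x|lborel. k x)"
  proof -
    have "(LINT x|lborel. m x) = (LINT y|lborel. LINT x|lborel. f (y, x))"
      using lborel_pair.Fubini_integral[of "\<lambda>y x. f (y, x)"] f_int by (simp add: m_def f_def)
    also have "\<dots> = measure MM I * (LINT x|lborel. k x)" using J_int by (simp only: f_def prod.case inner(2) integral_mult_left_zero)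
    finally show ?thesis .
  qed
  have [measurable]: "m \<in> borel_measurable borel" using borel_measurable_integrable[OF m_int] by simp
  have eq: "mass_on k I s = m (ln s)" if s: "0 < s" for s
  proof -
    have meas: "(\<lambda>t. indicat_real I t * k (ln (t / s))) \<in> borel_measurable borel" by measurable
    show ?thesis
      using kernel_shift_on[OF k s I(1,2)] mellin_exp[OF meas] s by (simp add: mass_on_def m_def J_def ln_div)
  qed
  have meas: "(\<lambda>s. m (ln s)) \<in> borel_measurable borel" by measurable
  have "integrable MM (\<lambda>s. m (ln s))" "(LINT s|MM. m (ln s)) = measure MM I * (LINT x|lborel. k x)"
    using mellin_exp[OF meas] m_int m_val by auto
  then show "integrable MM (mass_on k I)" "(LINT s|MM. mass_on k I s) = measure MM I * (LINT x|lborel. k x)"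
    using Bochner_Integration.integrable_cong[of MM MM "mass_on k I" "\<lambda>s. m (ln s)"]
      Bochner_Integration.integral_cong[of MM MM "mass_on k I" "\<lambda>s. m (ln s)"] eq by auto
qed

section \<open>Step approximation and vector-valued convolutions\<close>

definition modulus :: "(real \<Rightarrow> 'x::dedekind_complete_vector_lattice) \<Rightarrow> 'x \<Rightarrow> real \<Rightarrow> bool" where
  "modulus g w \<delta> \<longleftrightarrow> (\<forall>s>0. \<forall>t>0. d_ln s t \<le> \<delta> \<longrightarrow> \<bar>g s - g t\<bar> \<le> w)"

lemma modulusD: "modulus g w \<delta> \<Longrightarrow> 0 < s \<Longrightarrow> 0 < t \<Longrightarrow> d_ln s t \<le> \<delta> \<Longrightarrow> \<bar>g s - g t\<bar> \<le> w"
  by (simp add: modulus_def)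

lemma modulus_mono:
  assumes "modulus g w \<delta>" "w \<le> w'"
  shows "modulus g w' \<delta>"
  unfolding modulus_def
proof (intro allI impI)
  fix s t :: real assume "0 < s" "0 < t" "d_ln s t \<le> \<delta>"
  from modulusD[OF assms(1) this] assms(2) show "\<bar>g s - g t\<bar> \<le> w'" by (rule order_trans)
qed

text \<open>The same \<open>w\<close> bounds the values and measures the continuity, so a single
  vector serves all integrals built from \<open>g\<close>. Composition with the nonlinear factors
  stays in this class after doubling \<open>w\<close>.\<close>

definition steppable :: "real \<Rightarrow> real \<Rightarrow> 'x::dedekind_complete_vector_lattice \<Rightarrow> (real \<Rightarrow> 'x) \<Rightarrow> bool" where
  "steppable a b w g \<longleftrightarrow> 0 < a \<and> a \<le> b \<and> 0 \<le> w \<and> (\<forall>t>0. t \<notin> {a..b} \<longrightarrow> g t = 0) \<and> (\<forall>t>0. \<bar>g t\<bar> \<le> w) \<and>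
     (\<forall>e>0. \<exists>\<delta>>0. modulus g (e *\<^sub>R w) \<delta>)"

text \<open>A geometric grid is uniform for \<open>d_ln\<close>. The index of the node below
  \<open>t\<close> is a measurable function of \<open>t\<close>, and the index of \<open>b\<close>
  bounds the others on the interval, so finitely many nodes suffice.\<close>

lemma log_grid:
  fixes a b \<delta> :: real
  assumes "0 < a" "0 < \<delta>"
  obtains j :: "real \<Rightarrow> nat" where "j \<in> borel \<rightarrow>\<^sub>M count_space UNIV"
    and "\<And>t. t \<in> {a..b} \<Longrightarrow> j t \<le> j b \<and> d_ln (a * exp (real (j t) * \<delta>)) t \<le> \<delta>"
proof -
  define j where "j = (\<lambda>t. nat \<lfloor>(ln t - ln a) / \<delta>\<rfloor>)"
  have j: "j t \<le> j b \<and> d_ln (a * exp (real (j t) * \<delta>)) t \<le> \<delta>" if t: "t \<in> {a..b}" for t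
  proof
    have "ln t \<le> ln b" using t assms by simp
    then show "j t \<le> j b" unfolding j_def
      using assms by (intro nat_mono floor_mono divide_right_mono) auto
    have "0 \<le> (ln t - ln a) / \<delta>" using t assms by simp
    then have "real (j t) \<le> (ln t - ln a) / \<delta>" "(ln t - ln a) / \<delta> \<le> real (j t) + 1"
      unfolding j_def by linarith+
    then have "real (j t) * \<delta> \<le> ln t - ln a" "ln t - ln a \<le> real (j t) * \<delta> + \<delta>"
      using assms by (auto simp: field_simps)
    then show "d_ln (a * exp (real (j t) * \<delta>)) t \<le> \<delta>"
      using assms by (simp add: d_ln_def ln_mult)
  qed
  have "j \<in> borel \<rightarrow>\<^sub>M count_space UNIV" unfolding j_def by measurable
  then show thesis using j by (rule that)
qed

text \<open>The error carries the indicator of the interval, which makes it integrable besides being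
  uniformly small.\<close>

definition steps ::
  "real \<Rightarrow> real \<Rightarrow> 'x::dedekind_complete_vector_lattice \<Rightarrow> (real \<Rightarrow> 'x) \<Rightarrow> real \<Rightarrow>
    nat \<Rightarrow> (nat \<Rightarrow> real set) \<Rightarrow> (nat \<Rightarrow> 'x) \<Rightarrow> bool" where
  "steps a b w g e N I c \<longleftrightarrow> (\<forall>i<N. I i \<in> sets borel \<and> I i \<subseteq> {a..b} \<and> \<bar>c i\<bar> \<le> w) \<and>
     (\<forall>t>0. \<bar>(\<Sum>i<N. indicat_real (I i) t *\<^sub>R c i) - g t\<bar> \<le> (e * indicat_real {a..b} t) *\<^sub>R w)"

lemma steppable_steps:
  assumes g: "steppable a b w g" and e: "0 < e"
  shows "\<exists>N I c. steps a b w g e N I c"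
proof -
  have a: "0 < a" "a \<le> b" and w: "0 \<le> w" using g by (auto simp: steppable_def)
  obtain \<delta> where \<delta>: "0 < \<delta>" "modulus g (e *\<^sub>R w) \<delta>"
    using g e unfolding steppable_def by blast
  obtain j where [measurable]: "j \<in> borel \<rightarrow>\<^sub>M count_space UNIV"
    and j: "\<And>t. t \<in> {a..b} \<Longrightarrow> j t \<le> j b \<and> d_ln (a * exp (real (j t) * \<delta>)) t \<le> \<delta>"
    using log_grid[OF a(1) \<delta>(1)] by blast
  define N where "N = Suc (j b)"
  define I where "I = (\<lambda>i. {t \<in> {a..b}. j t = i})"
  define c where "c = (\<lambda>i. g (a * exp (real i * \<delta>)))"
  have sum: "(\<Sum>i<N. indicat_real (I i) t *\<^sub>R c i) = c (j t)" if t: "t \<in> {a..b}" for t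
  proof -
    have "j t < N" using j[OF t] by (simp add: N_def)
    have "(\<Sum>i<N. indicat_real (I i) t *\<^sub>R c i) = (\<Sum>i<N. if i = j t then c i else 0)"
      using t by (intro sum.cong) (auto simp: I_def)
    also have "\<dots> = c (j t)" using \<open>j t < N\<close> by simp
    finally show ?thesis .
  qed
  have "steps a b w g e N I c"
    unfolding steps_def
  proof (intro conjI[of "\<forall>i<N. _ i"] allI impI)
    fix i assume "i < N"
    have "I i \<in> sets borel" unfolding I_def by measurable
    moreover have "\<bar>c i\<bar> \<le> w" using g a by (auto simp: c_def steppable_def)
    ultimately show "I i \<in> sets borel \<and> I i \<subseteq> {a..b} \<and> \<bar>c i\<bar> \<le> w" by (auto simp: I_def)
  next
    fix t :: real assume t: "0 < t"
    show "\<bar>(\<Sum>i<N. indicat_real (I i) t *\<^sub>R c i) - g t\<bar> \<le> (e * indicat_real {a..b} t) *\<^sub>R w"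
    proof (cases "t \<in> {a..b}")
      case True
      from j[OF this] have "d_ln (a * exp (real (j t) * \<delta>)) t \<le> \<delta>" by simp
      then have "\<bar>c (j t) - g t\<bar> \<le> e *\<^sub>R w" unfolding c_def using a t by (intro modulusD[OF \<delta>(2)]) auto
      then show ?thesis using True sum by simp
    next
      case False
      then have "g t = 0" using g t by (auto simp: steppable_def)
      moreover have "(\<Sum>i<N. indicat_real (I i) t *\<^sub>R c i) = 0"
        using False by (intro sum.neutral) (auto simp: I_def)
      ultimately show ?thesis using False by simp
    qed
  qed
  then show ?thesis by blast
qed

text \<open>The weights \<open>K I\<close> stand for \<open>\<chi>\<^sub>I\<close>, for \<open>\<chi>\<^sub>I\<close> times a translate of the kernel, and for
  \<^term>\<open>mass_on k I\<close>; the limits \<open>h\<close> are then \<open>g\<close>, the integrand of the operator, and the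
  operator itself.\<close>

lemma step_limit:
  assumes g: "steppable a b w g" and B: "0 \<le> B"
    and K: "\<And>I. I \<in> sets borel \<Longrightarrow> I \<subseteq> {a..b} \<Longrightarrow> integrable MM (K I) \<and> (\<forall>t>0. 0 \<le> K I t \<and> K I t \<le> B)"
    and h: "\<And>N I c d t. 0 < d \<Longrightarrow> 0 < t \<Longrightarrow> steps a b w g d N I c \<Longrightarrow>
      \<bar>(\<Sum>i<N. K (I i) t *\<^sub>R c i) - h t\<bar> \<le> (d * K {a..b} t) *\<^sub>R w"
  shows "\<exists>v. ru_integral w h v"
proof (rule ru_integral_closure)
  show w: "0 \<le> w" using g by (simp add: steppable_def)
  fix e :: real assume e: "0 < e"
  have ab: "integrable MM (K {a..b})" "\<And>t. 0 < t \<Longrightarrow> 0 \<le> K {a..b} t \<and> K {a..b} t \<le> B"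
    using K[of "{a..b}"] by auto
  define \<kappa> where "\<kappa> = (LINT t|MM. K {a..b} t)"
  have \<kappa>: "0 \<le> \<kappa>" unfolding \<kappa>_def by (rule Bochner_Integration.integral_nonneg) (use ab in auto)
  \<comment> \<open>With this choice \<open>d * K {a..b} t\<close> stays below \<open>e\<close> both
    pointwise and in the integral; the summand 1 keeps the denominator positive.\<close>
  define d where "d = e / (1 + B + \<kappa>)"
  have d: "0 < d" "d * B \<le> e" "d * \<kappa> \<le> e" using e B \<kappa> by (auto simp: d_def field_simps)
  obtain N I c where st: "steps a b w g d N I c" using steppable_steps[OF g d(1)] by blast
  then have I: "I i \<in> sets borel \<and> I i \<subseteq> {a..b} \<and> \<bar>c i\<bar> \<le> w" if "i < N" for i
    using that by (simp add: steps_def)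
  have "ru_integral w (\<lambda>t. \<Sum>i<N. K (I i) t *\<^sub>R c i) (\<Sum>i<N. (LINT t|MM. K (I i) t) *\<^sub>R c i)"
    by (rule ru_integral_weighted[OF w]) (use I K in blast)+
  moreover have "ru_close w e (\<lambda>t. \<Sum>i<N. K (I i) t *\<^sub>R c i) h"
    unfolding ru_close_def
  proof (intro exI[of _ "\<lambda>t. d * K {a..b} t"] conjI allI impI)
    show "integrable MM (\<lambda>t. d * K {a..b} t)" using ab(1) by (rule integrable_mult_right)
    show "(LINT t|MM. d * K {a..b} t) \<le> e" using d(3) by (simp add: \<kappa>_def)
    fix t :: real assume t: "0 < t"
    show "0 \<le> d * K {a..b} t" using ab(2)[OF t] d by simp
    have "d * K {a..b} t \<le> d * B" using ab(2)[OF t] d by (intro mult_left_mono) auto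
    also have "\<dots> \<le> e" by (rule d)
    finally show "d * K {a..b} t \<le> e" .
    show "\<bar>(\<Sum>i<N. K (I i) t *\<^sub>R c i) - h t\<bar> \<le> (d * K {a..b} t) *\<^sub>R w"
      by (rule h[OF d(1) t st])
  qed
  ultimately show "\<exists>f v. ru_integral w f v \<and> ru_close w e f h" by blast
qed

lemma steppable_ru_integral:
  assumes g: "steppable a b w g"
  shows "\<exists>v. ru_integral w g v"
proof (rule step_limit[OF g zero_le_one, of indicat_real])
  have a: "0 < a" using g by (simp add: steppable_def)
  fix I assume I: "I \<in> sets borel" "I \<subseteq> {a..b}"
  then have "I \<in> fin_sets"
    using a by (intro fin_sets_subset[OF mellin_interval_fin[OF a]] mellin_sets_borel) auto
  then show "integrable MM (indicat_real I) \<and> (\<forall>t>0. 0 \<le> indicat_real I t \<and> indicat_real I t \<le> 1)"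
    using integrable_mellin_indicator by simp
qed (unfold steps_def, blast)

text \<open>\<open>step_limit\<close> is used twice. For fixed \<open>s\<close>, indicators times
  the translated kernel give the value \<open>V s\<close>; the weights \<open>mass_on k I\<close>
  then give integrability of \<open>V\<close> in \<open>s\<close>. The error of the second use is
  the integral of the error of the first, which takes the place of a Fubini theorem for vector
  integrals.\<close>

lemma mellin_convolution:
  assumes g: "steppable a b w g" and k: "kernel k"
  obtains V u where "\<And>s. 0 < s \<Longrightarrow> ru_integral w (\<lambda>t. k (ln (t / s)) *\<^sub>R g t) (V s)"
    and "ru_integral w V u" and "\<And>s. 0 < s \<Longrightarrow> \<bar>V s\<bar> \<le> mass_on k {a..b} s *\<^sub>R w"
proof -
  have a: "0 < a" "a \<le> b" and w: "0 \<le> w" and gw: "\<And>t. 0 < t \<Longrightarrow> \<bar>g t\<bar> \<le> w"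
    and g0: "\<And>t. 0 < t \<Longrightarrow> t \<notin> {a..b} \<Longrightarrow> g t = 0" using g by (auto simp: steppable_def)
  have ab: "{a..b} \<in> sets borel" "{a..b} \<subseteq> {0<..}" using a by auto
  obtain B where B: "\<And>x. k x \<le> B" and k0: "\<And>x. 0 \<le> k x" using k by (auto simp: kernel_def)
  have B0: "0 \<le> B" using B k0 order_trans by blast
  let ?K = "\<lambda>s I t. indicat_real I t * k (ln (t / s))"
  have K: "integrable MM (?K s I) \<and> (\<forall>t>0. 0 \<le> ?K s I t \<and> ?K s I t \<le> B)"
    if "0 < s" "I \<in> sets borel" "I \<subseteq> {a..b}" for s I
    using kernel_shift_on[OF k that(1,2)] that(3) ab(2) k0 B B0 by (auto simp: indicator_def)
  have diff: "\<bar>(\<Sum>i<N. ?K s (I i) t *\<^sub>R c i) - k (ln (t / s)) *\<^sub>R g t\<bar> \<le> (d * ?K s {a..b} t) *\<^sub>R w"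
    if t: "0 < t" and st: "steps a b w g d N I c" for N I c s t d
  proof -
    have le: "\<bar>(\<Sum>i<N. indicat_real (I i) t *\<^sub>R c i) - g t\<bar> \<le> (d * indicat_real {a..b} t) *\<^sub>R w"
      using st t by (simp only: steps_def)
    have "(\<Sum>i<N. ?K s (I i) t *\<^sub>R c i) - k (ln (t / s)) *\<^sub>R g t =
        k (ln (t / s)) *\<^sub>R ((\<Sum>i<N. indicat_real (I i) t *\<^sub>R c i) - g t)"
      unfolding scaleR_diff_right scaleR_sum_right scaleR_scaleR
      by (simp only: mult.commute[of _ "k (ln (t / s))"])
    then show ?thesis
      using scaleR_left_mono[OF le k0[of "ln (t / s)"]] by (simp add: abs_scaleR_vl k0 mult_ac)
  qed
  have "\<exists>v. ru_integral w (\<lambda>t. k (ln (t / s)) *\<^sub>R g t) v" if s: "0 < s" for s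
    by (rule step_limit[OF g B0, of "?K s"]) (rule K[OF s], assumption+, rule diff)
  then obtain V where V: "\<And>s. 0 < s \<Longrightarrow> ru_integral w (\<lambda>t. k (ln (t / s)) *\<^sub>R g t) (V s)" by metis
  have V_le: "\<bar>V s\<bar> \<le> mass_on k {a..b} s *\<^sub>R w" if s: "0 < s" for s
    unfolding mass_on_def
  proof (rule ru_integral_bound[OF V[OF s] w kernel_shift_on[OF k s ab]], intro conjI)
    fix t :: real assume t: "0 < t"
    show "0 \<le> indicat_real {a..b} t * k (ln (t / s))" using k0 by simp
    show "\<bar>k (ln (t / s)) *\<^sub>R g t\<bar> \<le> (indicat_real {a..b} t * k (ln (t / s))) *\<^sub>R w"
      using g0[OF t] gw[OF t] k0 by (cases "t \<in> {a..b}") (auto simp: abs_scaleR_vl intro: scaleR_left_mono)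
  qed
  have "\<exists>u. ru_integral w V u"
  proof (rule step_limit[OF g, of "LINT x|lborel. k x" "mass_on k"])
    show "0 \<le> (LINT x|lborel. k x)" using k0 by simp
    show "integrable MM (mass_on k I) \<and> (\<forall>s>0. 0 \<le> mass_on k I s \<and> mass_on k I s \<le> (LINT x|lborel. k x))"
      if I: "I \<in> sets borel" "I \<subseteq> {a..b}" for I
    proof -
      have I': "I \<subseteq> {0<..}" using I(2) ab(2) by blast
      have "I \<in> fin_sets" by (rule fin_sets_subset[OF mellin_interval_fin[OF a(1)] mellin_sets_borel[OF I(1) I'] I(2)])
      then show ?thesis using mass_on_integrable(1)[OF k I(1) I'] mass_on_bounds[OF k _ I(1) I'] by blast
    qed
    fix N I c and d s :: real
    assume d: "0 < d" and s: "0 < s" and st: "steps a b w g d N I c"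
    have I: "I i \<in> sets borel \<and> I i \<subseteq> {a..b} \<and> \<bar>c i\<bar> \<le> w" if "i < N" for i
      using st that by (simp add: steps_def)
    have step: "ru_integral w (\<lambda>t. \<Sum>i<N. ?K s (I i) t *\<^sub>R c i) (\<Sum>i<N. mass_on k (I i) s *\<^sub>R c i)"
      unfolding mass_on_def by (rule ru_integral_weighted[OF w]) (use I K[OF s] in blast)+
    \<comment> \<open>The finite sum is the convolution of the step function at \<open>s\<close>, so
      its distance to \<open>V s\<close> is bounded by integrating the pointwise error in
      \<open>t\<close>.\<close>
    have "\<bar>(\<Sum>i<N. mass_on k (I i) s *\<^sub>R c i) - V s\<bar> \<le> (LINT t|MM. d * ?K s {a..b} t) *\<^sub>R w"
    proof (rule ru_integral_bound[OF ru_integral_diff[OF step V[OF s] w] w])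
      show "integrable MM (\<lambda>t. d * ?K s {a..b} t)"
        using kernel_shift_on[OF k s ab] by (rule integrable_mult_right)
      fix t :: real assume t: "0 < t"
      show "0 \<le> d * ?K s {a..b} t \<and> \<bar>(\<Sum>i<N. ?K s (I i) t *\<^sub>R c i) - k (ln (t / s)) *\<^sub>R g t\<bar> \<le> (d * ?K s {a..b} t) *\<^sub>R w"
        using diff[OF t st] d k0 by simp
    qed
    then show "\<bar>(\<Sum>i<N. mass_on k (I i) s *\<^sub>R c i) - V s\<bar> \<le> (d * mass_on k {a..b} s) *\<^sub>R w"
      by (simp add: mass_on_def del: scaleR_sum_left)
  qed
  with V V_le that show thesis by blast
qed

text \<open>Total mass 1 writes \<open>g s\<close> as an integral against the same kernel, so the
  difference is a single integral of \<open>g t - g s\<close>. The modulus handles logarithmic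
  distances below \<delta>; elsewhere the bound \<open>2 *\<^sub>R w\<close> meets only the outer
  mass.\<close>

lemma mellin_convolution_diff:
  assumes g: "steppable a b w g" and k: "kernel k" and s: "0 < s"
    and v: "ru_integral w (\<lambda>t. k (ln (t / s)) *\<^sub>R g t) v"
    and one: "(LINT x|lborel. k x) = 1" and e: "0 < e"
    and \<delta>: "modulus g (e *\<^sub>R w) \<delta>"
  shows "\<bar>v - g s\<bar> \<le> (e + 2 * (LINT x|lborel. outer \<delta> k x)) *\<^sub>R w"
proof -
  have w: "0 \<le> w" and gw: "\<And>t. 0 < t \<Longrightarrow> \<bar>g t\<bar> \<le> w" using g by (auto simp: steppable_def)
  obtain B where B: "\<And>x. k x \<le> B" and k0: "\<And>x. 0 \<le> k x" using k by (auto simp: kernel_def)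
  define k' where "k' = outer \<delta> k"
  have k': "kernel k'" unfolding k'_def by (rule kernel_outer[OF k])
  have "ru_integral \<bar>g s\<bar> (\<lambda>t. k (ln (t / s)) *\<^sub>R g s) ((LINT t|MM. k (ln (t / s))) *\<^sub>R g s)"
    by (rule ru_integral_const[OF kernel_shift(1)[OF k s], of B]) (simp add: k0 B)
  then have "ru_integral w (\<lambda>t. k (ln (t / s)) *\<^sub>R g s) (g s)"
    using ru_integral_mono gw[OF s] by (fastforce simp: kernel_shift(2)[OF k s] one)
  from ru_integral_diff[OF v this w]
  have diff: "ru_integral w (\<lambda>t. k (ln (t / s)) *\<^sub>R g t - k (ln (t / s)) *\<^sub>R g s) (v - g s)" .
  have "\<bar>v - g s\<bar> \<le> (LINT t|MM. e * k (ln (t / s)) + 2 * k' (ln (t / s))) *\<^sub>R w"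
  proof (rule ru_integral_bound[OF diff w])
    show "integrable MM (\<lambda>t. e * k (ln (t / s)) + 2 * k' (ln (t / s)))"
      using kernel_shift(1)[OF k s] kernel_shift(1)[OF k' s] by simp
    fix t :: real assume t: "0 < t"
    have "\<bar>k (ln (t / s)) *\<^sub>R g t - k (ln (t / s)) *\<^sub>R g s\<bar> = k (ln (t / s)) *\<^sub>R \<bar>g t - g s\<bar>"
      by (simp add: abs_scaleR_vl k0 flip: scaleR_diff_right)
    also have "\<dots> \<le> (e * k (ln (t / s)) + 2 * k' (ln (t / s))) *\<^sub>R w"
    proof (cases "\<delta> \<le> \<bar>ln (t / s)\<bar>")
      case True
      have "\<bar>g t - g s\<bar> \<le> 2 *\<^sub>R w"
        using order_trans[OF abs_triangle_ineq4 add_mono[OF gw[OF t] gw[OF s]]] by (simp add: scaleR_2)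
      then have "k (ln (t / s)) *\<^sub>R \<bar>g t - g s\<bar> \<le> (2 * k (ln (t / s))) *\<^sub>R w"
        using scaleR_left_mono[OF _ k0, of "\<bar>g t - g s\<bar>" "2 *\<^sub>R w" "ln (t / s)"] by (simp add: mult.commute)
      also have "\<dots> \<le> (e * k (ln (t / s)) + 2 * k' (ln (t / s))) *\<^sub>R w"
        using True w e k0 by (intro scaleR_right_mono) (auto simp: k'_def outer_def)
      finally show ?thesis .
    next
      case False
      then have "d_ln t s \<le> \<delta>" using s t by (simp add: d_ln_def ln_div)
      from scaleR_left_mono[OF modulusD[OF \<delta> t s this] k0[of "ln (t / s)"]] show ?thesis
        using False by (simp add: k'_def outer_def mult.commute)
    qed
    finally show "0 \<le> e * k (ln (t / s)) + 2 * k' (ln (t / s)) \<and>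
      \<bar>k (ln (t / s)) *\<^sub>R g t - k (ln (t / s)) *\<^sub>R g s\<bar> \<le> (e * k (ln (t / s)) + 2 * k' (ln (t / s))) *\<^sub>R w"
      using e k0 k' by (simp add: kernel_def)
  qed
  also have "(LINT t|MM. e * k (ln (t / s)) + 2 * k' (ln (t / s))) = e + 2 * (LINT x|lborel. k' x)"
    using kernel_shift[OF k s] kernel_shift[OF k' s] one by simp
  finally show ?thesis by (simp add: k'_def)
qed

section \<open>The kernels\<close>

definition rescaled :: "(real \<Rightarrow> real) \<Rightarrow> nat \<Rightarrow> real \<Rightarrow> real" where
  "rescaled \<psi> n x = real n * \<psi> (real n * x)"

lemma kernel_rescaled:
  assumes \<psi>: "kernel \<psi>"
  shows "kernel (rescaled \<psi> n)"
  unfolding kernel_def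
proof (intro conjI allI)
  show "integrable lborel (rescaled \<psi> n)"
  proof (cases "n = 0")
    case False
    then have "integrable lborel (\<lambda>x. \<psi> (0 + real n * x))"
      using \<psi> by (intro lborel_integrable_real_affine) (auto simp: kernel_def)
    then show ?thesis by (simp add: rescaled_def[abs_def])
  qed (simp add: rescaled_def[abs_def])
  show "0 \<le> rescaled \<psi> n x" for x using \<psi> by (simp add: rescaled_def kernel_def)
  obtain B where "\<And>x. \<psi> x \<le> B" using \<psi> by (auto simp: kernel_def)
  then show "\<exists>B. \<forall>x. rescaled \<psi> n x \<le> B"
    by (intro exI[of _ "real n * B"]) (simp add: rescaled_def mult_left_mono)
qed

text \<open>The factor \<open>h\<close> is carried along so that one substitution yields both the
  total mass (constant \<open>h\<close>) and the tails (indicator \<open>h\<close>).\<close>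

lemma integral_rescaled:
  assumes "1 \<le> n"
  shows "(LINT x|lborel. h (real n * x) * rescaled \<psi> n x) = (LINT x|lborel. h x * \<psi> x)"
  using lborel_integral_real_affine[of "real n" "\<lambda>x. h x * \<psi> x" 0] assms
  by (simp add: rescaled_def mult_ac flip: integral_mult_right_zero)

text \<open>The substitution moves the cut-off from \<delta> to \<open>\<delta> * real n\<close>;
  the indicators then tend to 0 pointwise under the fixed majorant \<psi>.\<close>

lemma rescaled_tail:
  assumes \<psi>: "kernel \<psi>" and \<delta>: "0 < \<delta>"
  shows "(\<lambda>n. LINT x|lborel. outer \<delta> (rescaled \<psi> n) x) \<longlonglongrightarrow> 0"
proof -
  have [measurable]: "\<psi> \<in> borel_measurable borel" by (rule kernel_measurable[OF \<psi>])
  have "(\<lambda>n. LINT x|lborel. indicat_real {x. \<delta> * real n \<le> \<bar>x\<bar>} x * \<psi> x) \<longlonglongrightarrow> (LINT x::real|lborel. 0)"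
  proof (rule integral_dominated_convergence[where w="\<lambda>x. \<bar>\<psi> x\<bar>"])
    show "AE x in lborel. (\<lambda>n. indicat_real {x. \<delta> * real n \<le> \<bar>x\<bar>} x * \<psi> x) \<longlonglongrightarrow> 0"
    proof (rule AE_I2)
      fix x :: real
      obtain N where N: "\<bar>x\<bar> / \<delta> < real N" using reals_Archimedean2 by blast
      have "indicat_real {x. \<delta> * real n \<le> \<bar>x\<bar>} x * \<psi> x = 0" if "N \<le> n" for n
      proof -
        have "\<bar>x\<bar> / \<delta> < real n" using N that by linarith
        then show ?thesis using \<delta> by (simp add: field_simps)
      qed
      then show "(\<lambda>n. indicat_real {x. \<delta> * real n \<le> \<bar>x\<bar>} x * \<psi> x) \<longlonglongrightarrow> 0"
        by (intro tendsto_eventually eventually_sequentiallyI[of N])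
    qed
  qed (use \<psi> in \<open>auto simp: kernel_def indicator_def\<close>)
  then have "(\<lambda>n. LINT x|lborel. indicat_real {x. \<delta> * real n \<le> \<bar>x\<bar>} x * \<psi> x) \<longlonglongrightarrow> 0" by simp
  moreover have *: "(LINT x|lborel. indicat_real {x. \<delta> * real n \<le> \<bar>x\<bar>} x * \<psi> x) =
      (LINT x|lborel. outer \<delta> (rescaled \<psi> n) x)" if "1 \<le> n" for n
  proof -
    have "indicat_real {x. \<delta> * real n \<le> \<bar>x\<bar>} (real n * x) = indicat_real {x. \<delta> \<le> \<bar>x\<bar>} x" for x
      using that by (simp add: indicator_def abs_mult mult.commute)
    then show ?thesis using integral_rescaled[OF that, of "indicat_real {x. \<delta> * real n \<le> \<bar>x\<bar>}" \<psi>]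
      by (simp add: outer_def)
  qed
  ultimately show ?thesis
    by (rule Lim_transform_eventually[OF _ eventually_sequentiallyI])
qed

text \<open>With x = ln t, the power t^n becomes e^(nx) and the condition t < 1 becomes x < 0, so
  the profile is the exponential density on the negative axis.\<close>

lemma moment_profile:
  "kernel (\<lambda>x. indicat_real {..<0} x * exp x)" "(LINT x|lborel. indicat_real {..<0} x * exp x) = 1"
proof -
  have e: "einterval (- (\<infinity>::ereal)) (ereal 0) = {..<0}" by (auto simp: einterval_def)
  have 1: "((exp \<circ> real_of_ereal) \<longlongrightarrow> 0) (at_right (- (\<infinity>::ereal)))"
    by (simp add: ereal_tendsto_simps exp_at_bot)
  have 2: "((exp \<circ> real_of_ereal) \<longlongrightarrow> 1) (at_left (ereal 0))"
    unfolding ereal_tendsto_simps using tendsto_exp[OF tendsto_ident_at, of "0::real" "{..<0}"] by simp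
  note FTC = interval_integral_FTC_nonneg[of "- (\<infinity>::ereal)" "ereal 0" exp exp, OF _ _ _ _ 1 2]
  have "set_integrable lborel {..<0} (exp :: real \<Rightarrow> real)" using FTC(1) by (simp add: e)
  then show "kernel (\<lambda>x. indicat_real {..<0} x * exp x)"
    by (auto simp: kernel_def set_integrable_def indicator_def intro!: exI[of _ 1])
  show "(LINT x|lborel. indicat_real {..<0} x * exp x) = 1"
    using FTC(2) by (simp add: interval_lebesgue_integral_def e set_lebesgue_integral_def)
qed

text \<open>This is the centred normal density of variance 2, since x^2 / 4 = x^2 / (2 * 2).\<close>

lemma gauss_profile:
  "kernel (\<lambda>x. 1 / (2 * sqrt pi) * exp (- (x\<^sup>2 / 4)))" "(LINT x|lborel. 1 / (2 * sqrt pi) * exp (- (x\<^sup>2 / 4))) = 1"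
proof -
  have eq: "(\<lambda>x. 1 / (2 * sqrt pi) * exp (- (x\<^sup>2 / 4))) = normal_density 0 (sqrt 2)"
    by (auto simp: normal_density_def real_sqrt_mult fun_eq_iff)
  show "(LINT x|lborel. 1 / (2 * sqrt pi) * exp (- (x\<^sup>2 / 4))) = 1"
    unfolding eq by simp
  have "1 / (2 * sqrt pi) * exp (- (x\<^sup>2 / 4)) \<le> 1 / (2 * sqrt pi) * 1" for x
    by (intro mult_left_mono) auto
  then show "kernel (\<lambda>x. 1 / (2 * sqrt pi) * exp (- (x\<^sup>2 / 4)))"
    unfolding kernel_def by (intro conjI exI[of _ "1 / (2 * sqrt pi)"]) (auto simp: eq[simplified])
qed

text \<open>Partial integration of \<open>(1 + x\<^sup>2)\<^sup>-\<^sup>p\<close> gives the recursion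
  \<open>2p I\<^sub>p\<^sub>+\<^sub>1 = (2p - 1) I\<^sub>p\<close> for the total masses, with \<open>I\<^sub>1 = \<pi>\<close> from \<^const>\<open>arctan\<close>.\<close>

lemma poisson_cauchy_antiderivative:
  assumes "1 \<le> p"
  shows "\<exists>G. (\<forall>x. DERIV G x :> 1 / (1 + x\<^sup>2) ^ p) \<and>
    (G \<longlongrightarrow> 1 / (2 * poisson_cauchy_const p)) at_top \<and> (G \<longlongrightarrow> - 1 / (2 * poisson_cauchy_const p)) at_bot"
  using assms
proof (induction p rule: nat_induct_at_least)
  case base
  \<comment> \<open>At p = 1 the truncated difference \<open>2 * p - 3\<close> is 0, so the double
    factorial in the denominator is 1.\<close>
  have "poisson_cauchy_const 1 = 1 / pi" by (simp add: poisson_cauchy_const_def)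
  then show ?case
    by (intro exI[of _ arctan])
       (auto intro!: derivative_eq_intros tendsto_eq_intros tendsto_arctan_at_top tendsto_arctan_at_bot simp: inverse_eq_divide)
next
  case (Suc p)
  then obtain G where G: "\<And>x. DERIV G x :> 1 / (1 + x\<^sup>2) ^ p"
    "(G \<longlongrightarrow> 1 / (2 * poisson_cauchy_const p)) at_top" "(G \<longlongrightarrow> - 1 / (2 * poisson_cauchy_const p)) at_bot" by blast
  have p: "0 < real p" using Suc.hyps by simp
  \<comment> \<open>The factor that the recursion puts between consecutive total masses.\<close>
  define c where "c = (2 * real p - 1) / (2 * real p)"
  \<comment> \<open>For p = 1 truncated subtraction makes both double factorials 1; from p = 2 on
    the defining recursion of \<open>double_fact\<close> applies.\<close>
  have dfact: "double_fact (2 * Suc p - 3) = (2 * p - 1) * double_fact (2 * p - 3)"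
  proof (cases "p = 1")
    case False
    with Suc.hyps obtain r where r: "p = Suc (Suc r)" by (metis One_nat_def Suc_le_D le_antisym not_less_eq_eq Suc_leI le_SucE old.nat.exhaust)
    have e: "2 * Suc p - 3 = 2 * p - 1" "Suc (Suc (2 * p - 3)) = 2 * p - 1" using r by auto
    show ?thesis unfolding e(1) using double_fact.simps(3)[of "2 * p - 3"] unfolding e(2) .
  qed simp
  have const: "1 / poisson_cauchy_const (Suc p) = c * (1 / poisson_cauchy_const p)"
  proof -
    obtain r where r: "p = Suc r" using Suc.hyps by (cases p) auto
    have "real (2 * p - 1) = 2 * real p - 1" using Suc.hyps by (simp add: of_nat_diff)
    then show ?thesis
      unfolding poisson_cauchy_const_def dfact by (simp add: r c_def field_simps)
  qed
  \<comment> \<open>The second summand is the boundary term of the partial integration. It vanishes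
    at both ends, so the limits of \<open>G\<close> are just multiplied by \<open>c\<close>.\<close>
  define H where "H = (\<lambda>x. c * G x + x / (2 * real p * (1 + x\<^sup>2) ^ p))"
  have D: "DERIV H x :> 1 / (1 + x\<^sup>2) ^ Suc p" for x
  proof -
    have pos: "0 < 1 + x\<^sup>2" by (simp add: add_pos_nonneg)
    obtain r where r: "p = Suc r" using Suc.hyps by (cases p) auto
    have "DERIV (\<lambda>x. x / (2 * real p * (1 + x\<^sup>2) ^ p)) x :>
      (1 * (2 * real p * (1 + x\<^sup>2) ^ p) - x * (2 * real p * (real p * (1 + x\<^sup>2) ^ (p - 1) * (2 * x)))) / (2 * real p * (1 + x\<^sup>2) ^ p)\<^sup>2"
      using pos p by (auto intro!: derivative_eq_intros simp: power2_eq_square)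
    from DERIV_add[OF DERIV_cmult[OF G(1), of c] this]
    have "DERIV H x :> c * (1 / (1 + x\<^sup>2) ^ p) +
      (1 * (2 * real p * (1 + x\<^sup>2) ^ p) - x * (2 * real p * (real p * (1 + x\<^sup>2) ^ (p - 1) * (2 * x)))) / (2 * real p * (1 + x\<^sup>2) ^ p)\<^sup>2"
      by (simp add: H_def)
    moreover have "c * (1 / (1 + x\<^sup>2) ^ p) +
      (1 * (2 * real p * (1 + x\<^sup>2) ^ p) - x * (2 * real p * (real p * (1 + x\<^sup>2) ^ (p - 1) * (2 * x)))) / (2 * real p * (1 + x\<^sup>2) ^ p)\<^sup>2
      = 1 / (1 + x\<^sup>2) ^ Suc p"
    proof -
      define y where "y = 1 + x\<^sup>2"
      have x2: "x * x = y - 1" by (simp add: y_def power2_eq_square)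
      have y: "0 < y" using pos by (simp add: y_def)
      have "(1 * (2 * real p * y ^ p) - x * (2 * real p * (real p * y ^ (p - 1) * (2 * x)))) / (2 * real p * y ^ p)\<^sup>2
         = (2 * real p * y ^ p - 4 * real p * real p * (y - 1) * y ^ r) / (2 * real p * y ^ p)\<^sup>2"
        unfolding x2[symmetric] by (simp add: r algebra_simps)
      also have "\<dots> = (y - 2 * real p * (y - 1)) / (2 * real p * y ^ Suc p)"
      proof -
        define P where "P = real p"
        define z where "z = y ^ r"
        have nz: "2 * P * z \<noteq> 0" using p y by (simp add: P_def z_def)
        have "2 * real p * y ^ p - 4 * real p * real p * (y - 1) * y ^ r = (2 * P * z) * (y - 2 * P * (y - 1))"
          unfolding P_def[symmetric] by (simp add: r z_def algebra_simps)
        moreover have "(2 * real p * y ^ p)\<^sup>2 = (2 * P * z) * (2 * P * y ^ Suc p)"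
          unfolding P_def[symmetric] by (simp add: r z_def power2_eq_square)
        ultimately show ?thesis
          using nonzero_mult_divide_mult_cancel_left[OF nz] by (simp only: P_def)
      qed
      finally have 1: "(1 * (2 * real p * y ^ p) - x * (2 * real p * (real p * y ^ (p - 1) * (2 * x)))) / (2 * real p * y ^ p)\<^sup>2
         = (y - 2 * real p * (y - 1)) / (2 * real p * y ^ Suc p)" .
      have 2: "c * (1 / y ^ p) = (2 * real p - 1) * y / (2 * real p * y ^ Suc p)"
        using y p by (simp add: c_def field_simps)
      have "(2 * real p - 1) * y + (y - 2 * real p * (y - 1)) = 2 * real p" by (simp add: algebra_simps)
      then have "c * (1 / y ^ p) + (y - 2 * real p * (y - 1)) / (2 * real p * y ^ Suc p) = 2 * real p / (2 * real p * y ^ Suc p)"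
        by (simp only: 2 flip: add_divide_distrib)
      then show ?thesis using 1 p by (simp add: y_def)
    qed
    ultimately show ?thesis by simp
  qed
  have lim0: "((\<lambda>x. x / (2 * real p * (1 + x\<^sup>2) ^ p)) \<longlongrightarrow> 0) F" if F: "filterlim (\<lambda>x. \<bar>x::real\<bar>) at_top F" for F
  proof (rule Lim_null_comparison)
    show "((\<lambda>x. 1 / \<bar>x\<bar>) \<longlongrightarrow> 0) F"
      using tendsto_divide_0[OF tendsto_const filterlim_at_top_imp_at_infinity[OF F]] .
    show "\<forall>\<^sub>F x in F. norm (x / (2 * real p * (1 + x\<^sup>2) ^ p)) \<le> 1 / \<bar>x\<bar>"
    proof (rule always_eventually, rule allI)
      fix x :: real
      show "norm (x / (2 * real p * (1 + x\<^sup>2) ^ p)) \<le> 1 / \<bar>x\<bar>"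
      proof (cases "x = 0")
        case False
        have "x\<^sup>2 \<le> 1 * (1 + x\<^sup>2) ^ 1" by simp
        also have "\<dots> \<le> (2 * real p) * (1 + x\<^sup>2) ^ p"
          using Suc.hyps by (intro mult_mono power_increasing) auto
        finally have "\<bar>x\<bar> * \<bar>x\<bar> \<le> 2 * real p * (1 + x\<^sup>2) ^ p" by (simp add: power2_eq_square)
        moreover have "0 < 2 * real p * (1 + x\<^sup>2) ^ p" using p by (simp add: add_pos_nonneg)
        ultimately show ?thesis using False by (simp add: abs_mult field_simps)
      qed simp
    qed
  qed
  have top: "(H \<longlongrightarrow> c * (1 / (2 * poisson_cauchy_const p)) + 0) at_top"
    unfolding H_def by (intro tendsto_add tendsto_mult tendsto_const G lim0 filterlim_abs_real)
  have bot: "(H \<longlongrightarrow> c * (- 1 / (2 * poisson_cauchy_const p)) + 0) at_bot"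
    unfolding H_def
  proof (intro tendsto_add tendsto_mult tendsto_const G lim0)
    show "filterlim (\<lambda>x. \<bar>x::real\<bar>) at_top at_bot"
      by (simp add: filterlim_at_top_mirror[symmetric] filterlim_at_bot_mirror filterlim_abs_real)
  qed
  show ?case
  proof (intro exI[of _ H] conjI allI)
    have "c * (1 / (2 * poisson_cauchy_const p)) + 0 = c * (1 / poisson_cauchy_const p) / 2"
      "c * (- 1 / (2 * poisson_cauchy_const p)) + 0 = - (c * (1 / poisson_cauchy_const p) / 2)" by simp_all
    with top bot show "(H \<longlongrightarrow> 1 / (2 * poisson_cauchy_const (Suc p))) at_top"
      "(H \<longlongrightarrow> - 1 / (2 * poisson_cauchy_const (Suc p))) at_bot"
      unfolding const[symmetric] by (simp_all add: mult.commute)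
  qed (rule D)
qed

text \<open>The antiderivative rises from -1/(2 C_p) to 1/(2 C_p) over the real line, so (1 +
  x^2)^(-p) has total mass 1/C_p, and the constant normalises it.\<close>

lemma poisson_cauchy_profile:
  assumes "1 \<le> p"
  shows "kernel (\<lambda>x. poisson_cauchy_const p / (1 + x\<^sup>2) ^ p)"
    and "(LINT x|lborel. poisson_cauchy_const p / (1 + x\<^sup>2) ^ p) = 1"
proof -
  have pos: "0 < poisson_cauchy_const p"
  proof -
    have "0 < double_fact m" for m by (induction m rule: double_fact.induct) auto
    then show ?thesis by (simp add: poisson_cauchy_const_def)
  qed
  have y: "1 \<le> 1 + x\<^sup>2" "0 < 1 + x\<^sup>2" for x :: real by (auto simp: add_pos_nonneg)
  have y1: "1 \<le> (1 + x\<^sup>2) ^ p" for x :: real using y by (intro one_le_power) auto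
  obtain G where G: "\<And>x. DERIV G x :> 1 / (1 + x\<^sup>2) ^ p"
    "(G \<longlongrightarrow> 1 / (2 * poisson_cauchy_const p)) at_top" "(G \<longlongrightarrow> - 1 / (2 * poisson_cauchy_const p)) at_bot"
    using poisson_cauchy_antiderivative[OF assms] by blast
  have e: "einterval (- (\<infinity>::ereal)) (\<infinity>::ereal) = UNIV" by (auto simp: einterval_def)
  have 1: "((G \<circ> real_of_ereal) \<longlongrightarrow> - 1 / (2 * poisson_cauchy_const p)) (at_right (- (\<infinity>::ereal)))"
    unfolding ereal_tendsto_simps by (rule G)
  have 2: "((G \<circ> real_of_ereal) \<longlongrightarrow> 1 / (2 * poisson_cauchy_const p)) (at_left (\<infinity>::ereal))"
    unfolding ereal_tendsto_simps by (rule G)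
  have cont: "isCont (\<lambda>x::real. 1 / (1 + x\<^sup>2) ^ p) x" for x
    using y(2)[of x] by (auto intro!: continuous_intros)
  note FTC = interval_integral_FTC_nonneg[of "- (\<infinity>::ereal)" "\<infinity>::ereal" G "\<lambda>x. 1 / (1 + x\<^sup>2) ^ p", OF _ G(1) cont _ 1 2]
  have int: "integrable lborel (\<lambda>x::real. 1 / (1 + x\<^sup>2) ^ p)"
    using FTC(1) by (simp add: e set_integrable_def)
  have val: "(LINT x|lborel. 1 / (1 + x\<^sup>2) ^ p) = 1 / poisson_cauchy_const p"
    using FTC(2) pos by (simp add: interval_lebesgue_integral_def e set_lebesgue_integral_def field_simps)
  have eq: "poisson_cauchy_const p / (1 + x\<^sup>2) ^ p = poisson_cauchy_const p * (1 / (1 + x\<^sup>2) ^ p)" for x :: real by simp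
  show "(LINT x|lborel. poisson_cauchy_const p / (1 + x\<^sup>2) ^ p) = 1"
    unfolding eq integral_mult_right_zero val using pos by simp
  show "kernel (\<lambda>x. poisson_cauchy_const p / (1 + x\<^sup>2) ^ p)"
    unfolding kernel_def
  proof (intro conjI allI exI)
    show "integrable lborel (\<lambda>x. poisson_cauchy_const p / (1 + x\<^sup>2) ^ p)"
      unfolding eq using int by (rule integrable_mult_right)
    show "0 \<le> poisson_cauchy_const p / (1 + x\<^sup>2) ^ p" for x :: real using pos y1[of x] by simp
    show "poisson_cauchy_const p / (1 + x\<^sup>2) ^ p \<le> poisson_cauchy_const p" for x :: real
      using pos y1[of x] by (simp add: divide_le_eq)
  qed
qed

lemma kernel_profile:
  assumes "L = moment_kernel \<or> L = gauss_weierstrass_kernel \<or> (\<exists>p\<ge>2. L = poisson_cauchy_kernel p)"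
  obtains \<psi> where "kernel \<psi>" "(LINT x|lborel. \<psi> x) = 1" "\<And>n t. 0 < t \<Longrightarrow> L n t = rescaled \<psi> n (ln t)"
  using assms
proof (elim disjE exE conjE)
  assume L: "L = moment_kernel"
  have "L n t = rescaled (\<lambda>x. indicat_real {..<0} x * exp x) n (ln t)" if "0 < t" for n t
    using that unfolding L moment_kernel_def rescaled_def
    by (auto simp: indicator_def exp_of_nat_mult mult_less_0_iff zero_less_mult_iff)
  with moment_profile that show thesis by blast
next
  assume L: "L = gauss_weierstrass_kernel"
  have "L n t = rescaled (\<lambda>x. 1 / (2 * sqrt pi) * exp (- (x\<^sup>2 / 4))) n (ln t)" for n t
    unfolding L gauss_weierstrass_kernel_def rescaled_def by (simp add: power_mult_distrib)
  with gauss_profile that show thesis by blast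
next
  fix p :: nat assume p: "2 \<le> p" and L: "L = poisson_cauchy_kernel p"
  have "L n t = rescaled (\<lambda>x. poisson_cauchy_const p / (1 + x\<^sup>2) ^ p) n (ln t)" for n t
    unfolding L poisson_cauchy_kernel_def rescaled_def by (simp add: power_mult_distrib)
  moreover have "1 \<le> p" using p by simp
  ultimately show thesis using poisson_cauchy_profile that by blast
qed

section \<open>Powers and nonlinear factors\<close>

text \<open>Collects what powers from a multiplication and pointwise powers have in common. In the
  last clause \<open>W\<close> bounds the arguments and \<open>u\<close> is the direction of their
  difference; \<open>W + u\<close> dominates both, so a product of q factors can be compared with
  one value of \<phi>.\<close>

definition power_like :: "nat \<Rightarrow> ('x::dedekind_complete_vector_lattice \<Rightarrow> 'x) \<Rightarrow> bool" where
  "power_like q \<phi> \<longleftrightarrow> \<phi> 0 = 0 \<and> (\<forall>u. 0 \<le> \<phi> u) \<and> (\<forall>c>0. \<forall>u. \<phi> (c *\<^sub>R u) = c ^ q *\<^sub>R \<phi> u) \<and>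
     (\<forall>W u e x y. 0 \<le> W \<longrightarrow> 0 \<le> u \<longrightarrow> 0 \<le> e \<longrightarrow> \<bar>x\<bar> \<le> W \<longrightarrow> \<bar>y\<bar> \<le> W \<longrightarrow> \<bar>x - y\<bar> \<le> e *\<^sub>R u \<longrightarrow>
        \<bar>\<phi> x - \<phi> y\<bar> \<le> (e * real q) *\<^sub>R \<phi> (W + u))"

section \<open>Powers for a positive bilinear product\<close>

context
  fixes m :: "'x::dedekind_complete_vector_lattice \<Rightarrow> 'x \<Rightarrow> 'x"
  assumes bil: "bilinear m" and mpos: "\<And>x y. 0 \<le> x \<Longrightarrow> 0 \<le> y \<Longrightarrow> 0 \<le> m x y"
begin

lemma mult_mono_vl: "0 \<le> x \<Longrightarrow> x \<le> x' \<Longrightarrow> 0 \<le> y \<Longrightarrow> y \<le> y' \<Longrightarrow> m x y \<le> m x' y'"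
proof -
  assume *: "0 \<le> x" "x \<le> x'" "0 \<le> y" "y \<le> y'"
  have "0 \<le> m (x' - x) y" "0 \<le> m x' (y' - y)" using * by (auto intro!: mpos intro: order_trans)
  then have "m x y \<le> m x' y" "m x' y \<le> m x' y'"
    by (simp_all add: bilinear_lsub[OF bil] bilinear_rsub[OF bil])
  then show ?thesis by (rule order_trans)
qed

lemma mult_abs_le_right: "\<bar>m x z\<bar> \<le> m x \<bar>z\<bar>" if "0 \<le> x"
proof -
  have "0 \<le> \<bar>z\<bar> - z" "0 \<le> \<bar>z\<bar> - (- z)"
    unfolding diff_ge_0_iff_ge by (rule abs_ge_self abs_ge_minus_self)+
  then have "0 \<le> m x (\<bar>z\<bar> - z)" "0 \<le> m x (\<bar>z\<bar> - (- z))" using that by (blast intro: mpos)+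
  then show ?thesis unfolding bilinear_rsub[OF bil] bilinear_rneg[OF bil] by (simp only: abs_le_iff diff_ge_0_iff_ge)
qed

lemma mult_abs_le_left: "\<bar>m z x\<bar> \<le> m \<bar>z\<bar> x" if "0 \<le> x"
proof -
  have "0 \<le> \<bar>z\<bar> - z" "0 \<le> \<bar>z\<bar> - (- z)"
    unfolding diff_ge_0_iff_ge by (rule abs_ge_self abs_ge_minus_self)+
  then have "0 \<le> m (\<bar>z\<bar> - z) x" "0 \<le> m (\<bar>z\<bar> - (- z)) x" using that by (blast intro: mpos)+
  then show ?thesis unfolding bilinear_lsub[OF bil] bilinear_lneg[OF bil] by (simp only: abs_le_iff diff_ge_0_iff_ge)
qed

lemma iterate_nonneg: "0 \<le> x \<Longrightarrow> 0 \<le> (m x ^^ k) x"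
  by (induction k) (auto intro: mpos)

lemma iterate_mono: "0 \<le> x \<Longrightarrow> x \<le> y \<Longrightarrow> (m x ^^ k) x \<le> (m y ^^ k) y"
  by (induction k) (auto intro!: mult_mono_vl iterate_nonneg)

lemma iterate_scaleR: "(m (c *\<^sub>R x) ^^ k) (c *\<^sub>R x) = c ^ Suc k *\<^sub>R (m x ^^ k) x"
  by (induction k) (auto simp: bilinear_lmul[OF bil] bilinear_rmul[OF bil] mult_ac)

lemma iterate_lipschitz:
  assumes a: "0 \<le> a" "a \<le> W" and b: "0 \<le> b" "b \<le> W" and u: "0 \<le> u" and e: "0 \<le> e"
    and ab: "\<bar>a - b\<bar> \<le> e *\<^sub>R u"
  shows "\<bar>(m a ^^ k) a - (m b ^^ k) b\<bar> \<le> (e * real (Suc k)) *\<^sub>R (m (W + u) ^^ k) (W + u)"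
proof (induction k)
  have W: "0 \<le> W" using a by (rule order_trans)
  case 0
  have "e *\<^sub>R u \<le> e *\<^sub>R (W + u)" using W e by (intro scaleR_left_mono) auto
  with ab show ?case by (auto intro: order_trans)
next
  have W: "0 \<le> W" using a by (rule order_trans)
  let ?w = "W + u"
  case (Suc k)
  let ?p = "\<lambda>x. (m x ^^ k) x"
  have w: "0 \<le> ?w" "a \<le> ?w" "b \<le> ?w" "u \<le> ?w" using W u a b by (auto intro: add_increasing2)
  \<comment> \<open>Telescoping with the order of the factors kept. The first summand carries the
    induction hypothesis and the second adds one more \<open>e\<close>, which leads to the factor
    q.\<close>
  have "(m a ^^ Suc k) a - (m b ^^ Suc k) b = m a (?p a - ?p b) + m (a - b) (?p b)"
    by (simp add: bilinear_rsub[OF bil] bilinear_lsub[OF bil])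
  then have "\<bar>(m a ^^ Suc k) a - (m b ^^ Suc k) b\<bar> \<le> \<bar>m a (?p a - ?p b)\<bar> + \<bar>m (a - b) (?p b)\<bar>"
    by (simp only: abs_triangle_ineq)
  also have "\<bar>m a (?p a - ?p b)\<bar> \<le> m a \<bar>?p a - ?p b\<bar>" using a(1) by (rule mult_abs_le_right)
  also have "\<dots> \<le> m ?w ((e * real (Suc k)) *\<^sub>R ?p ?w)"
    using a w Suc.IH by (intro mult_mono_vl) auto
  also have "\<bar>m (a - b) (?p b)\<bar> \<le> m \<bar>a - b\<bar> (?p b)" using iterate_nonneg[OF b(1)] by (rule mult_abs_le_left)
  also have "\<dots> \<le> m (e *\<^sub>R ?w) (?p ?w)"
    using order_trans[OF ab scaleR_left_mono[OF w(4) e]] w b by (intro mult_mono_vl iterate_mono iterate_nonneg) auto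
  finally have "\<bar>(m a ^^ Suc k) a - (m b ^^ Suc k) b\<bar> \<le> m ?w ((e * real (Suc k)) *\<^sub>R ?p ?w) + m (e *\<^sub>R ?w) (?p ?w)"
    by (simp add: add_mono)
  also have "\<dots> = (e * real (Suc (Suc k))) *\<^sub>R (m ?w ^^ Suc k) ?w"
  proof -
    have "m x ((e * real (Suc k)) *\<^sub>R y) + m (e *\<^sub>R x) y = (e * real (Suc (Suc k))) *\<^sub>R m x y" for x y
      by (simp add: bilinear_lmul[OF bil] bilinear_rmul[OF bil] algebra_simps flip: scaleR_add_left)
    then show ?thesis by simp
  qed
  finally show ?case .
qed

lemma power_like_iterate:
  assumes q: "1 \<le> q" and \<phi>: "\<And>u. \<phi> u = (m \<bar>u\<bar> ^^ (q - 1)) \<bar>u\<bar>"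
  shows "power_like q \<phi>"
  unfolding power_like_def
proof (intro conjI allI impI)
  have "Suc (q - 1) = q" using q by simp
  note S = this
  \<comment> \<open>Homogeneity of the iterates holds for every real factor, and the factor 0 gives
    the value at 0.\<close>
  have "\<phi> (0 *\<^sub>R 0) = 0" using iterate_scaleR[where c=0 and x=0 and k="q - 1"] by (simp add: \<phi> S power_0_left)
  then show "\<phi> 0 = 0" by simp
  show "0 \<le> \<phi> u" for u by (simp add: \<phi> iterate_nonneg)
  show "\<phi> (c *\<^sub>R u) = c ^ q *\<^sub>R \<phi> u" if "0 < c" for c u
    using iterate_scaleR[where c=c and x="\<bar>u\<bar>" and k="q - 1"] that unfolding S by (simp add: \<phi> abs_scaleR_vl)
  fix W u x y :: 'x and e :: real
  assume *: "0 \<le> W" "0 \<le> u" "0 \<le> e" "\<bar>x\<bar> \<le> W" "\<bar>y\<bar> \<le> W" "\<bar>x - y\<bar> \<le> e *\<^sub>R u"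
  have "\<bar>\<bar>x\<bar> - \<bar>y\<bar>\<bar> \<le> e *\<^sub>R u" by (rule order_trans[OF abs_triangle_ineq3 *(6)])
  from iterate_lipschitz[OF _ *(4) _ *(5) *(2,3) this, of "q - 1"]
  show "\<bar>\<phi> x - \<phi> y\<bar> \<le> (e * real q) *\<^sub>R \<phi> (W + u)"
    unfolding S using *(1,2) by (simp add: \<phi>)
qed

end

lemma power_like_abs: "(\<And>u. \<phi> u = \<bar>u\<bar>) \<Longrightarrow> power_like 1 \<phi>"
  for \<phi> :: "'x::dedekind_complete_vector_lattice \<Rightarrow> 'x"
  unfolding power_like_def
proof (intro conjI allI impI)
  fix W u x y :: 'x and e :: real
  assume \<phi>: "\<And>u. \<phi> u = \<bar>u\<bar>" and *: "0 \<le> W" "0 \<le> u" "0 \<le> e" "\<bar>x - y\<bar> \<le> e *\<^sub>R u"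
  have "\<bar>\<bar>x\<bar> - \<bar>y\<bar>\<bar> \<le> e *\<^sub>R u" by (rule order_trans[OF abs_triangle_ineq3 *(4)])
  also have "\<dots> \<le> e *\<^sub>R (W + u)" using * by (intro scaleR_left_mono) auto
  finally show "\<bar>\<phi> x - \<phi> y\<bar> \<le> (e * real 1) *\<^sub>R \<phi> (W + u)" using * by (simp add: \<phi>)
qed (auto simp: abs_scaleR_vl)

section \<open>Powers in spaces of functions\<close>

context
  fixes M :: "'w measure" and F :: "('w \<Rightarrow> real) set"
    and cls :: "('w \<Rightarrow> real) \<Rightarrow> 'x::dedekind_complete_vector_lattice"
  assumes fs: "function_space M F cls"
begin

lemma cls_add: "h \<in> F \<Longrightarrow> k \<in> F \<Longrightarrow> (\<lambda>w. h w + k w) \<in> F \<and> cls (\<lambda>w. h w + k w) = cls h + cls k"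
  and cls_scaleR: "h \<in> F \<Longrightarrow> (\<lambda>w. c * h w) \<in> F \<and> cls (\<lambda>w. c * h w) = c *\<^sub>R cls h"
  and cls_abs_in: "h \<in> F \<Longrightarrow> (\<lambda>w. \<bar>h w\<bar>) \<in> F"
  and cls_le: "h \<in> F \<Longrightarrow> k \<in> F \<Longrightarrow> cls h \<le> cls k \<longleftrightarrow> (AE w in M. h w \<le> k w)"
  and cls_surj: "cls ` F = UNIV"
  using fs unfolding function_space_def by blast+

lemma cls_cases: obtains h where "h \<in> F" "x = cls h"
  using cls_surj by (metis UNIV_I imageE)

lemma cls_diff: "h \<in> F \<Longrightarrow> k \<in> F \<Longrightarrow> (\<lambda>w. h w - k w) \<in> F \<and> cls (\<lambda>w. h w - k w) = cls h - cls k"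
  using cls_add[of h "\<lambda>w. (-1) * k w"] cls_scaleR[of k "-1"] by simp

lemma cls_zero: "(\<lambda>w. 0) \<in> F" "cls (\<lambda>w. 0) = 0"
proof -
  obtain h where "h \<in> F" by (rule cls_cases)
  then show "(\<lambda>w. 0) \<in> F" "cls (\<lambda>w. 0) = 0" using cls_scaleR[of h 0] by simp_all
qed

text \<open>The absolute value of a class is a supremum in the lattice and has to be related to the
  pointwise one. For the harder inequality a representative of \<open>\<bar>cls h\<bar>\<close> is
  chosen, and its two almost everywhere bounds, on \<open>h\<close> and on \<open>- h\<close>, are
  combined.\<close>

lemma cls_abs:
  assumes h: "h \<in> F"
  shows "\<bar>cls h\<bar> = cls (\<lambda>w. \<bar>h w\<bar>)"
proof (rule antisym)
  have m: "(\<lambda>w. (-1) * h w) \<in> F" "cls (\<lambda>w. (-1) * h w) = - cls h" using cls_scaleR[OF h, of "-1"] by auto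
  show "\<bar>cls h\<bar> \<le> cls (\<lambda>w. \<bar>h w\<bar>)"
    unfolding abs_le_iff m(2)[symmetric]
    by (simp add: cls_le[OF h cls_abs_in[OF h]] cls_le[OF m(1) cls_abs_in[OF h], simplified])
  obtain k where k: "k \<in> F" "\<bar>cls h\<bar> = cls k" by (rule cls_cases)
  have "cls h \<le> cls k" "cls (\<lambda>w. (-1) * h w) \<le> cls k" unfolding m(2) k(2)[symmetric] by (simp_all add: abs_ge_self abs_ge_minus_self)
  then have "AE w in M. h w \<le> k w" "AE w in M. (-1) * h w \<le> k w"
    using cls_le[OF h k(1)] cls_le[OF m(1) k(1)] by auto
  then have "AE w in M. \<bar>h w\<bar> \<le> k w" by eventually_elim auto
  then show "cls (\<lambda>w. \<bar>h w\<bar>) \<le> \<bar>cls h\<bar>" using cls_le[OF cls_abs_in[OF h] k(1)] k by simp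
qed

lemma power_like_pointwise:
  assumes q: "1 \<le> q" and \<phi>: "pointwise_power F cls q \<phi>"
  shows "power_like q \<phi>"
proof -
  have pw: "(\<lambda>w. \<bar>h w\<bar> ^ q) \<in> F" "\<phi> (cls h) = cls (\<lambda>w. \<bar>h w\<bar> ^ q)" if "h \<in> F" for h
    using \<phi> that by (auto simp: pointwise_power_def)
  \<comment> \<open>The scalar estimate is the result for iterates applied to ordinary
    multiplication of reals; it is then used at almost every point of the representatives.\<close>
  have real: "\<bar>\<bar>a\<bar> ^ q - \<bar>b\<bar> ^ q\<bar> \<le> e * real q * \<bar>W + u\<bar> ^ q"
    if "0 \<le> W" "0 \<le> u" "0 \<le> e" "\<bar>a\<bar> \<le> W" "\<bar>b\<bar> \<le> W" "\<bar>a - b\<bar> \<le> e * u" for a b W u e :: real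
  proof -
    have "bilinear ((*) :: real \<Rightarrow> real \<Rightarrow> real)"
      by (simp add: bilinear_conv_bounded_bilinear bounded_bilinear_mult)
    moreover have "\<bar>x\<bar> ^ q = ((*) \<bar>x\<bar> ^^ (q - 1)) \<bar>x\<bar>" for x :: real
    proof -
      have "((*) y ^^ k) y = y ^ Suc k" for y :: real and k by (induction k) auto
      moreover obtain k where "q = Suc k" using q by (cases q) auto
      ultimately show ?thesis by simp
    qed
    ultimately have "power_like q (\<lambda>x::real. \<bar>x\<bar> ^ q)" using q by (intro power_like_iterate) auto
    with that show ?thesis unfolding power_like_def by simp
  qed
  show ?thesis
    unfolding power_like_def
  proof (intro conjI allI impI)
    show "\<phi> 0 = 0" using pw(2)[OF cls_zero(1)] q by (simp add: cls_zero power_0_left)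
    show "0 \<le> \<phi> u" for u
    proof -
      obtain h where h: "h \<in> F" "u = cls h" by (rule cls_cases)
      show ?thesis using cls_le[OF cls_zero(1) pw(1)[OF h(1)]] by (simp add: h pw cls_zero)
    qed
    show "\<phi> (c *\<^sub>R u) = c ^ q *\<^sub>R \<phi> u" if "0 < c" for c u
    proof -
      obtain h where h: "h \<in> F" "u = cls h" by (rule cls_cases)
      have "\<phi> (c *\<^sub>R u) = cls (\<lambda>w. c ^ q * \<bar>h w\<bar> ^ q)"
        using pw(2)[of "\<lambda>w. c * h w"] cls_scaleR[OF h(1), of c] that h by (simp add: abs_mult power_mult_distrib)
      then show ?thesis using cls_scaleR[OF pw(1)[OF h(1)], of "c ^ q"] pw(2)[OF h(1)] h by simp
    qed
    fix W u x y :: 'x and e :: real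
    assume *: "0 \<le> W" "0 \<le> u" "0 \<le> e" "\<bar>x\<bar> \<le> W" "\<bar>y\<bar> \<le> W" "\<bar>x - y\<bar> \<le> e *\<^sub>R u"
    obtain w where w: "w \<in> F" "W = cls w" by (rule cls_cases)
    obtain v where v: "v \<in> F" "u = cls v" by (rule cls_cases)
    obtain h where h: "h \<in> F" "x = cls h" by (rule cls_cases)
    obtain k where k: "k \<in> F" "y = cls k" by (rule cls_cases)
    have hk: "(\<lambda>w. h w - k w) \<in> F" "x - y = cls (\<lambda>w. h w - k w)" using cls_diff h k by auto
    have ev: "(\<lambda>w. e * v w) \<in> F" "e *\<^sub>R u = cls (\<lambda>w. e * v w)" using cls_scaleR v by auto
    have wv: "(\<lambda>a. w a + v a) \<in> F" "W + u = cls (\<lambda>a. w a + v a)" using cls_add w v by auto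
    have "AE a in M. 0 \<le> w a" using *(1) cls_le[OF cls_zero(1) w(1)] w by (simp add: cls_zero)
    moreover have "AE a in M. 0 \<le> v a" using *(2) cls_le[OF cls_zero(1) v(1)] v by (simp add: cls_zero)
    moreover have "AE a in M. \<bar>h a\<bar> \<le> w a" using *(4) cls_le[OF cls_abs_in[OF h(1)] w(1)] h w by (simp add: cls_abs)
    moreover have "AE a in M. \<bar>k a\<bar> \<le> w a" using *(5) cls_le[OF cls_abs_in[OF k(1)] w(1)] k w by (simp add: cls_abs)
    moreover have "AE a in M. \<bar>h a - k a\<bar> \<le> e * v a"
      using *(6) cls_le[OF cls_abs_in[OF hk(1)] ev(1)] hk ev by (simp add: cls_abs)
    ultimately have le: "AE a in M. \<bar>\<bar>h a\<bar> ^ q - \<bar>k a\<bar> ^ q\<bar> \<le> e * real q * \<bar>w a + v a\<bar> ^ q"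
      by eventually_elim (rule real[OF _ _ *(3)])
    have d: "(\<lambda>a. \<bar>h a\<bar> ^ q - \<bar>k a\<bar> ^ q) \<in> F" "\<phi> x - \<phi> y = cls (\<lambda>a. \<bar>h a\<bar> ^ q - \<bar>k a\<bar> ^ q)"
      using cls_diff[OF pw(1)[OF h(1)] pw(1)[OF k(1)]] pw(2) h k by auto
    have r: "(\<lambda>a. e * real q * \<bar>w a + v a\<bar> ^ q) \<in> F"
      "(e * real q) *\<^sub>R \<phi> (W + u) = cls (\<lambda>a. e * real q * \<bar>w a + v a\<bar> ^ q)"
      using cls_scaleR[OF pw(1)[OF wv(1)], of "e * real q"] pw(2)[OF wv(1)] wv(2) by auto
    show "\<bar>\<phi> x - \<phi> y\<bar> \<le> (e * real q) *\<^sub>R \<phi> (W + u)"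
      using le cls_le[OF cls_abs_in[OF d(1)] r(1)] d r by (simp add: cls_abs)
  qed
qed

end

text \<open>A Lipschitz constant independent of \<open>n\<close> preserves a common modulus of
  continuity, and a fixed vector \<open>E\<close> lets the distance to the identity fit the scheme
  with one vector. The last condition starts at \<open>n = 1\<close> because the saturation map is
  zero at \<open>n = 0\<close>.\<close>

definition near_identity :: "(nat \<Rightarrow> 'x \<Rightarrow> 'x) \<Rightarrow> 'x::dedekind_complete_vector_lattice \<Rightarrow> bool" where
  "near_identity \<Upsilon> E \<longleftrightarrow> 0 \<le> E \<and> (\<forall>n. \<Upsilon> n 0 = 0) \<and> (\<forall>n x y. \<bar>\<Upsilon> n x - \<Upsilon> n y\<bar> \<le> 2 *\<^sub>R \<bar>x - y\<bar>) \<and>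
     (\<forall>n\<ge>1. \<forall>x. \<bar>\<Upsilon> n x - x\<bar> \<le> (1 / real n) *\<^sub>R E)"

lemma near_identity_linear:
  fixes \<Upsilon> :: "nat \<Rightarrow> 'a \<Rightarrow> 'a::dedekind_complete_vector_lattice"
  assumes "\<And>n u. \<Upsilon> n u = u"
  shows "near_identity \<Upsilon> 0"
  unfolding near_identity_def assms
proof (intro conjI allI impI)
  show "\<bar>x - y\<bar> \<le> 2 *\<^sub>R \<bar>x - y\<bar>" for x y :: 'a using scaleR_right_mono[of 1 2 "\<bar>x - y\<bar>"] by simp
qed auto

text \<open>The map equals \<open>x - r x\<close> with
  \<open>r x = x / (c * \<bar>x\<bar> + 1)\<close>. Since \<open>r\<close> is nonexpansive, the
  constant 2 results for every \<open>c\<close>, including \<open>c = 0\<close>.\<close>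

lemma saturation_lipschitz:
  fixes h k c :: real
  assumes c: "0 \<le> c"
  shows "\<bar>c * h * \<bar>h\<bar> / (c * \<bar>h\<bar> + 1) - c * k * \<bar>k\<bar> / (c * \<bar>k\<bar> + 1)\<bar> \<le> 2 * \<bar>h - k\<bar>"
proof -
  define r where "r = (\<lambda>x. x / (c * \<bar>x\<bar> + 1))"
  have pos: "1 \<le> c * \<bar>x\<bar> + 1" for x using c by simp
  have eq: "c * x * \<bar>x\<bar> / (c * \<bar>x\<bar> + 1) = x - r x" for x
    using pos[of x] by (simp add: r_def field_simps)
  have "\<bar>r h - r k\<bar> \<le> \<bar>h - k\<bar>"
  proof -
    let ?D = "(c * \<bar>h\<bar> + 1) * (c * \<bar>k\<bar> + 1)"
    have D: "0 < ?D" using pos[of h] pos[of k] by (intro mult_pos_pos) linarith+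
    have r_diff: "r h - r k = (h - k + c * (h * \<bar>k\<bar> - k * \<bar>h\<bar>)) / ?D"
      using pos[of h] pos[of k] by (simp add: r_def field_simps)
    have "\<bar>h - k + c * (h * \<bar>k\<bar> - k * \<bar>h\<bar>)\<bar> \<le> \<bar>h - k\<bar> * ?D"
    proof -
      have "\<bar>h * \<bar>k\<bar> - k * \<bar>h\<bar>\<bar> \<le> \<bar>h - k\<bar> * (\<bar>h\<bar> + \<bar>k\<bar>)"
      \<comment> \<open>For equal signs the cross term vanishes. For opposite signs
        \<open>\<bar>h - k\<bar>\<close> is \<open>\<bar>h\<bar> + \<bar>k\<bar>\<close>, and its
        square dominates twice the product.\<close>
      proof (cases "0 \<le> h \<longleftrightarrow> 0 \<le> k")
        case True
        then have "h * \<bar>k\<bar> - k * \<bar>h\<bar> = 0" by (auto simp: abs_if)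
        then show ?thesis by simp
      next
        case False
        then have hk: "\<bar>h - k\<bar> = \<bar>h\<bar> + \<bar>k\<bar>" by auto
        have "\<bar>h * \<bar>k\<bar> - k * \<bar>h\<bar>\<bar> \<le> \<bar>h * \<bar>k\<bar>\<bar> + \<bar>k * \<bar>h\<bar>\<bar>" by (rule abs_triangle_ineq4)
        also have "\<dots> = 2 * (\<bar>h\<bar> * \<bar>k\<bar>)" by (simp add: abs_mult)
        also have "\<dots> \<le> (\<bar>h\<bar> + \<bar>k\<bar>) * (\<bar>h\<bar> + \<bar>k\<bar>)" by (simp add: algebra_simps)
        finally show ?thesis unfolding hk .
      qed
      then have "c * \<bar>h * \<bar>k\<bar> - k * \<bar>h\<bar>\<bar> \<le> c * (\<bar>h - k\<bar> * (\<bar>h\<bar> + \<bar>k\<bar>))" using c by (rule mult_left_mono)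
      moreover have "\<bar>h - k + c * (h * \<bar>k\<bar> - k * \<bar>h\<bar>)\<bar> \<le> \<bar>h - k\<bar> + c * \<bar>h * \<bar>k\<bar> - k * \<bar>h\<bar>\<bar>"
        using abs_triangle_ineq[of "h - k" "c * (h * \<bar>k\<bar> - k * \<bar>h\<bar>)"] c by (simp add: abs_mult)
      moreover have "\<bar>h - k\<bar> + c * (\<bar>h - k\<bar> * (\<bar>h\<bar> + \<bar>k\<bar>)) \<le> \<bar>h - k\<bar> * ?D"
      proof -
        have "0 \<le> \<bar>h - k\<bar> * ((c * \<bar>h\<bar>) * (c * \<bar>k\<bar>))" using c by (intro mult_nonneg_nonneg) auto
        moreover have "\<bar>h - k\<bar> * ?D = \<bar>h - k\<bar> + c * (\<bar>h - k\<bar> * (\<bar>h\<bar> + \<bar>k\<bar>)) + \<bar>h - k\<bar> * ((c * \<bar>h\<bar>) * (c * \<bar>k\<bar>))"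
          by (simp only: algebra_simps mult_1_left mult_1_right)
        ultimately show ?thesis by linarith
      qed
      ultimately show ?thesis by linarith
    qed
    then show ?thesis
      unfolding r_diff abs_divide abs_of_pos[OF D] by (simp only: pos_divide_le_eq[OF D])
  qed
  then have "\<bar>h - k\<bar> + \<bar>r h - r k\<bar> \<le> 2 * \<bar>h - k\<bar>" by simp
  from order_trans[OF abs_triangle_ineq4 this]
  have "\<bar>(h - k) - (r h - r k)\<bar> \<le> 2 * \<bar>h - k\<bar>" .
  moreover have "(h - k) - (r h - r k) = h - r h - (k - r k)" by simp
  ultimately show ?thesis by (simp only: eq)
qed

text \<open>The difference is - h / (c |h| + 1), which stays bounded however large \<open>h\<close>
  is. The error is therefore a multiple of a constant function, independent of the argument.\<close>

lemma saturation_close: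
  fixes h c :: real
  assumes c: "0 < c"
  shows "\<bar>c * h * \<bar>h\<bar> / (c * \<bar>h\<bar> + 1) - h\<bar> \<le> 1 / c"
proof -
  have pos: "1 \<le> c * \<bar>h\<bar> + 1" using c by simp
  have "c * h * \<bar>h\<bar> / (c * \<bar>h\<bar> + 1) - h = - h / (c * \<bar>h\<bar> + 1)"
    using pos by (simp add: field_simps)
  also have "\<bar>\<dots>\<bar> = \<bar>h\<bar> / (c * \<bar>h\<bar> + 1)" using pos by (simp add: abs_divide)
  also have "\<dots> \<le> 1 / c"
  proof -
    have "\<bar>h\<bar> \<le> 1 / c * (c * \<bar>h\<bar> + 1)" using c by (simp add: field_simps)
    moreover have "0 < c * \<bar>h\<bar> + 1" using pos by simp
    ultimately show ?thesis by (simp only: pos_divide_le_eq)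
  qed
  finally show ?thesis .
qed

text \<open>Keeps the saturated functions among the representatives, where \<open>cls\<close>
  translates between functions and vectors. For \<open>r = 0\<close> measurability is the whole
  condition.\<close>

lemma Lr_functions_solid:
  assumes h: "h \<in> Lr_functions r" and k: "k \<in> borel_measurable (lebesgue_on {0..1})" and le: "\<And>x. \<bar>k x\<bar> \<le> \<bar>h x\<bar>"
  shows "k \<in> Lr_functions r"
  unfolding Lr_functions_def
proof (intro CollectI conjI impI)
  assume "r = top"
  then obtain B where "AE x in lebesgue_on {0..1}. \<bar>h x\<bar> \<le> B" using h by (auto simp: Lr_functions_def)
  then have "AE x in lebesgue_on {0..1}. \<bar>k x\<bar> \<le> B" by eventually_elim (use le order_trans in blast)
  then show "\<exists>B. AE x in lebesgue_on {0..1}. \<bar>k x\<bar> \<le> B" ..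
next
  assume "0 < r \<and> r < top"
  then have "integrable (lebesgue_on {0..1}) (\<lambda>x. \<bar>h x\<bar> powr enn2real r)" using h by (auto simp: Lr_functions_def)
  then show "integrable (lebesgue_on {0..1}) (\<lambda>x. \<bar>k x\<bar> powr enn2real r)"
  proof (rule Bochner_Integration.integrable_bound)
    show "(\<lambda>x. \<bar>k x\<bar> powr enn2real r) \<in> borel_measurable (lebesgue_on {0..1})" using k by measurable
    show "AE x in lebesgue_on {0..1}. norm (\<bar>k x\<bar> powr enn2real r) \<le> norm (\<bar>h x\<bar> powr enn2real r)"
      using le by (auto intro!: powr_mono2)
  qed
qed (rule k)

lemma near_identity_saturation:
  fixes clsr :: "(real \<Rightarrow> real) \<Rightarrow> 'x::dedekind_complete_vector_lattice"
  assumes Lr: "is_Lr r clsr"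
    and \<Upsilon>: "\<And>n h. h \<in> Lr_functions r \<Longrightarrow>
      \<Upsilon> n (clsr h) = clsr (\<lambda>x. real n * h x * \<bar>h x\<bar> / (real n * \<bar>h x\<bar> + 1))"
  shows "near_identity \<Upsilon> (clsr (\<lambda>x. 1))"
proof -
  have fs: "function_space (lebesgue_on {0..1}) (Lr_functions r) clsr" using Lr by (simp add: is_Lr_def)
  let ?\<sigma> = "\<lambda>n h x. real n * h x * \<bar>h x\<bar> / (real n * \<bar>h x\<bar> + 1)"
  have \<sigma>: "?\<sigma> n h \<in> Lr_functions r" if h: "h \<in> Lr_functions r" for n h
  proof -
    have [measurable]: "h \<in> borel_measurable (lebesgue_on {0..1})" using h by (simp add: Lr_functions_def)
    \<comment> \<open>The Lipschitz bound against 0 dominates the saturated function by twice the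
      original one.\<close>
    have "(\<lambda>x. 2 * h x) \<in> Lr_functions r" using cls_scaleR[OF fs h, of 2] by simp
    then show ?thesis
    proof (rule Lr_functions_solid)
      show "?\<sigma> n h \<in> borel_measurable (lebesgue_on {0..1})" by measurable
      show "\<bar>?\<sigma> n h x\<bar> \<le> \<bar>2 * h x\<bar>" for x
        using saturation_lipschitz[of "real n" "h x" 0] by (simp add: abs_mult)
    qed
  qed
  \<comment> \<open>The interval has finite measure, so constants belong to every space of the
    scale; the class of 1 is the vector \<open>E\<close>.\<close>
  have 1: "(\<lambda>x. 1) \<in> Lr_functions r"
    by (auto simp: Lr_functions_def intro!: exI[of _ 1])
  show ?thesis
    unfolding near_identity_def
  proof (intro conjI allI impI)
    show "0 \<le> clsr (\<lambda>x. 1)" using cls_le[OF fs cls_zero(1)[OF fs] 1] by (simp add: cls_zero[OF fs])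
    show "\<Upsilon> n 0 = 0" for n using \<Upsilon>[OF cls_zero(1)[OF fs], of n] by (simp add: cls_zero[OF fs])
    show "\<bar>\<Upsilon> n x - \<Upsilon> n y\<bar> \<le> 2 *\<^sub>R \<bar>x - y\<bar>" for n x y
    proof -
      obtain h where h: "h \<in> Lr_functions r" "x = clsr h" by (rule cls_cases[OF fs])
      obtain k where k: "k \<in> Lr_functions r" "y = clsr k" by (rule cls_cases[OF fs])
      note d = cls_diff[OF fs \<sigma>[OF h(1)] \<sigma>[OF k(1)], of n n]
      note d' = cls_diff[OF fs h(1) k(1)]
      note s = cls_scaleR[OF fs cls_abs_in[OF fs d'[THEN conjunct1]], of 2]
      have "clsr (\<lambda>a. \<bar>?\<sigma> n h a - ?\<sigma> n k a\<bar>) \<le> clsr (\<lambda>a. 2 * \<bar>h a - k a\<bar>)"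
        unfolding cls_le[OF fs cls_abs_in[OF fs d[THEN conjunct1]] s[THEN conjunct1]]
        by (intro AE_I2 saturation_lipschitz) simp
      then show ?thesis
        using cls_abs[OF fs d[THEN conjunct1]] cls_abs[OF fs d'[THEN conjunct1]] d d' s \<Upsilon>[OF h(1)] \<Upsilon>[OF k(1)] h k by simp
    qed
    fix n :: nat and x assume n: "1 \<le> n"
    obtain h where h: "h \<in> Lr_functions r" "x = clsr h" by (rule cls_cases[OF fs])
    note d = cls_diff[OF fs \<sigma>[OF h(1)] h(1), of n]
    note s = cls_scaleR[OF fs 1, of "1 / real n"]
    have "clsr (\<lambda>a. \<bar>?\<sigma> n h a - h a\<bar>) \<le> clsr (\<lambda>a. 1 / real n * 1)"
      unfolding cls_le[OF fs cls_abs_in[OF fs d[THEN conjunct1]] s[THEN conjunct1]]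
      using n saturation_close[of "real n"] by (intro AE_I2) simp
    then show "\<bar>\<Upsilon> n x - x\<bar> \<le> (1 / real n) *\<^sub>R clsr (\<lambda>x. 1)"
      using cls_abs[OF fs d[THEN conjunct1]] d s \<Upsilon>[OF h(1)] h by simp
  qed
qed

section \<open>Convergence of the operators\<close>

context
  fixes q :: nat and \<phi> :: "'x::dedekind_complete_vector_lattice \<Rightarrow> 'x"
  assumes \<phi>: "power_like q \<phi>"
begin

lemma power_like_lipschitz:
  "0 \<le> W \<Longrightarrow> 0 \<le> u \<Longrightarrow> 0 \<le> e \<Longrightarrow> \<bar>x\<bar> \<le> W \<Longrightarrow> \<bar>y\<bar> \<le> W \<Longrightarrow> \<bar>x - y\<bar> \<le> e *\<^sub>R u \<Longrightarrow>
    \<bar>\<phi> x - \<phi> y\<bar> \<le> e *\<^sub>R real q *\<^sub>R \<phi> (W + u)"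
  using \<phi> unfolding power_like_def by simp

lemma power_like_nonneg: "0 \<le> \<phi> u" and power_like_zero: "\<phi> 0 = 0"
  and power_like_scaleR: "0 < c \<Longrightarrow> \<phi> (c *\<^sub>R u) = c ^ q *\<^sub>R \<phi> u"
  using \<phi> unfolding power_like_def by blast+

text \<open>The error function is kept below 1, so \<open>b + w\<close> bounds the approximant as
  well as \<open>F\<close>, and the local Lipschitz estimate applies. The second \<open>w\<close> in
  the new vector is the direction in which the two differ.\<close>

lemma ru_integral_power:
  assumes F: "ru_integral w F v" and w: "0 \<le> w" and b: "0 \<le> b" "\<And>t. 0 < t \<Longrightarrow> \<bar>F t\<bar> \<le> b"
  shows "\<exists>v'. ru_integral (real q *\<^sub>R \<phi> (b + w + w)) (\<lambda>t. \<phi> \<bar>F t\<bar>) v'"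
proof (rule ru_integral_exists)
  show P: "0 \<le> real q *\<^sub>R \<phi> (b + w + w)" by (simp add: scaleR_nonneg_nonneg power_like_nonneg)
  fix e :: real assume e: "0 < e"
  obtain g where g: "simple_fun g" "ru_close w (min e 1) g F"
    using ru_integralD[OF F, of "min e 1"] e by auto
  then obtain k where k: "integrable MM k" "(LINT t|MM. k t) \<le> min e 1"
      "\<And>t. 0 < t \<Longrightarrow> 0 \<le> k t \<and> k t \<le> min e 1 \<and> \<bar>g t - F t\<bar> \<le> k t *\<^sub>R w"
    unfolding ru_close_def by blast
  have "ru_close (real q *\<^sub>R \<phi> (b + w + w)) e (\<lambda>t. \<phi> \<bar>g t\<bar>) (\<lambda>t. \<phi> \<bar>F t\<bar>)"
    unfolding ru_close_def
  proof (intro exI[of _ k] conjI allI impI)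
    fix t :: real assume t: "0 < t"
    have kt: "0 \<le> k t" "k t \<le> e" "k t \<le> 1" "\<bar>g t - F t\<bar> \<le> k t *\<^sub>R w" using k(3)[OF t] by auto
    then show "0 \<le> k t" "k t \<le> e" by auto
    show "\<bar>\<phi> \<bar>g t\<bar> - \<phi> \<bar>F t\<bar>\<bar> \<le> k t *\<^sub>R real q *\<^sub>R \<phi> (b + w + w)"
    proof (rule power_like_lipschitz[OF _ w kt(1)])
      show "0 \<le> b + w" using b w by simp
      have "\<bar>g t - F t\<bar> \<le> w" using kt scaleR_right_mono[OF kt(3) w] by auto
      then have "\<bar>F t\<bar> + \<bar>g t - F t\<bar> \<le> b + w" using b(2)[OF t] by (intro add_mono)
      then show "\<bar>\<bar>g t\<bar>\<bar> \<le> b + w" using abs_triangle_ineq[of "F t" "g t - F t"] by simp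
      show "\<bar>\<bar>F t\<bar>\<bar> \<le> b + w" using b(2)[OF t] w by (simp add: add_increasing2)
      show "\<bar>\<bar>g t\<bar> - \<bar>F t\<bar>\<bar> \<le> k t *\<^sub>R w" by (rule order_trans[OF abs_triangle_ineq3 kt(4)])
    qed
  qed (use k in auto)
  moreover have "simple_fun (\<lambda>t. \<phi> \<bar>g t\<bar>)"
    by (rule simple_fun_compose[where p="\<lambda>x. \<phi> \<bar>x\<bar>"]) (simp_all add: power_like_zero g)
  ultimately show "\<exists>f. simple_fun f \<and> ru_close (real q *\<^sub>R \<phi> (b + w + w)) e f (\<lambda>t. \<phi> \<bar>F t\<bar>)" by blast
qed

text \<open>Comparison with the value 0 of \<phi> at 0: the Lipschitz estimate converts a majorant
  of \<open>F\<close> into a majorant of the integrand that is linear in \<open>k\<close>, whatever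
  q is.\<close>

lemma power_integral_bound:
  assumes F: "ru_integral (real q *\<^sub>R \<phi> (b + w + w)) (\<lambda>t. \<phi> \<bar>F t\<bar>) v'"
    and w: "0 \<le> w" and b: "0 \<le> b" "\<And>t. 0 < t \<Longrightarrow> \<bar>F t\<bar> \<le> b"
    and k: "integrable MM k" "\<And>t. 0 < t \<Longrightarrow> 0 \<le> k t \<and> \<bar>F t\<bar> \<le> k t *\<^sub>R w"
  shows "\<bar>v'\<bar> \<le> (LINT t|MM. k t) *\<^sub>R real q *\<^sub>R \<phi> (b + w + w)"
proof (rule ru_integral_bound[OF F _ k(1)])
  show "0 \<le> real q *\<^sub>R \<phi> (b + w + w)" by (simp add: scaleR_nonneg_nonneg power_like_nonneg)
  fix t :: real assume t: "0 < t"
  have "\<bar>\<phi> \<bar>F t\<bar> - \<phi> 0\<bar> \<le> k t *\<^sub>R real q *\<^sub>R \<phi> (b + w + w)"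
    using k(2)[OF t] b(2)[OF t] b w by (intro power_like_lipschitz) (auto simp: add_increasing2)
  then show "0 \<le> k t \<and> \<bar>\<phi> \<bar>F t\<bar>\<bar> \<le> k t *\<^sub>R real q *\<^sub>R \<phi> (b + w + w)"
    using k(2)[OF t] by (simp add: power_like_zero)
qed

text \<open>The modular of \<open>a *\<^sub>R F t\<close> is \<open>a ^ q\<close> times that of
  \<open>F\<close>. As \<open>q \<ge> 1\<close>, this factor is at most \<open>a\<close> when
  \<open>a \<le> 1\<close>, and the Archimedean property makes the infimum 0.\<close>

lemma in_orlicz_space:
  assumes setting: "convergence_setting C lb R" and q: "1 \<le> q"
    and F: "ru_integral w F v" and w: "0 \<le> w" and b: "0 \<le> b" "\<And>t. 0 < t \<Longrightarrow> \<bar>F t\<bar> \<le> b"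
  shows "F \<in> orlicz_space C lb R \<phi>"
proof -
  let ?P = "real q *\<^sub>R \<phi> (b + w + w)"
  have P: "0 \<le> ?P" by (simp add: scaleR_nonneg_nonneg power_like_nonneg)
  obtain v' where v': "ru_integral ?P (\<lambda>t. \<phi> \<bar>F t\<bar>) v'"
    using ru_integral_power[OF F w b] by blast
  have v0: "0 \<le> v'" by (rule ru_integral_nonneg[OF setting v' P]) (rule power_like_nonneg)
  have "ru_integral ?P (\<lambda>t. \<phi> \<bar>a *\<^sub>R F t\<bar>) (a ^ q *\<^sub>R v')" if a: "0 < a" for a
    using ru_integral_scaleR[OF v' P, of "a ^ q"] a by (simp add: abs_scaleR_vl power_like_scaleR)
  from vl_integral_ru[OF setting this P]
  have m: "modular_defined C lb R \<phi> (\<lambda>t. a *\<^sub>R F t)" "modular C lb R \<phi> (\<lambda>t. a *\<^sub>R F t) = a ^ q *\<^sub>R v'"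
    if "0 < a" for a using that unfolding modular_defined_def modular_def by auto
  define V where "V = {modular C lb R \<phi> (\<lambda>g. a *\<^sub>R F g) | a. 0 < a \<and> modular_defined C lb R \<phi> (\<lambda>g. a *\<^sub>R F g)}"
  have V: "V = {a ^ q *\<^sub>R v' | a. 0 < a}" using m unfolding V_def by (intro Collect_cong) force
  have ne: "V \<noteq> {}" unfolding V by (auto intro: exI[of _ 1])
  have ge: "0 \<le> x" if "x \<in> V" for x using that v0 unfolding V by (auto intro!: scaleR_nonneg_nonneg)
  then have bdd: "bdd_below V" by (auto simp: bdd_below_def)
  have "Inf V = 0"
  proof (rule antisym)
    show "0 \<le> Inf V" using ne ge by (rule cInf_greatest)
    show "Inf V \<le> 0"
    proof (rule archimedean_le_0[OF v0])
      fix e :: real assume e: "0 < e"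
      have "Inf V \<le> (min e 1) ^ q *\<^sub>R v'" using e by (intro cInf_lower bdd) (auto simp: V)
      also have "(min e 1) ^ q \<le> (min e 1) ^ 1" using e q by (intro power_decreasing) auto
      then have "(min e 1) ^ q *\<^sub>R v' \<le> e *\<^sub>R v'" using v0 by (intro scaleR_right_mono) auto
      finally show "Inf V \<le> e *\<^sub>R v'" .
    qed
  qed
  with ne bdd show ?thesis unfolding orlicz_space_def V_def Let_def by simp
qed

end

text \<open>An order bound on the values is not part of the definition of \<open>Cc\<close>. It is
  obtained from the values at finitely many grid points plus the oscillation \<open>u\<close>
  between them; adding \<open>u\<close> once more gives one vector for values and modulus.\<close>

lemma Cc_steppable:
  assumes f: "f \<in> Cc"
  obtains a b w where "steppable a b w f"
proof -
  obtain K u where K: "compact K" "K \<subseteq> {0<..}" "\<And>t. 0 < t \<Longrightarrow> t \<notin> K \<Longrightarrow> f t = 0"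
    and u: "0 \<le> u" and unif: "\<forall>\<epsilon>>0. \<exists>\<delta>>0. modulus f (\<epsilon> *\<^sub>R u) \<delta>"
    using f unfolding Cc_def modulus_def by auto
  obtain a b where ab: "0 < a" "a \<le> b" "K \<subseteq> {a..b}"
  proof (cases "K = {}")
    case True
    then show thesis by (intro that[of 1 1]) auto
  next
    case False
    obtain a where "a \<in> K" "\<forall>t\<in>K. a \<le> t" using compact_attains_inf[OF K(1) False] by blast
    moreover obtain b where "b \<in> K" "\<forall>t\<in>K. t \<le> b" using compact_attains_sup[OF K(1) False] by blast
    ultimately show thesis using K(2) by (intro that[of a b]) auto
  qed
  obtain \<delta> where \<delta>: "0 < \<delta>" "modulus f u \<delta>"
    using unif[rule_format, of 1] by auto
  obtain j :: "real \<Rightarrow> nat" where j: "\<And>t. t \<in> {a..b} \<Longrightarrow> j t \<le> j b \<and> d_ln (a * exp (real (j t) * \<delta>)) t \<le> \<delta>"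
    using log_grid[OF ab(1) \<delta>(1)] by blast
  define W where "W = (\<Sum>i\<le>j b. \<bar>f (a * exp (real i * \<delta>))\<bar>) + u"
  have W: "0 \<le> W" using u by (simp add: W_def sum_nonneg)
  have fW: "\<bar>f t\<bar> \<le> W" if t: "0 < t" for t
  proof (cases "t \<in> {a..b}")
    case True
    let ?p = "a * exp (real (j t) * \<delta>)"
    have "\<bar>f t\<bar> \<le> \<bar>f ?p\<bar> + \<bar>f ?p - f t\<bar>"
      using abs_triangle_ineq4[of "f ?p" "f ?p - f t"] by simp
    also have "\<bar>f ?p - f t\<bar> \<le> u" using j[OF True] ab t by (intro modulusD[OF \<delta>(2)]) auto
    also have "\<bar>f ?p\<bar> \<le> (\<Sum>i\<le>j b. \<bar>f (a * exp (real i * \<delta>))\<bar>)"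
      using j[OF True] by (subst sum.remove[of _ "j t"]) (auto intro: sum_nonneg)
    finally show ?thesis by (simp add: W_def)
  next
    case False
    then have "f t = 0" using K(3)[OF t] ab(3) by blast
    then show ?thesis using W by simp
  qed
  have "steppable a b (u + W) f"
    unfolding steppable_def
  proof (intro conjI allI impI ab(1,2))
    show "0 \<le> u + W" using u W by simp
    show "f t = 0" if "0 < t" "t \<notin> {a..b}" for t using K(3)[OF that(1)] that(2) ab(3) by blast
    show "\<bar>f t\<bar> \<le> u + W" if "0 < t" for t using fW[OF that] u by (simp add: add_increasing)
    fix e :: real assume e: "0 < e"
    have "e *\<^sub>R u \<le> e *\<^sub>R (u + W)" using W e by (intro scaleR_left_mono) auto
    then show "\<exists>\<delta>>0. modulus f (e *\<^sub>R (u + W)) \<delta>" using unif e modulus_mono by blast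
  qed
  then show thesis by (rule that)
qed

lemma steppable_mono:
  assumes f: "steppable a b w f" and le: "w \<le> w'"
  shows "steppable a b w' f"
proof -
  have "\<exists>\<delta>>0. modulus f (e *\<^sub>R w') \<delta>" if e: "0 < e" for e
  proof -
    have "e *\<^sub>R w \<le> e *\<^sub>R w'" using le e by (intro scaleR_left_mono) auto
    moreover obtain \<delta> where "0 < \<delta>" "modulus f (e *\<^sub>R w) \<delta>" using f e unfolding steppable_def by blast
    ultimately show ?thesis using modulus_mono by blast
  qed
  moreover have "0 \<le> w'" "\<forall>t>0. \<bar>f t\<bar> \<le> w'" using f le by (auto simp: steppable_def intro: order_trans)
  ultimately show ?thesis using f by (simp add: steppable_def)
qed

text \<open>The same \<delta> works for every \<open>n\<close>, so the nonlinear factors do not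
  spoil uniformity in \<open>n\<close>.\<close>

lemma near_identity_modulus:
  assumes \<Upsilon>: "near_identity \<Upsilon> E" and f: "modulus f (e *\<^sub>R w) \<delta>"
  shows "modulus (\<lambda>t. \<Upsilon> n (f t)) (e *\<^sub>R 2 *\<^sub>R w) \<delta>"
  unfolding modulus_def
proof (intro allI impI)
  fix s t :: real assume "0 < s" "0 < t" "d_ln s t \<le> \<delta>"
  then have "2 *\<^sub>R \<bar>f s - f t\<bar> \<le> 2 *\<^sub>R e *\<^sub>R w" by (intro scaleR_left_mono modulusD[OF f]) auto
  moreover have "\<bar>\<Upsilon> n (f s) - \<Upsilon> n (f t)\<bar> \<le> 2 *\<^sub>R \<bar>f s - f t\<bar>" using \<Upsilon> by (simp add: near_identity_def)
  ultimately show "\<bar>\<Upsilon> n (f s) - \<Upsilon> n (f t)\<bar> \<le> e *\<^sub>R 2 *\<^sub>R w" by (simp add: mult.commute)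
qed

lemma near_identity_steppable:
  assumes f: "steppable a b w f" and \<Upsilon>: "near_identity \<Upsilon> E"
  shows "steppable a b (2 *\<^sub>R w) (\<lambda>t. \<Upsilon> n (f t))"
  unfolding steppable_def
proof (intro conjI allI impI)
  show "0 < a" "a \<le> b" using f by (auto simp: steppable_def)
  show "0 \<le> 2 *\<^sub>R w" using f by (auto simp: steppable_def scaleR_nonneg_nonneg)
  have 0: "\<Upsilon> n 0 = 0" using \<Upsilon> by (simp add: near_identity_def)
  show "\<Upsilon> n (f t) = 0" if "0 < t" "t \<notin> {a..b}" for t using f that 0 by (simp add: steppable_def)
  show "\<bar>\<Upsilon> n (f t)\<bar> \<le> 2 *\<^sub>R w" if "0 < t" for t
  proof -
    have "\<bar>\<Upsilon> n (f t) - \<Upsilon> n 0\<bar> \<le> 2 *\<^sub>R \<bar>f t - 0\<bar>" using \<Upsilon> unfolding near_identity_def by blast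
    also have "\<dots> \<le> 2 *\<^sub>R w" using f that by (intro scaleR_left_mono) (auto simp: steppable_def)
    finally show ?thesis by (simp add: 0)
  qed
  fix e :: real assume "0 < e"
  then obtain \<delta> where "0 < \<delta>" "modulus f (e *\<^sub>R w) \<delta>" using f unfolding steppable_def by blast
  then show "\<exists>\<delta>>0. modulus (\<lambda>t. \<Upsilon> n (f t)) (e *\<^sub>R 2 *\<^sub>R w) \<delta>"
    using near_identity_modulus[OF \<Upsilon>] by (intro exI conjI)
qed

section \<open>Estimates for the operators\<close>

context
  fixes C :: "'x::dedekind_complete_vector_lattice convergence"
    and lb :: "(nat \<Rightarrow> 'x) \<Rightarrow> 'x extended"
    and R :: "real convergence"
    and L :: "nat \<Rightarrow> real \<Rightarrow> real" and \<psi> :: "real \<Rightarrow> real"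
    and \<Upsilon> :: "nat \<Rightarrow> 'x \<Rightarrow> 'x" and E :: 'x
    and f :: "real \<Rightarrow> 'x" and a b w
  assumes setting: "convergence_setting C lb R"
    and \<psi>: "kernel \<psi>" and \<psi>_one: "(LINT x|lborel. \<psi> x) = 1"
    and L: "\<And>n t. 0 < t \<Longrightarrow> L n t = rescaled \<psi> n (ln t)"
    and \<Upsilon>: "near_identity \<Upsilon> E" and f: "steppable a b w f" and Ew: "E \<le> w"
begin

private abbreviation "T \<equiv> mellin_operator C lb R (product_kernel L \<Upsilon>) f"
private abbreviation "u \<equiv> 2 *\<^sub>R w"
private abbreviation "tail \<delta> n \<equiv> LINT x|lborel. outer \<delta> (rescaled \<psi> n) x"

lemma w_nonneg: "0 \<le> w" "0 \<le> u" "w \<le> u" and ab: "0 < a" "a \<le> b"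
  using f by (auto simp: steppable_def scaleR_nonneg_nonneg scaleR_2)

text \<open>The nonlinearity is absorbed by convolving \<open>\<Upsilon> n (f t)\<close> instead of
  \<open>f t\<close>; what remains is linear in the convolved function. The vector doubles because
  of the Lipschitz constant 2.\<close>

lemma operator_integral:
  "0 < s \<Longrightarrow> ru_integral u (\<lambda>t. rescaled \<psi> n (ln (t / s)) *\<^sub>R \<Upsilon> n (f t)) (T n s)"
  and operator_integrable: "0 < s \<Longrightarrow> vl_integrable C lb R (\<lambda>t. product_kernel L \<Upsilon> n (t / s) (f t))"
  and operator_ru: "\<exists>v. ru_integral u (T n) v"
  and operator_le: "0 < s \<Longrightarrow> \<bar>T n s\<bar> \<le> mass_on (rescaled \<psi> n) {a..b} s *\<^sub>R u"
proof -
  obtain V v where V: "\<And>s. 0 < s \<Longrightarrow> ru_integral u (\<lambda>t. rescaled \<psi> n (ln (t / s)) *\<^sub>R \<Upsilon> n (f t)) (V s)"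
    and v: "ru_integral u V v" and le: "\<And>s. 0 < s \<Longrightarrow> \<bar>V s\<bar> \<le> mass_on (rescaled \<psi> n) {a..b} s *\<^sub>R u"
    using mellin_convolution[OF near_identity_steppable[OF f \<Upsilon>] kernel_rescaled[OF \<psi>]] by blast
  have K: "ru_integral u (\<lambda>t. product_kernel L \<Upsilon> n (t / s) (f t)) (V s)" if "0 < s" for s
    using V[OF that] that by (subst ru_integral_cong) (auto simp: product_kernel_def L)
  have T: "T n s = V s" if "0 < s" for s
    unfolding mellin_operator_def by (rule vl_integral_ru(2)[OF setting K[OF that] w_nonneg(2)])
  show "0 < s \<Longrightarrow> ru_integral u (\<lambda>t. rescaled \<psi> n (ln (t / s)) *\<^sub>R \<Upsilon> n (f t)) (T n s)" using V T by simp
  show "0 < s \<Longrightarrow> vl_integrable C lb R (\<lambda>t. product_kernel L \<Upsilon> n (t / s) (f t))"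
    by (rule vl_integral_ru(1)[OF setting K w_nonneg(2)])
  show "\<exists>v. ru_integral u (T n) v" using v ru_integral_cong[of "T n" V] T by blast
  show "0 < s \<Longrightarrow> \<bar>T n s\<bar> \<le> mass_on (rescaled \<psi> n) {a..b} s *\<^sub>R u" using le T by simp
qed

lemma operator_bounded:
  assumes s: "0 < s"
  shows "\<bar>T n s\<bar> \<le> u"
proof -
  \<comment> \<open>The mass is 1 from \<open>n = 1\<close> on but 0 for \<open>n = 0\<close>, so an
    inequality is what holds for all indices.\<close>
  have "(LINT x|lborel. rescaled \<psi> n x) \<le> 1"
    using integral_rescaled[of n "\<lambda>_. 1" \<psi>] \<psi>_one by (cases "n = 0") (auto simp: rescaled_def)
  moreover have "mass_on (rescaled \<psi> n) {a..b} s \<le> (LINT x|lborel. rescaled \<psi> n x)"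
    using ab by (intro mass_on_bounds(2)[OF kernel_rescaled[OF \<psi>] s]) auto
  ultimately have "mass_on (rescaled \<psi> n) {a..b} s *\<^sub>R u \<le> 1 *\<^sub>R u"
    using w_nonneg by (intro scaleR_right_mono) auto
  then show ?thesis using operator_le[OF s, of n] by simp
qed

lemma f_bounded: "0 < s \<Longrightarrow> \<bar>f s\<bar> \<le> u"
  using f w_nonneg by (auto simp: steppable_def intro: order_trans)

lemma operator_diff_bounded:
  assumes "0 < s"
  shows "\<bar>T n s - f s\<bar> \<le> 2 *\<^sub>R u"
  using order_trans[OF abs_triangle_ineq4 add_mono[OF operator_bounded[OF assms] f_bounded[OF assms]]]
  by (simp add: scaleR_2)

lemma operator_uniform:
  assumes e: "0 < e"
  shows "\<forall>\<^sub>F n in sequentially. \<forall>s>0. \<bar>T n s - f s\<bar> \<le> e *\<^sub>R u"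
proof -
  \<comment> \<open>One quarter pays for the modulus of continuity, two for the tail, which enters
    twice, and one for the distance of the nonlinear factor from the identity.\<close>
  have e4: "0 < e / 4" using e by simp
  obtain \<delta> where \<delta>: "0 < \<delta>" "modulus f ((e / 4) *\<^sub>R w) \<delta>"
    using f e4 unfolding steppable_def by blast
  have "\<forall>\<^sub>F n in sequentially. tail \<delta> n < e / 4"
    using order_tendstoD(2)[OF rescaled_tail[OF \<psi> \<delta>(1)] e4] .
  moreover have "\<forall>\<^sub>F n in sequentially. 1 / real n < e / 4"
    using order_tendstoD(2)[OF lim_1_over_n e4] .
  moreover have "\<forall>\<^sub>F n in sequentially. 1 \<le> n" by (rule eventually_ge_at_top)
  ultimately show ?thesis
  proof eventually_elim
    fix n :: nat assume n: "tail \<delta> n < e / 4" "1 / real n < e / 4" "1 \<le> n"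
    show "\<forall>s>0. \<bar>T n s - f s\<bar> \<le> e *\<^sub>R u"
    proof (intro allI impI)
      fix s :: real assume s: "0 < s"
      have one: "(LINT x|lborel. rescaled \<psi> n x) = 1"
        using integral_rescaled[OF n(3), of "\<lambda>_. 1" \<psi>] \<psi>_one by simp
      have "\<bar>T n s - \<Upsilon> n (f s)\<bar> \<le> (e / 4 + 2 * tail \<delta> n) *\<^sub>R u"
        by (rule mellin_convolution_diff[OF near_identity_steppable[OF f \<Upsilon>] kernel_rescaled[OF \<psi>] s
              operator_integral[OF s] one e4 near_identity_modulus[OF \<Upsilon> \<delta>(2)]])
      moreover have "\<bar>\<Upsilon> n (f s) - f s\<bar> \<le> (1 / real n) *\<^sub>R u"
      proof -
        have "\<bar>\<Upsilon> n (f s) - f s\<bar> \<le> (1 / real n) *\<^sub>R E" using \<Upsilon> n(3) by (simp add: near_identity_def)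
        also have "\<dots> \<le> (1 / real n) *\<^sub>R u"
          using Ew w_nonneg(3) by (intro scaleR_left_mono) (auto intro: order_trans)
        finally show ?thesis .
      qed
      ultimately have "\<bar>T n s - f s\<bar> \<le> (e / 4 + 2 * tail \<delta> n) *\<^sub>R u + (1 / real n) *\<^sub>R u"
        using order_trans[OF abs_diff_triangle add_mono] by blast
      also have "\<dots> = (e / 4 + 2 * tail \<delta> n + 1 / real n) *\<^sub>R u" by (simp only: scaleR_add_left)
      also have "\<dots> \<le> e *\<^sub>R u" using n w_nonneg by (intro scaleR_right_mono) auto
      finally show "\<bar>T n s - f s\<bar> \<le> e *\<^sub>R u" .
    qed
  qed
qed

lemma operator_sup_null: "sup_null C (\<lambda>n. (\<lambda>s. \<bar>T n s - f s\<bar>) ` {0<..})"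
  unfolding sup_null_def
proof
  let ?V = "\<lambda>n. (\<lambda>s. \<bar>T n s - f s\<bar>) ` {0<..}"
  have "v \<le> 2 *\<^sub>R u" if "v \<in> ?V n" for v n using that operator_diff_bounded by auto
  then show B: "\<forall>n. bdd_above (?V n)" unfolding bdd_above_def by blast
  show "null_seq C (\<lambda>n. Sup (insert 0 (?V n)))"
  proof (rule null_seq_uniform[OF setting w_nonneg(2)])
    show "0 \<le> Sup (insert 0 (?V n))" for n using B by (intro cSup_upper) auto
    fix e :: real assume e: "0 < e"
    show "\<forall>\<^sub>F n in sequentially. Sup (insert 0 (?V n)) \<le> e *\<^sub>R u"
      using operator_uniform[OF e]
    proof eventually_elim
      case (elim n)
      have "0 \<le> e *\<^sub>R u" using e by (intro scaleR_nonneg_nonneg[OF _ w_nonneg(2)]) simp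
      with elim show ?case by (intro cSup_least) auto
    qed
  qed
qed

text \<open>Outside the interval widened by the factor e on both sides, every point of the support
  lies at logarithmic distance at least 1. Hence only the outer part of the kernel acts there, while
  \<open>f\<close> vanishes.\<close>

lemma operator_tail:
  assumes s: "0 < s" "s \<notin> {a * exp (-1)..b * exp 1}"
  shows "\<bar>T n s - f s\<bar> \<le> mass_on (outer 1 (rescaled \<psi> n)) {a..b} s *\<^sub>R u"
proof -
  have "s \<notin> {a..b}"
  proof
    assume "s \<in> {a..b}"
    moreover have "a * exp (-1) \<le> a * 1" "b * 1 \<le> b * exp 1" using ab by (intro mult_left_mono; simp)+
    ultimately show False using s(2) by simp
  qed
  then have "f s = 0" using f s(1) by (simp add: steppable_def)
  moreover have "mass_on (rescaled \<psi> n) {a..b} s = mass_on (outer 1 (rescaled \<psi> n)) {a..b} s"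
    unfolding mass_on_def
  proof (intro Bochner_Integration.integral_cong refl)
    fix t :: real assume t: "t \<in> space MM"
    show "indicat_real {a..b} t * rescaled \<psi> n (ln (t / s)) =
      indicat_real {a..b} t * outer 1 (rescaled \<psi> n) (ln (t / s))"
    proof (cases "t \<in> {a..b}")
      case True
      have bounds: "ln (a * exp (-1)) = ln a - 1" "ln (b * exp 1) = ln b + 1"
        using ab by (simp_all add: ln_mult)
      have "1 \<le> \<bar>ln (t / s)\<bar>"
      proof (cases "s < a * exp (-1)")
        case lt: True
        have "ln s \<le> ln (a * exp (-1))" using lt s ab by (intro ln_mono) auto
        moreover have "ln a \<le> ln t" using True ab by (intro ln_mono) auto
        moreover have "ln (t / s) = ln t - ln s" using s t by (simp add: ln_div)
        ultimately show ?thesis unfolding bounds by linarith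
      next
        case False
        then have "b * exp 1 < s" using s by auto
        then have "ln (b * exp 1) \<le> ln s" using ab by (intro ln_mono) auto
        moreover have "ln t \<le> ln b" using True ab by (intro ln_mono) auto
        moreover have "ln (t / s) = ln t - ln s" using s t by (simp add: ln_div)
        ultimately show ?thesis unfolding bounds by linarith
      qed
      then show ?thesis by (simp add: outer_def)
    qed simp
  qed
  ultimately show ?thesis using operator_le[OF s(1), of n] by simp
qed

text \<open>Uniform convergence does not suffice, because the half-line has infinite measure and the
  operators need not have compact support. The majorant of the difference is a small constant on the
  widened support plus the outer mass, whose total integral is known from
  \<open>mass_on_integrable\<close>.\<close>

lemma operator_modular:
  assumes \<phi>: "power_like q \<phi>" and q: "1 \<le> q"
  shows "modularly_convergent_with C lb R \<phi> 1 T f"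
proof -
  let ?F = "\<lambda>n s. T n s - f s"
  let ?b = "2 *\<^sub>R u"
  let ?P = "real q *\<^sub>R \<phi> (?b + u + u)"
  have P: "0 \<le> ?P" by (simp add: scaleR_nonneg_nonneg power_like_nonneg[OF \<phi>])
  have b: "0 \<le> ?b" by (rule scaleR_nonneg_nonneg[OF _ w_nonneg(2)]) simp
  obtain vf where vf: "ru_integral u f vf"
    using steppable_ru_integral[OF f] ru_integral_mono w_nonneg(3) by blast
  obtain vT where vT: "\<And>n. ru_integral u (T n) (vT n)" using operator_ru by metis
  have vF: "ru_integral u (?F n) (vT n - vf)" for n by (rule ru_integral_diff[OF vT vf w_nonneg(2)])
  have "\<exists>v. ru_integral ?P (\<lambda>t. \<phi> \<bar>?F n t\<bar>) v" for n
    by (rule ru_integral_power[OF \<phi> vF w_nonneg(2) b operator_diff_bounded])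
  then obtain v where v: "\<And>n. ru_integral ?P (\<lambda>t. \<phi> \<bar>?F n t\<bar>) (v n)" by metis
  have defined: "modular_defined C lb R \<phi> (\<lambda>g. 1 *\<^sub>R ?F n g)" for n
    using vl_integral_ru(1)[OF setting v P] by (simp add: modular_defined_def)
  have modular: "modular C lb R \<phi> (\<lambda>g. 1 *\<^sub>R ?F n g) = v n" for n
    using vl_integral_ru(2)[OF setting v P] by (simp add: modular_def)
  have "null_seq C v"
  \<comment> \<open>The criterion \<open>null_seq_uniform\<close> is for nonnegative sequences, so
    it is applied to the absolute values.\<close>
  proof (rule null_seq_abs_squeeze[OF convC[OF setting]])
    show "\<bar>v n\<bar> \<le> \<bar>v n\<bar>" for n ..
    show "null_seq C (\<lambda>n. \<bar>v n\<bar>)"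
    proof (rule null_seq_uniform[OF setting P])
      fix e :: real assume e: "0 < e"
      let ?J = "{a * exp (-1)..b * exp 1}"
      define \<mu> where "\<mu> = measure MM ?J"
      define \<mu>' where "\<mu>' = measure MM {a..b}"
      have \<mu>: "0 \<le> \<mu>" "0 \<le> \<mu>'" by (simp_all add: \<mu>_def \<mu>'_def)
      have J: "?J \<in> fin_sets" "{a..b} \<in> fin_sets" using ab by (auto intro!: mellin_interval_fin)
      have J_sub: "{a..b} \<subseteq> {0<..}" using ab by auto
      \<comment> \<open>The part on the widened support and the part outside get
        \<open>e / 2\<close> each; the summand 1 keeps the denominator positive.\<close>
      define \<eta> where "\<eta> = e / (2 * (1 + \<mu>))"
      have \<eta>: "0 < \<eta>" "\<eta> * \<mu> \<le> e / 2" using e \<mu> by (auto simp: \<eta>_def field_simps)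
      have e': "0 < e / (2 * (1 + \<mu>'))" using e \<mu> by simp
      show "\<forall>\<^sub>F n in sequentially. \<bar>v n\<bar> \<le> e *\<^sub>R ?P"
        using operator_uniform[OF \<eta>(1)] order_tendstoD(2)[OF rescaled_tail[OF \<psi> zero_less_one] e']
      proof eventually_elim
        case (elim n)
        define k where "k = outer 1 (rescaled \<psi> n)"
        have k: "kernel k" unfolding k_def by (intro kernel_outer kernel_rescaled \<psi>)
        have mass: "integrable MM (mass_on k {a..b})" "(LINT s|MM. mass_on k {a..b} s) = \<mu>' * tail 1 n"
          using mass_on_integrable[OF k _ J_sub J(2)] by (simp_all add: \<mu>'_def k_def)
        have ind: "integrable MM (indicat_real ?J)" "(LINT s|MM. indicat_real ?J s) = \<mu>"
          using integrable_mellin_indicator[OF J(1)] integral_mellin_indicator[OF J(1)]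
          by (simp_all only: \<mu>_def)
        let ?k = "\<lambda>s. \<eta> * indicat_real ?J s + mass_on k {a..b} s"
        have mass0: "0 \<le> mass_on k {a..b} s" if "0 < s" for s
          using ab by (intro mass_on_bounds(1)[OF k that]) auto
        have "\<bar>v n\<bar> \<le> (LINT s|MM. ?k s) *\<^sub>R ?P"
        proof (rule power_integral_bound[OF \<phi> v w_nonneg(2) b operator_diff_bounded])
          show "integrable MM ?k"
            by (rule Bochner_Integration.integrable_add[OF integrable_mult_right[OF ind(1)] mass(1)])
          fix s :: real assume s: "0 < s"
          show "0 \<le> ?k s \<and> \<bar>?F n s\<bar> \<le> ?k s *\<^sub>R u"
          proof
            show "0 \<le> ?k s" using \<eta> mass0[OF s] by simp
            show "\<bar>?F n s\<bar> \<le> ?k s *\<^sub>R u"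
            proof (cases "s \<in> ?J")
              case True
              have "\<bar>?F n s\<bar> \<le> \<eta> *\<^sub>R u" using elim(1) s by blast
              also have "\<dots> \<le> ?k s *\<^sub>R u"
                using True mass0[OF s] w_nonneg(2) by (intro scaleR_right_mono) auto
              finally show ?thesis .
            next
              case False
              then show ?thesis using operator_tail[OF s False, of n] by (simp add: k_def)
            qed
          qed
        qed
        also have "(LINT s|MM. ?k s) = \<eta> * \<mu> + \<mu>' * tail 1 n"
          using Bochner_Integration.integral_add[OF integrable_mult_right[OF ind(1), of \<eta>] mass(1)]
          by (simp only: integral_mult_right_zero ind(2) mass(2))
        also have "(\<eta> * \<mu> + \<mu>' * tail 1 n) *\<^sub>R ?P \<le> e *\<^sub>R ?P"
        proof (rule scaleR_right_mono[OF _ P])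
          have "\<mu>' * tail 1 n \<le> \<mu>' * (e / (2 * (1 + \<mu>')))"
            using elim(2) \<mu> by (intro mult_left_mono) auto
          also have "\<dots> \<le> e / 2" using e \<mu> by (simp add: field_simps)
          finally show "\<eta> * \<mu> + \<mu>' * tail 1 n \<le> e" using \<eta> by simp
        qed
        finally show ?case .
      qed
    qed simp
  qed
  moreover have "T n \<in> orlicz_space C lb R \<phi>" for n
    by (rule in_orlicz_space[OF \<phi> setting q vT w_nonneg(2) w_nonneg(2) operator_bounded])
  moreover have "f \<in> orlicz_space C lb R \<phi>"
    by (rule in_orlicz_space[OF \<phi> setting q vf w_nonneg(2) w_nonneg(2) f_bounded])
  ultimately show ?thesis
    unfolding modularly_convergent_with_def modular using defined by blast
qed

end

theorem corollary4p11:
  fixes C :: "'x::dedekind_complete_vector_lattice convergence"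
    and lb :: "(nat \<Rightarrow> 'x) \<Rightarrow> 'x extended"
    and R :: "real convergence"
    and q :: nat
    and \<phi> :: "'x \<Rightarrow> 'x"
    and L :: "nat \<Rightarrow> real \<Rightarrow> real"
    and \<Upsilon> :: "nat \<Rightarrow> 'x \<Rightarrow> 'x"
    and M :: "'w measure" and F :: "('w \<Rightarrow> real) set" and cls :: "('w \<Rightarrow> real) \<Rightarrow> 'x"
    and r :: ennreal and clsr :: "(real \<Rightarrow> real) \<Rightarrow> 'x"
    and m :: "'x \<Rightarrow> 'x \<Rightarrow> 'x"
  assumes "convergence_setting C lb R"
    and "1 \<le> q"
    and "L = moment_kernel \<or> L = gauss_weierstrass_kernel \<or>
         (\<exists>p\<ge>2. L = poisson_cauchy_kernel p)"
    and "(\<forall>n u. \<Upsilon> n u = u) \<and>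
           (q = 1 \<and> (\<forall>u. \<phi> u = \<bar>u\<bar>) \<or>
            f_algebra_mult m \<and> f_algebra_power m q \<phi> \<or>
            function_space M F cls \<and> pointwise_power F cls q \<phi>)
         \<or>
         is_Lr r clsr \<and> pointwise_power (Lr_functions r) clsr q \<phi> \<and>
           (\<forall>n. \<forall>h\<in>Lr_functions r.
              \<Upsilon> n (clsr h) = clsr (\<lambda>x. real n * h x * \<bar>h x\<bar> / (real n * \<bar>h x\<bar> + 1)))"
  shows "let K = product_kernel L \<Upsilon>; T = mellin_operator C lb R K in
    (\<forall>f\<in>Cc.
       (\<forall>n. \<forall>s>0. vl_integrable C lb R (\<lambda>t. K n (t / s) (f t))) \<and>
       sup_null C (\<lambda>n. (\<lambda>s. \<bar>T f n s - f s\<bar>) ` {0<..})) \<and>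
    (\<exists>a>0. \<forall>f\<in>Cc. modularly_convergent_with C lb R \<phi> a (T f) f)"
proof -
  obtain \<psi> where \<psi>: "kernel \<psi>" "(LINT x|lborel. \<psi> x) = 1" "\<And>n t. 0 < t \<Longrightarrow> L n t = rescaled \<psi> n (ln t)"
    using kernel_profile[OF assms(3)] by blast
  \<comment> \<open>The cases of the statement are reduced to two properties, and only these enter
    the convergence proof.\<close>
  have "power_like q \<phi> \<and> (\<exists>E. near_identity \<Upsilon> E)"
    using assms(4)
  proof (elim disjE conjE)
    assume "\<forall>n u. \<Upsilon> n u = u" "q = 1" "\<forall>u. \<phi> u = \<bar>u\<bar>"
    then show ?thesis using power_like_abs near_identity_linear by blast
  next
    assume lin: "\<forall>n u. \<Upsilon> n u = u" and m: "f_algebra_mult m" "f_algebra_power m q \<phi>"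
    have "power_like q \<phi>"
      by (rule power_like_iterate[of m, OF _ _ assms(2)])
         (use m in \<open>auto simp: f_algebra_mult_def f_algebra_power_def\<close>)
    then show ?thesis using lin near_identity_linear by blast
  next
    assume "\<forall>n u. \<Upsilon> n u = u" "function_space M F cls" "pointwise_power F cls q \<phi>"
    then show ?thesis using power_like_pointwise[OF _ assms(2)] near_identity_linear by blast
  next
    assume Lr: "is_Lr r clsr" and \<phi>: "pointwise_power (Lr_functions r) clsr q \<phi>"
      and \<Upsilon>: "\<forall>n. \<forall>h\<in>Lr_functions r.
        \<Upsilon> n (clsr h) = clsr (\<lambda>x. real n * h x * \<bar>h x\<bar> / (real n * \<bar>h x\<bar> + 1))"
    have "power_like q \<phi>"
      by (rule power_like_pointwise[OF _ assms(2) \<phi>]) (use Lr in \<open>simp add: is_Lr_def\<close>)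
    then show ?thesis using near_identity_saturation[OF Lr] \<Upsilon> by blast
  qed
  then obtain E where \<phi>: "power_like q \<phi>" and E: "near_identity \<Upsilon> E" by blast
  \<comment> \<open>The vector is enlarged by \<open>E\<close>, so that it dominates the values and
    modulus of \<open>f\<close> as well as the distance of the nonlinear factors from the
    identity.\<close>
  have step: "\<exists>a b w. steppable a b w f \<and> E \<le> w" if f: "f \<in> Cc" for f
  proof -
    obtain a b w where g: "steppable a b w f" using Cc_steppable[OF f] by blast
    have "0 \<le> E" "0 \<le> w" using E g by (auto simp: near_identity_def steppable_def)
    then have "steppable a b (w + E) f \<and> E \<le> w + E" using steppable_mono[OF g, of "w + E"] by simp
    then show ?thesis by blast
  qed
  have "(\<forall>n. \<forall>s>0. vl_integrable C lb R (\<lambda>t. product_kernel L \<Upsilon> n (t / s) (f t))) \<and>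
       sup_null C (\<lambda>n. (\<lambda>s. \<bar>mellin_operator C lb R (product_kernel L \<Upsilon>) f n s - f s\<bar>) ` {0<..}) \<and>
       modularly_convergent_with C lb R \<phi> 1 (mellin_operator C lb R (product_kernel L \<Upsilon>) f) f"
    if "f \<in> Cc" for f
  proof -
    obtain a b w where f: "steppable a b w f" "E \<le> w" using step[OF \<open>f \<in> Cc\<close>] by blast
    note hyps = assms(1) \<psi> E f
    show ?thesis
      using operator_integrable[OF hyps] operator_sup_null[OF hyps] operator_modular[OF hyps \<phi> assms(2)] by blast
  qed
  \<comment> \<open>The constant \<open>a = 1\<close> serves every \<open>f\<close>.\<close>
  then show ?thesis unfolding Let_def by (meson zero_less_one)
qed

end
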